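(* Let $(e_i)$ be a normalized Schauder basis of a reflexive Banach space $X$ which is $C$-Schreier unconditional for some $C<\infty$, i.e. $$\Big\|\sum_{i\in F}a_ie_i\Big\|\le C\Big\|\sum_i a_ie_i\Big\|$$ for all $F\in S_1$ and all scalars $(a_i)$. If $|SP_w(X)|=|SP_w(X^* )|=1$, then the unique spreading model in $SP_w(X)$ is equivalent to the unit vector basis of $c_0$ or of $\ell_p$ for some $1\le p<\infty$.
   Context: $S_1$ (the first Schreier class) is the family of finite sets $F\subseteq\mathbb N$ with $|F|\le\min F$. A normalized basic sequence $(x_i)$ generates a spreading model $(\tilde x_i)$ if there exist $\varepsilon_n\downarrow 0$ such that for all $n$, all $(a_i)_{i=1}^n\subseteq[-1,1]$ and all $n\le k_1<\cdots<k_n$, $(1+\varepsilon_n)^{-1}\|\sum_{i=1}^n a_i\tilde x_i\|\le\|\sum_{i=1}^n a_ix_{k_i}\|\le(1+\varepsilon_n)\|\sum_{i=1}^n a_i\tilde x_i\|$. Two sequences are equivalent if each dominates the other up to a constant, i.e. $C^{-1}\|\sum a_iv_i\|\le\|\sum a_iu_i\|\le C\|\sum a_iv_i\|$ for all finitely supported $(a_i)$. $SP_w(Z)$ is the set of equivalence classes of spreading models generated by normalized weakly null sequences in $Z$. *)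

theory Defs
  imports "HOL-Analysis.Analysis"
begin

(* Real Banach spaces are modelled by types of class banach; the dual X* is the
type of bounded linear functionals 'a =>L real. Sequences are indexed from 1
(index 0 is ignored). *)

definition reflexive_space :: "'a::real_normed_vector itself \<Rightarrow> bool" where
  "reflexive_space _ \<longleftrightarrow>
     surj (\<lambda>x::'a. Blinfun (\<lambda>f::'a \<Rightarrow>\<^sub>L real. blinfun_apply f x))"

definition schauder_basis :: "(nat \<Rightarrow> 'a::real_normed_vector) \<Rightarrow> bool" where
  "schauder_basis e \<longleftrightarrow>
     (\<forall>x. \<exists>!a::nat \<Rightarrow> real. a 0 = 0 \<and> (\<lambda>n. \<Sum>i=1..n. a i *\<^sub>R e i) \<longlonglongrightarrow> x)"

definition normalized_seq :: "(nat \<Rightarrow> 'a::real_normed_vector) \<Rightarrow> bool" where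
  "normalized_seq x \<longleftrightarrow> (\<forall>i\<ge>1. norm (x i) = 1)"

definition schreier1 :: "nat set set" where
  "schreier1 = {F. finite F \<and> (F \<noteq> {} \<longrightarrow> card F \<le> Min F)}"

definition schreier_unconditional :: "real \<Rightarrow> (nat \<Rightarrow> 'a::real_normed_vector) \<Rightarrow> bool" where
  "schreier_unconditional C e \<longleftrightarrow>
     (\<forall>F\<in>schreier1. \<forall>(a::nat \<Rightarrow> real) x.
        (\<lambda>n. \<Sum>i=1..n. a i *\<^sub>R e i) \<longlonglongrightarrow> x \<longrightarrow>
        norm (\<Sum>i\<in>F. a i *\<^sub>R e i) \<le> C * norm x)"

definition weakly_null :: "(nat \<Rightarrow> 'a::real_normed_vector) \<Rightarrow> bool" where
  "weakly_null x \<longleftrightarrow> (\<forall>f::'a \<Rightarrow>\<^sub>L real. (\<lambda>n. blinfun_apply f (x n)) \<longlonglongrightarrow> 0)"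

(* A spreading model (x~_i)_{i>=1} (in some normed space) is represented by the
function N with N(a) = norm (sum_i a_i x~_i) for finitely supported a; such N are
exactly the seminorms on finitely supported sequences. *)

definition trunc :: "nat \<Rightarrow> (nat \<Rightarrow> real) \<Rightarrow> nat \<Rightarrow> real" where
  "trunc n a = (\<lambda>i. if i \<in> {1..n} then a i else 0)"

definition sm_seminorm :: "((nat \<Rightarrow> real) \<Rightarrow> real) \<Rightarrow> bool" where
  "sm_seminorm N \<longleftrightarrow>
     (\<forall>n a b. N (trunc n (\<lambda>i. a i + b i)) \<le> N (trunc n a) + N (trunc n b)) \<and>
     (\<forall>n c a. N (trunc n (\<lambda>i. c * a i)) = \<bar>c\<bar> * N (trunc n a))"

definition generates_spreading_model ::
    "(nat \<Rightarrow> 'a::real_normed_vector) \<Rightarrow> ((nat \<Rightarrow> real) \<Rightarrow> real) \<Rightarrow> bool" where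
  "generates_spreading_model x N \<longleftrightarrow> sm_seminorm N \<and>
     (\<exists>\<epsilon>::nat \<Rightarrow> real. decseq \<epsilon> \<and> \<epsilon> \<longlonglongrightarrow> 0 \<and>
        (\<forall>n (a::nat \<Rightarrow> real) (k::nat \<Rightarrow> nat).
           (\<forall>i\<in>{1..n}. \<bar>a i\<bar> \<le> 1) \<and> strict_mono_on {1..n} k \<and> n \<le> k 1 \<longrightarrow>
             N (trunc n a) / (1 + \<epsilon> n) \<le> norm (\<Sum>i=1..n. a i *\<^sub>R x (k i)) \<and>
             norm (\<Sum>i=1..n. a i *\<^sub>R x (k i)) \<le> (1 + \<epsilon> n) * N (trunc n a)))"

definition sm_equiv :: "((nat \<Rightarrow> real) \<Rightarrow> real) \<Rightarrow> ((nat \<Rightarrow> real) \<Rightarrow> real) \<Rightarrow> bool" where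
  "sm_equiv N M \<longleftrightarrow> (\<exists>C>0. \<forall>n a.
     N (trunc n a) \<le> C * M (trunc n a) \<and> M (trunc n a) \<le> C * N (trunc n a))"

definition weak_sm :: "(nat \<Rightarrow> 'a::real_normed_vector) \<Rightarrow> ((nat \<Rightarrow> real) \<Rightarrow> real) \<Rightarrow> bool" where
  "weak_sm x N \<longleftrightarrow> normalized_seq x \<and> weakly_null x \<and> generates_spreading_model x N"

definition SPw_card_one :: "'a::real_normed_vector itself \<Rightarrow> bool" where
  "SPw_card_one _ \<longleftrightarrow>
     (\<exists>(x::nat \<Rightarrow> 'a) N. weak_sm x N) \<and>
     (\<forall>(x::nat \<Rightarrow> 'a) N (y::nat \<Rightarrow> 'a) M. weak_sm x N \<and> weak_sm y M \<longrightarrow> sm_equiv N M)"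

definition sm_equiv_c0 :: "((nat \<Rightarrow> real) \<Rightarrow> real) \<Rightarrow> bool" where
  "sm_equiv_c0 N \<longleftrightarrow> (\<exists>C>0. \<forall>n\<ge>1. \<forall>a.
     N (trunc n a) \<le> C * Max ((\<lambda>i. \<bar>a i\<bar>) ` {1..n}) \<and>
     Max ((\<lambda>i. \<bar>a i\<bar>) ` {1..n}) \<le> C * N (trunc n a))"

definition sm_equiv_lp :: "real \<Rightarrow> ((nat \<Rightarrow> real) \<Rightarrow> real) \<Rightarrow> bool" where
  "sm_equiv_lp p N \<longleftrightarrow> (\<exists>C>0. \<forall>n a.
     N (trunc n a) \<le> C * (\<Sum>i=1..n. \<bar>a i\<bar> powr p) powr (1/p) \<and>
     (\<Sum>i=1..n. \<bar>a i\<bar> powr p) powr (1/p) \<le> C * N (trunc n a))"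

end

theory Submission
  imports Defs "HOL-Library.Ramsey" "HOL-Library.Diagonal_Subsequence"
begin

text \<open>Reflexivity makes the basis \<open>e\<close> and its coordinate functionals weakly null; along a common
subsequence they generate spreading models \<open>N\<close> and \<open>M\<close>, which are unconditional and, by Schreier
unconditionality, dual to each other up to a constant.

Let \<open>a \<otimes> b\<close> be the vector obtained by replacing the \<open>i\<close>-th unit vector by the \<open>i\<close>-th of
consecutive copies of \<open>b\<close>. If \<open>N (a \<otimes> b) \<le> K * N a * N b\<close> failed for every \<open>K\<close>, with witnesses
\<open>a\<^sub>p\<close>, \<open>b\<^sub>p\<close> for \<open>K = 4 ^ p\<close>, then the block sequence whose terms are sums over \<open>p\<close> of copies of
\<open>2 ^ (-p)\<close> times \<open>b\<^sub>p\<close> would generate a spreading model not dominated by \<open>N\<close>, contradicting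
uniqueness. The same holds for \<open>M\<close>, and duality turns the estimate for \<open>M\<close> into the reverse
estimate for \<open>N\<close>.

Hence the norm of a sum of \<open>n\<close> unit vectors grows like \<open>n powr s\<close>. For the vector \<open>v\<close> which is
the sum over \<open>j \<le> L\<close> of \<open>2 powr (-s j)\<close> times the indicator of the \<open>2 ^ j\<close> multiples of
\<open>2 ^ (L - j)\<close>, concatenating two copies of \<open>v\<close> amounts to multiplying it by \<open>2 powr s\<close>, up to a
bounded error. If \<open>N v\<close> is unbounded in \<open>L\<close>, coefficients can thus be traded for multiplicities and
\<open>N\<close> is equivalent to the norm of \<open>l\<^sub>p\<close> with \<open>p = 1/s\<close>; otherwise the pairing of \<open>v\<close> with its
counterpart for the dual exponent shows that this applies to \<open>M\<close>.\<close>

section \<open>Subsymmetric norms on finitely supported sequences\<close>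

text \<open>Growth of order \<open>n powr s\<close> does not determine a norm: Lorentz norms share
  it with \<open>l\<^sub>p\<close>. The two-sided tensor estimate supplies the rest, but
  \<open>N\<close> is invariant only under spreading, not under permutations, so a test vector has
  to reproduce itself in its order and not merely in its distribution. Equally spaced indicators do
  this: a stretched copy of \<open>v\<close> and two copies of \<open>v\<close> in a row consist of
  the same equally spaced sets with the levels shifted by one, so only extreme levels are left over.
  That remainder has a fixed size and disappears after division by \<open>N v\<close> exactly when
  \<open>N v\<close> can be made large; this is why boundedness is the dividing line.

  Schreier sets are rich enough for the block construction because selecting the \<open>p\<close>-th
  pieces in a combination of blocks involves a number of coordinates that stays fixed while the
  blocks move to infinity. The weights \<open>2 ^ (-p)\<close> keep the blocks bounded and leave a
  factor \<open>2 ^ p\<close> of the excess \<open>4 ^ p\<close>. Such projections bound the new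
  model only from below, so uniqueness can give only an upper estimate for tensor products; the
  lower one has to come from the dual space.\<close>

text \<open>Finitely supported vectors are total functions with an explicit length. Indices start at
  0 up to the interface with the statement, where they start at 1.\<close>

definition below :: "nat \<Rightarrow> (nat \<Rightarrow> real) \<Rightarrow> bool" where
  "below n f \<longleftrightarrow> (\<forall>i\<ge>n. f i = 0)"

definition tens :: "nat \<Rightarrow> (nat \<Rightarrow> real) \<Rightarrow> (nat \<Rightarrow> real) \<Rightarrow> nat \<Rightarrow> real" where
  "tens m a b = (\<lambda>i. a (i div m) * b (i mod m))"

lemma belowD: "below n f \<Longrightarrow> n \<le> i \<Longrightarrow> f i = 0"
  by (simp add: below_def)

lemma below_lt: "below n f \<Longrightarrow> f i \<noteq> 0 \<Longrightarrow> i < n"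
  by (meson below_def not_le_imp_less)

lemma below_mono: "below n f \<Longrightarrow> n \<le> m \<Longrightarrow> below m f"
  by (simp add: below_def)

lemma below_add: "below n f \<Longrightarrow> below n g \<Longrightarrow> below n (\<lambda>i. f i + g i)"
  by (simp add: below_def)

lemma below_scale: "below n f \<Longrightarrow> below n (\<lambda>i. t * f i)"
  by (simp add: below_def)

lemma below_sum: "(\<And>j. j \<in> J \<Longrightarrow> below n (g j)) \<Longrightarrow> below n (\<lambda>i. \<Sum>j\<in>J. g j i)"
  by (simp add: below_def)

lemma below_bounded:
  assumes "below n f"
  shows "\<exists>\<mu>>0. \<forall>i. \<bar>f i\<bar> \<le> \<mu>"
proof (intro exI[of _ "(\<Sum>i<n. \<bar>f i\<bar>) + 1"] conjI allI)
  fix i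
  have "\<bar>f i\<bar> \<le> (\<Sum>i<n. \<bar>f i\<bar>)"
    using belowD[OF assms] by (cases "i < n") (auto intro!: member_le_sum sum_nonneg)
  then show "\<bar>f i\<bar> \<le> (\<Sum>i<n. \<bar>f i\<bar>) + 1" by simp
qed (simp add: add_nonneg_pos sum_nonneg)

lemma below_tens:
  assumes "below n a" "below m b" shows "below (n * m) (tens m a b)"
  unfolding below_def tens_def
proof (intro allI impI)
  fix i assume i: "n * m \<le> i"
  show "a (i div m) * b (i mod m) = 0"
  proof (cases "m = 0")
    case True
    then show ?thesis using assms(2) by (simp add: below_def)
  next
    case False
    then have "n \<le> i div m"
      using i by (metis div_le_mono nonzero_mult_div_cancel_right)
    then show ?thesis using assms(1) by (simp add: below_def)
  qed
qed

section \<open>Growth exponents of almost multiplicative sequences\<close>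

text \<open>A two-sided Fekete argument: \<open>p k = log 2 (l (2 ^ k))\<close> is additive up to
  \<open>L = log 2 K\<close> in both directions, so it stays within \<open>L\<close> of a linear
  function \<open>s * k\<close>. Monotonicity forces \<open>0 \<le> s\<close>, the linear bound
  forces \<open>s \<le> 1\<close>, and monotonicity interpolates between powers of 2.\<close>

lemma exponent_exists:
  fixes l :: "nat \<Rightarrow> real"
  assumes pos: "\<And>n. n \<ge> 1 \<Longrightarrow> l n > 0" and K: "K > 0" and C: "C > 0"
    and sub: "\<And>n m. l (n * m) \<le> K * (l n * l m)"
    and super: "\<And>n m. l n * l m \<le> K * l (n * m)"
    and mono: "\<And>n m. n \<le> m \<Longrightarrow> l n \<le> C * l m"
    and lin: "\<And>n. l n \<le> real n * l 1"
  shows "\<exists>s D. 0 \<le> s \<and> s \<le> 1 \<and> D > 0 \<and>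
    (\<forall>n\<ge>1. real n powr s \<le> D * l n \<and> l n \<le> D * real n powr s)"
proof -
  define p where "p k = log 2 (l (2 ^ k))" for k :: nat
  define L where "L = log 2 K"
  have lp: "l (2 ^ k) = 2 powr p k" for k
    using pos[of "2 ^ k"] by (simp add: p_def)
  have KL: "K = 2 powr L" using K by (simp add: L_def)
  have sub': "p (k + j) \<le> L + (p k + p j)" for k j
  proof -
    have "2 powr p (k + j) \<le> 2 powr (L + (p k + p j))"
      using sub[of "2 ^ k" "2 ^ j"] by (simp add: power_add[symmetric] lp KL powr_add)
    then show ?thesis by simp
  qed
  have super': "p k + p j \<le> L + p (k + j)" for k j
  proof -
    have "2 powr (p k + p j) \<le> 2 powr (L + p (k + j))"
      using super[of "2 ^ k" "2 ^ j"] by (simp add: power_add[symmetric] lp KL powr_add)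
    then show ?thesis by simp
  qed
  have subm: "p (k * Suc j) + L \<le> real (Suc j) * (p k + L)" for k j
  proof (induction j)
    case (Suc j)
    have "p (k * Suc (Suc j)) \<le> L + (p k + p (k * Suc j))"
      using sub'[of k "k * Suc j"] by (simp add: algebra_simps)
    with Suc show ?case by (simp add: algebra_simps)
  qed simp
  have superm: "real (Suc j) * (p k - L) \<le> p (k * Suc j) - L" for k j
  proof (induction j)
    case (Suc j)
    have "p k + p (k * Suc j) \<le> L + p (k * Suc (Suc j))"
      using super'[of k "k * Suc j"] by (simp add: algebra_simps)
    with Suc show ?case by (simp add: algebra_simps)
  qed simp
  have L0: "p 0 \<le> L + (p 0 + p 0)" "p 0 + p 0 \<le> L + p 0"
    using sub'[of 0 0] super'[of 0 0] by simp_all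
  then have Lnn: "0 \<le> L" by linarith
  \<comment> \<open>Both quotients are compared through \<open>p (k * j)\<close>, split once into
    \<open>j\<close> summands \<open>p k\<close> and once into \<open>k\<close> summands
    \<open>p j\<close>.\<close>
  have cross: "(p k - L) / real k \<le> (p j + L) / real j" if kj1: "k \<ge> 1" "j \<ge> 1" for k j
  proof -
    obtain k' j' where kj: "k = Suc k'" "j = Suc j'" using kj1 by (cases k; cases j) auto
    have "real j * (p k - L) \<le> p (k * j) - L" using superm[of j' k] kj by simp
    also have "\<dots> \<le> p (k * j) + L" using Lnn by simp
    also have "\<dots> \<le> real k * (p j + L)" using subm[of j k'] kj by (simp add: mult.commute)
    finally show ?thesis using kj1 by (simp add: field_simps)
  qed
  define s where "s = (INF j\<in>{1..}. (p j + L) / real j)"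
  have bdd: "bdd_below ((\<lambda>j. (p j + L) / real j) ` {1..})"
    by (rule bdd_belowI2[of _ "(p 1 - L) / real 1"]) (use cross[of 1] in auto)
  have s_le: "s * real j \<le> p j + L" if "j \<ge> 1" for j
  proof -
    have "s \<le> (p j + L) / real j" unfolding s_def by (rule cINF_lower[OF bdd]) (use that in simp)
    then show ?thesis using that by (simp add: field_simps)
  qed
  have s_ge: "p k - L \<le> s * real k" if "k \<ge> 1" for k
  proof -
    have "(p k - L) / real k \<le> s" unfolding s_def
      by (rule cINF_greatest) (use cross that in auto)
    then show ?thesis using that by (simp add: field_simps)
  qed
  have s_le': "s * real j \<le> p j + L" for j
    using s_le[of j] L0 by (cases j) auto
  have s_ge': "p k \<le> s * real k + L" for k
    using s_ge[of k] L0 by (cases k) auto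
  have s0: "0 \<le> s"
  proof (rule ccontr)
    assume "\<not> 0 \<le> s"
    then obtain k where k: "real k * (- s) > log 2 C - p 0 + L"
      using reals_Archimedean3[of "-s"] by auto
    have "2 powr p 0 \<le> 2 powr (log 2 C + p k)"
      using mono[of "2 ^ 0" "2 ^ k"] C unfolding lp by (simp add: powr_add)
    then have "p 0 \<le> log 2 C + p k" by simp
    with s_ge'[of k] k show False by (simp add: algebra_simps)
  qed
  have s1: "s \<le> 1"
  proof (rule ccontr)
    assume "\<not> s \<le> 1"
    then obtain k where k: "real k * (s - 1) > p 0 + L"
      using reals_Archimedean3[of "s - 1"] by auto
    have "2 powr p k \<le> 2 powr (real k + p 0)"
      using lin[of "2 ^ k"] lp[of k] lp[of 0] by (simp add: powr_add powr_realpow)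
    then have "p k \<le> real k + p 0" by simp
    with s_le'[of k] k show False by (simp add: algebra_simps)
  qed
  \<comment> \<open>\<open>2 powr L\<close> is the additive error of \<open>p\<close>, the factor 2
    pays for passing from \<open>2 ^ k\<close> to \<open>2 ^ Suc k\<close> with
    \<open>s \<le> 1\<close>, and \<open>C\<close> for monotonicity.\<close>
  define D where "D = 2 powr (1 + L) * C"
  have D: "D > 0" unfolding D_def using C by simp
  have "real n powr s \<le> D * l n \<and> l n \<le> D * real n powr s" if n0: "n \<ge> 1" for n
  proof -
    obtain k where k: "2 ^ k \<le> n" "n < 2 ^ (Suc k)"
      using ex_power_ivl1[of 2 n] n0 by auto
    have pw: "2 powr (s * real j) = (2 ^ j) powr s" for j
      by (simp add: powr_powr powr_realpow[symmetric] mult.commute)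
    have n1: "real n \<le> 2 ^ Suc k" using k(2) by (metis less_imp_le of_nat_le_iff of_nat_numeral of_nat_power)
    have n2: "2 ^ k \<le> real n" using k(1) by (metis of_nat_le_iff of_nat_numeral of_nat_power)
    have "real n powr s \<le> (2 ^ Suc k) powr s" by (rule powr_mono2) (use s0 n1 in auto)
    also have "\<dots> = 2 powr (s * real (Suc k))" by (simp only: pw)
    also have "\<dots> \<le> 2 powr (1 + L + p k)" using s_le'[of k] s1 by (simp add: algebra_simps)
    also have "\<dots> = 2 powr (1 + L) * l (2 ^ k)" by (simp add: lp powr_add)
    also have "\<dots> \<le> 2 powr (1 + L) * (C * l n)" by (intro mult_left_mono mono k) simp
    finally have 1: "real n powr s \<le> D * l n" by (simp add: D_def)
    have "l n \<le> C * l (2 ^ Suc k)" by (rule mono) (use k in simp)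
    also have "\<dots> = C * 2 powr p (Suc k)" by (simp only: lp)
    also have "\<dots> \<le> C * 2 powr (1 + L + s * real k)"
      using s_ge'[of "Suc k"] s1 C by (simp add: algebra_simps)
    also have "\<dots> = D * (2 ^ k) powr s" by (simp add: D_def powr_add pw)
    also have "\<dots> \<le> D * real n powr s"
      by (intro mult_left_mono powr_mono2) (use s0 n2 D in auto)
    finally show ?thesis using 1 by simp
  qed
  with s0 s1 D show ?thesis by blast
qed

section \<open>Unconditional norms invariant under spreading\<close>

text \<open>\<open>mono\<close> is unconditionality with constant \<open>C\<close>. The side
  condition of \<open>spread\<close> asks only that \<open>k\<close> reach the support, so the rule
  inserts and deletes zero coordinates alike. \<open>coord\<close> makes \<open>N\<close> definite
  on finitely supported vectors. The function \<open>lam\<close> is the fundamental function of the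
  norm.\<close>

locale subsym =
  fixes N :: "(nat \<Rightarrow> real) \<Rightarrow> real" and C c :: real
  assumes triangle: "below n f \<Longrightarrow> below n g \<Longrightarrow> N (\<lambda>i. f i + g i) \<le> N f + N g"
    and scale: "below n f \<Longrightarrow> N (\<lambda>i. t * f i) = \<bar>t\<bar> * N f"
    and spread: "below n f \<Longrightarrow> strict_mono k \<Longrightarrow> {i. f i \<noteq> 0} \<subseteq> range k \<Longrightarrow> N (\<lambda>i. f (k i)) = N f"
    and mono: "below n g \<Longrightarrow> (\<And>i. \<bar>f i\<bar> \<le> \<bar>g i\<bar>) \<Longrightarrow> N f \<le> C * N g"
    and coord: "below n f \<Longrightarrow> c * \<bar>f j\<bar> \<le> N f"
    and c_pos: "c > 0"
begin

definition lam :: "nat \<Rightarrow> real" where "lam n = N (\<lambda>i. if i < n then 1 else 0)"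

lemma N_zero: "N (\<lambda>_. 0) = 0"
  using scale[of 0 "\<lambda>_. 0" 0] by (simp add: below_def)

lemma N_nonneg: "below n f \<Longrightarrow> 0 \<le> N f"
  using coord[of n f 0] c_pos by (smt (verit) mult_nonneg_nonneg)

lemma N_pos: "below n f \<Longrightarrow> f j \<noteq> 0 \<Longrightarrow> 0 < N f"
  using coord[of n f j] c_pos by (smt (verit) mult_pos_pos zero_less_abs_iff)

lemma N_sum:
  assumes "finite J" "\<And>j. j \<in> J \<Longrightarrow> below n (g j)"
  shows "N (\<lambda>i. \<Sum>j\<in>J. g j i) \<le> (\<Sum>j\<in>J. N (g j))"
  using assms
proof (induction J rule: finite_induct)
  case empty
  then show ?case by (simp add: N_zero)
next
  case (insert x F)
  have "N (\<lambda>i. g x i + (\<Sum>j\<in>F. g j i)) \<le> N (g x) + N (\<lambda>i. \<Sum>j\<in>F. g j i)"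
    by (rule triangle[of n]) (use insert below_sum[of F n g] in auto)
  with insert show ?case by simp
qed

lemma N_diff_le:
  assumes "below n f" "below n g" "below n h" "\<And>i. f i + h i = g i + r i" "below n r"
  shows "N f \<le> N g + N r + N h"
proof -
  have "N (\<lambda>i. g i + r i + (-1) * h i) \<le> N (\<lambda>i. g i + r i) + N (\<lambda>i. (-1) * h i)"
    by (rule triangle[of n]) (use assms below_scale[of n h "-1"] in \<open>auto intro!: below_add\<close>)
  also have "N (\<lambda>i. g i + r i) \<le> N g + N r" by (rule triangle[of n]) (use assms in auto)
  also have "N (\<lambda>i. (-1) * h i) = N h" using scale[of n h "-1"] assms by simp
  also have "(\<lambda>i. g i + r i + (-1) * h i) = f" using assms(4) by (auto simp: algebra_simps intro!: ext)
  finally show ?thesis by simp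
qed

text \<open>Spreading along an enumeration of \<open>T\<close> turns its indicator into that of an
  initial segment, so only the cardinality matters.\<close>

lemma N_indicator:
  assumes "finite T"
  shows "N (\<lambda>i. if i \<in> T then t else 0) = \<bar>t\<bar> * lam (card T)"
proof -
  define f :: "nat \<Rightarrow> real" where "f = (\<lambda>i. if i \<in> T then 1 else 0)"
  \<comment> \<open>\<open>q\<close> lies beyond \<open>T\<close>. The enumeration of
    \<open>T\<close> is continued there because \<open>spread\<close> wants \<open>k\<close>
    strictly increasing on all of \<open>nat\<close>.\<close>
  define q where "q = (if T = {} then 0 else Suc (Max T))"
  have q: "x < q" if "x \<in> T" for x
    using that assms by (auto simp: q_def less_Suc_eq_le)
  define k where "k i = (if i < card T then sorted_list_of_set T ! i else q + i)" for i
  have len: "length (sorted_list_of_set T) = card T" by simp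
  have kT: "k i \<in> T \<longleftrightarrow> i < card T" for i
  proof (cases "i < card T")
    case True
    then have "sorted_list_of_set T ! i \<in> set (sorted_list_of_set T)" by (intro nth_mem) simp
    then show ?thesis using True assms by (simp add: k_def)
  next
    case False
    then show ?thesis using q[of "q + i"] by (auto simp: k_def)
  qed
  have "strict_mono k"
  proof (rule strict_monoI)
    fix i j :: nat assume ij: "i < j"
    show "k i < k j"
    proof (cases "j < card T")
      case True
      then show ?thesis using ij sorted_wrt_nth_less[OF strict_sorted_list_of_set, of i j T] by (simp add: k_def)
    next
      case False
      have "k i < q + j"
      proof (cases "i < card T")
        case True
        then show ?thesis using q[of "k i"] kT[of i] by simp
      next
        case False
        then show ?thesis using ij by (simp add: k_def)
      qed
      then show ?thesis using False by (simp add: k_def)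
    qed
  qed
  moreover have "{i. f i \<noteq> 0} \<subseteq> range k"
  proof
    fix x assume "x \<in> {i. f i \<noteq> 0}"
    then have "x \<in> set (sorted_list_of_set T)" using assms by (auto simp: f_def split: if_splits)
    then obtain i where "i < card T" "sorted_list_of_set T ! i = x" by (metis in_set_conv_nth len)
    then show "x \<in> range k" by (metis k_def rangeI)
  qed
  moreover have bf: "below q f" using q by (auto simp: below_def f_def dest: leD)
  ultimately have "N (\<lambda>i. f (k i)) = N f" by (intro spread[of q])
  moreover have "(\<lambda>i. f (k i)) = (\<lambda>i. if i < card T then 1 else 0)" by (simp add: f_def kT)
  ultimately have "N f = lam (card T)" by (simp add: lam_def)
  moreover have "N (\<lambda>i. t * f i) = \<bar>t\<bar> * N f" by (rule scale[OF bf])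
  moreover have "(\<lambda>i. t * f i) = (\<lambda>i. if i \<in> T then t else 0)" by (auto simp: f_def)
  ultimately show ?thesis by simp
qed

lemma lam_pos: "n \<ge> 1 \<Longrightarrow> lam n > 0"
  unfolding lam_def by (rule N_pos[of n _ 0]) (auto simp: below_def)

lemma lam_lin: "lam n \<le> real n * lam 1"
proof -
  have "N (\<lambda>i. \<Sum>j<n. if i \<in> {j} then 1 else 0) \<le> (\<Sum>j<n. N (\<lambda>i. if i \<in> {j} then 1 else 0))"
    by (rule N_sum[of _ n]) (auto simp: below_def)
  also have "\<dots> = real n * lam 1" by (subst N_indicator) auto
  also have "(\<lambda>i. \<Sum>j<n. if i \<in> {j} then 1 else 0) = (\<lambda>i. if i < n then 1 else (0::real))"
    by (auto simp: intro!: ext)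
  finally show ?thesis by (simp add: lam_def)
qed

lemma lam_mono: "n \<le> m \<Longrightarrow> lam n \<le> C * lam m"
  unfolding lam_def by (rule mono[of m]) (auto simp: below_def)

lemma C_pos: "C > 0"
proof -
  have "0 < lam 1" by (rule lam_pos) simp
  moreover have "lam 1 \<le> C * lam 1" by (rule lam_mono) simp
  ultimately show ?thesis by (smt (verit) mult_nonpos_nonneg)
qed

lemma N_le_sup:
  assumes "below n f" "\<And>i. \<bar>f i\<bar> \<le> \<mu>"
  shows "N f \<le> C * (\<mu> * lam n)"
proof -
  have "\<mu> \<ge> 0" using assms(2)[of 0] by linarith
  have b: "below n (\<lambda>i. if i < n then 1 else 0)" by (simp add: below_def)
  have "N f \<le> C * N (\<lambda>i. \<mu> * (if i < n then 1 else 0))"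
    by (rule mono[of n]) (use assms belowD[OF assms(1)] \<open>\<mu> \<ge> 0\<close> in \<open>auto simp: below_def\<close>)
  also have "N (\<lambda>i. \<mu> * (if i < n then 1 else 0)) = \<mu> * lam n"
    unfolding lam_def using scale[OF b, of \<mu>] \<open>\<mu> \<ge> 0\<close> by simp
  finally show ?thesis .
qed

lemma N_le_sum:
  assumes "below n f"
  shows "N f \<le> (\<Sum>i<n. \<bar>f i\<bar>) * lam 1"
proof -
  have "N (\<lambda>i. \<Sum>j<n. if i \<in> {j} then f j else 0) \<le> (\<Sum>j<n. N (\<lambda>i. if i \<in> {j} then f j else 0))"
    by (rule N_sum[of _ n]) (auto simp: below_def)
  also have "\<dots> = (\<Sum>i<n. \<bar>f i\<bar>) * lam 1" by (subst N_indicator) (auto simp: sum_distrib_right)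
  also have "(\<lambda>i. \<Sum>j<n. if i \<in> {j} then f j else 0) = f"
    using assms by (auto simp: below_def intro!: ext)
  finally show ?thesis .
qed

text \<open>Averaging over the cyclic shifts of a vector replaces it by a constant one, and a cyclic
  shift is the sum of two spread pieces of the original vector.\<close>

lemma average_le:
  assumes "below n f"
  shows "\<bar>\<Sum>i<n. f i\<bar> * lam n \<le> 2 * C * real n * N f"
proof (cases "n = 0")
  case True
  then show ?thesis by simp
next
  case False
  \<comment> \<open>In the rotation of \<open>f\<close> by \<open>j\<close>, \<open>g2 j\<close> is
    the part that does not wrap around and \<open>g1 j\<close> the part that does; each is a shifted
    truncation of \<open>f\<close>.\<close>
  define g1 where "g1 j i = (if i < n \<and> n \<le> i + j then f ((i + j) - n) else 0)" for j i
  define g2 where "g2 j i = (if i + j < n then f (i + j) else 0)" for j i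
  have b: "below n (g1 j)" "below n (g2 j)" for j by (auto simp: below_def g1_def g2_def)
  have g1: "N (g1 j) \<le> C * N f" if "j < n" for j
  proof -
    define h where "h i = (if i < j then f i else 0)" for i
    have "N (\<lambda>i. g1 j (i + (n - j))) = N (g1 j)"
    proof (rule spread[OF b(1)])
      show "strict_mono (\<lambda>i. i + (n - j))" by (simp add: strict_mono_def)
      show "{i. g1 j i \<noteq> 0} \<subseteq> range (\<lambda>i. i + (n - j))"
      proof
        fix x assume "x \<in> {i. g1 j i \<noteq> 0}"
        then have "n \<le> x + j" by (auto simp: g1_def split: if_splits)
        then have "x = (x - (n - j)) + (n - j)" by simp
        then show "x \<in> range (\<lambda>i. i + (n - j))" by blast
      qed
    qed
    moreover have "(\<lambda>i. g1 j (i + (n - j))) = h" using that by (auto simp: g1_def h_def fun_eq_iff)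
    moreover have "N h \<le> C * N f" by (rule mono[OF assms]) (auto simp: h_def)
    ultimately show ?thesis by simp
  qed
  have g2: "N (g2 j) \<le> C * N f" for j
  proof -
    define h where "h i = (if j \<le> i \<and> i < n then f i else 0)" for i
    have bh: "below n h" by (auto simp: below_def h_def)
    have "N (\<lambda>i. h (i + j)) = N h"
    proof (rule spread[OF bh])
      show "strict_mono (\<lambda>i. i + j)" by (simp add: strict_mono_def)
      show "{i. h i \<noteq> 0} \<subseteq> range (\<lambda>i. i + j)"
      proof
        fix x assume "x \<in> {i. h i \<noteq> 0}"
        then have "x = (x - j) + j" by (auto simp: h_def split: if_splits)
        then show "x \<in> range (\<lambda>i. i + j)" by blast
      qed
    qed
    moreover have "(\<lambda>i. h (i + j)) = g2 j" by (auto simp: g2_def h_def fun_eq_iff)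
    moreover have "N h \<le> C * N f" by (rule mono[OF assms]) (auto simp: h_def)
    ultimately show ?thesis by simp
  qed
  define S where "S = (\<Sum>i<n. f i)"
  \<comment> \<open>Over all \<open>j < n\<close> the position \<open>i\<close> meets every
    coordinate of \<open>f\<close> exactly once.\<close>
  have point: "(\<Sum>j<n. g1 j i + g2 j i) = (if i < n then S else 0)" for i
  proof (cases "i < n")
    case True
    have "(\<Sum>j<n. g1 j i + g2 j i) = (\<Sum>j\<in>{n-i..<n}. f (i + j - n)) + (\<Sum>j\<in>{0..<n-i}. f (i + j))"
    proof -
      have "(\<Sum>j<n. g1 j i) = (\<Sum>j\<in>{n-i..<n}. f (i + j - n))"
        by (rule sum.mono_neutral_cong_right) (use True in \<open>auto simp: g1_def\<close>)
      moreover have "(\<Sum>j<n. g2 j i) = (\<Sum>j\<in>{0..<n-i}. f (i + j))"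
        by (rule sum.mono_neutral_cong_right) (use True in \<open>auto simp: g2_def\<close>)
      ultimately show ?thesis by (simp add: sum.distrib)
    qed
    also have "(\<Sum>j\<in>{n-i..<n}. f (i + j - n)) = (\<Sum>j\<in>{0..<i}. f j)"
      by (rule sum.reindex_bij_witness[of _ "\<lambda>j. j + (n - i)" "\<lambda>j. i + j - n"]) (use True in auto)
    also have "(\<Sum>j\<in>{0..<n-i}. f (i + j)) = (\<Sum>j\<in>{i..<n}. f j)"
      by (rule sum.reindex_bij_witness[of _ "\<lambda>j. j - i" "\<lambda>j. i + j"]) auto
    also have "(\<Sum>j\<in>{0..<i}. f j) + (\<Sum>j\<in>{i..<n}. f j) = S"
      unfolding S_def using True by (simp add: sum.atLeastLessThan_concat atLeast0LessThan[symmetric])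
    finally show ?thesis using True by simp
  qed (auto simp: g1_def g2_def)
  have "\<bar>S\<bar> * lam n = N (\<lambda>i. \<Sum>j<n. g1 j i + g2 j i)"
    using N_indicator[of "{..<n}" S] by (simp add: point)
  also have "\<dots> \<le> (\<Sum>j<n. N (\<lambda>i. g1 j i + g2 j i))"
    by (rule N_sum[of _ n]) (use b in \<open>auto intro: below_add\<close>)
  also have "\<dots> \<le> (\<Sum>j<n. 2 * C * N f)"
    by (intro sum_mono order.trans[OF triangle[OF b]]) (use add_mono[OF g1 g2] in \<open>auto simp: algebra_simps\<close>)
  finally show ?thesis by (simp add: S_def algebra_simps)
qed

end


section \<open>Norms that are multiplicative on tensor products\<close>

locale tensor_model = subsym +
  fixes K :: real
  assumes K_pos: "K > 0"
    and tens_upper: "below n a \<Longrightarrow> below m b \<Longrightarrow> N (tens m a b) \<le> K * (N a * N b)"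
    and tens_lower: "below n a \<Longrightarrow> below m b \<Longrightarrow> N a * N b \<le> K * N (tens m a b)"
begin

lemma tens_ones:
  "tens m (\<lambda>i. if i < n then 1 else 0) (\<lambda>i. if i < m then 1 else 0) = (\<lambda>i. if i < n * m then 1 else 0)"
proof (rule ext)
  fix i
  show "tens m (\<lambda>i. if i < n then 1 else 0) (\<lambda>i. if i < m then 1 else 0) i = (if i < n * m then 1 else 0)"
    by (cases "m = 0") (auto simp: tens_def less_mult_imp_div_less div_less_iff_less_mult)
qed

text \<open>Indicators of initial segments are closed under tensor products, so \<open>lam\<close>
  is multiplicative up to \<open>K\<close>.\<close>

lemma lam_exponent:
  "\<exists>s D. 0 \<le> s \<and> s \<le> 1 \<and> D > 0 \<and>
    (\<forall>n\<ge>1. real n powr s \<le> D * lam n \<and> lam n \<le> D * real n powr s)"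
proof (rule exponent_exists[OF lam_pos K_pos C_pos _ _ lam_mono lam_lin])
  have b: "below n (\<lambda>i. if i < n then 1 else 0)" for n by (simp add: below_def)
  show "lam (n * m) \<le> K * (lam n * lam m)" for n m
    using tens_upper[OF b[of n] b[of m]] unfolding tens_ones lam_def .
  show "lam n * lam m \<le> K * lam (n * m)" for n m
    using tens_lower[OF b[of n] b[of m]] unfolding tens_ones lam_def .
qed

end

section \<open>Dyadic test vectors\<close>

text \<open>The weight of level \<open>j\<close> balances its \<open>2 ^ j\<close> points when
  \<open>lam n\<close> is of order \<open>n powr s\<close>. For \<open>s > 0\<close> the decreasing
  rearrangement is comparable to \<open>n powr (- s)\<close>; the nested, equally spaced arrangement
  is chosen because the norms at hand are not symmetric.\<close>

definition dyadic_vec :: "real \<Rightarrow> nat \<Rightarrow> nat \<Rightarrow> real" where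
  "dyadic_vec s L i =
    (if i < 2 ^ L then \<Sum>j\<le>L. if 2 ^ (L - j) dvd i then 2 powr (- (s * real j)) else 0 else 0)"

lemma below_dyadic_vec: "below (2 ^ L) (dyadic_vec s L)"
  by (simp add: below_def dyadic_vec_def)

lemma card_multiples_shift:
  assumes "d > 0"
  shows "card {x. \<exists>c<q. x = p + c * d} = (q::nat)" "finite {x. \<exists>c<q. x = p + c * d}"
proof -
  have eq: "{x. \<exists>c<q. x = p + c * d} = (\<lambda>c. p + c * d) ` {..<q}" by auto
  show "card {x. \<exists>c<q. x = p + c * d} = q"
    unfolding eq by (subst card_image) (use assms in \<open>auto simp: inj_on_def\<close>)
  show "finite {x. \<exists>c<q. x = p + c * d}" unfolding eq by simp
qed

text \<open>The diagonal terms suffice: for each \<open>j\<close> the \<open>2 ^ j\<close> points of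
  level \<open>j\<close> contribute \<open>2 powr (- (s + t) * j)\<close> each, hence 1 in total,
  and the mixed products of levels are nonnegative.\<close>

lemma dyadic_pairing:
  assumes "s + t = 1"
  shows "real L + 1 \<le> (\<Sum>i<2 ^ L. dyadic_vec s L i * dyadic_vec t L i)"
proof -
  define A where "A s j i = (if 2 ^ (L - j) dvd i then 2 powr (- (s * real j)) else (0::real))" for s j and i :: nat
  have "real L + 1 = (\<Sum>j\<le>L. \<Sum>i<2 ^ L. A s j i * A t j i)"
  proof -
    have "(\<Sum>i<2 ^ L. A s j i * A t j i) = 1" if "j \<le> L" for j
    proof -
      define T where "T = {x::nat. \<exists>c<2^j. x = 0 + c * 2 ^ (L - j)}"
      have T: "card T = 2 ^ j" "finite T" using card_multiples_shift[of "2 ^ (L - j)" "2 ^ j" 0] by (simp_all add: T_def)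
      have LL: "(2::nat) ^ L = 2 ^ j * 2 ^ (L - j)" using that by (simp add: power_add[symmetric])
      have "(\<Sum>i<2 ^ L. A s j i * A t j i) = (\<Sum>i\<in>T. 2 powr (- real j))"
      proof (rule sum.mono_neutral_cong_right)
        show "T \<subseteq> {..<2 ^ L}" by (auto simp: T_def LL)
        show "\<forall>i\<in>{..<2 ^ L} - T. A s j i * A t j i = 0"
          by (auto simp: A_def T_def LL dvd_def mult.commute)
        show "A s j x * A t j x = 2 powr (- real j)" if "x \<in> T" for x
        proof -
          have "2 ^ (L - j) dvd x" using that by (auto simp: T_def)
          then have "A s j x * A t j x = 2 powr (- (s * real j) + - (t * real j))" by (simp only: A_def if_True powr_add)
          also have "- (s * real j) + - (t * real j) = - ((s + t) * real j)" by (simp add: algebra_simps)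
          finally show ?thesis using assms by simp
        qed
      qed auto
      also have "\<dots> = 1" using T by (simp add: powr_minus powr_realpow)
      finally show ?thesis .
    qed
    then show ?thesis by simp
  qed
  also have "\<dots> = (\<Sum>i<2 ^ L. \<Sum>j\<le>L. A s j i * A t j i)" by (rule sum.swap)
  also have "\<dots> \<le> (\<Sum>i<2 ^ L. dyadic_vec s L i * dyadic_vec t L i)"
  proof (rule sum_mono)
    fix i :: nat assume i: "i \<in> {..<2 ^ L}"
    have nn: "0 \<le> A s j i" for s j by (simp add: A_def)
    have "(\<Sum>j\<le>L. A s j i * A t j i) \<le> (\<Sum>j\<le>L. A s j i * (\<Sum>j'\<le>L. A t j' i))"
      by (intro sum_mono mult_left_mono member_le_sum) (auto simp: nn)
    also have "\<dots> = (\<Sum>j\<le>L. A s j i) * (\<Sum>j'\<le>L. A t j' i)" by (simp add: sum_distrib_right)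
    finally show "(\<Sum>j\<le>L. A s j i * A t j i) \<le> dyadic_vec s L i * dyadic_vec t L i"
      using i by (simp add: dyadic_vec_def A_def)
  qed
  finally show ?thesis .
qed


text \<open>This is the support of the 0-1 vector in which a coefficient
  \<open>2 powr (s * kk i)\<close> has been traded for \<open>2 ^ kk i\<close> ones.\<close>

lemma card_block_set:
  fixes kk :: "nat \<Rightarrow> nat"
  assumes "finite I" "\<And>i. kk i \<le> k"
  shows "card {y. y div 2 ^ k \<in> I \<and> y mod 2 ^ k < 2 ^ kk (y div 2 ^ k)} = (\<Sum>i\<in>I. 2 ^ kk i)"
    and "finite {y. y div 2 ^ k \<in> I \<and> y mod 2 ^ k < 2 ^ kk (y div (2::nat) ^ k)}"
proof -
  have lt: "c < 2 ^ k" if "c < 2 ^ kk i" for c i :: nat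
    using that assms(2)[of i] by (meson less_le_trans one_le_numeral power_increasing)
  have eq: "{y. y div 2 ^ k \<in> I \<and> y mod 2 ^ k < 2 ^ kk (y div 2 ^ k)}
      = (\<Union>i\<in>I. (\<lambda>c. i * 2 ^ k + c) ` {..<2 ^ kk i})" (is "?S = ?U")
  proof
    show "?S \<subseteq> ?U"
    proof
      fix y assume "y \<in> ?S"
      moreover have "y = (y div 2 ^ k) * 2 ^ k + y mod 2 ^ k" by (rule div_mult_mod_eq[symmetric])
      ultimately show "y \<in> ?U" by blast
    qed
    show "?U \<subseteq> ?S" using lt by auto
  qed
  show "finite ?S" unfolding eq using assms(1) by simp
  have "card ?U = (\<Sum>i\<in>I. card ((\<lambda>c. i * 2 ^ k + c) ` {..<2 ^ kk i}))"
  proof (rule card_UN_disjoint[OF assms(1)])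
    show "\<forall>i\<in>I. \<forall>j\<in>I. i \<noteq> j \<longrightarrow> (\<lambda>c. i * 2 ^ k + c) ` {..<2 ^ kk i} \<inter> (\<lambda>c. j * 2 ^ k + c) ` {..<2 ^ kk j} = {}"
    proof (intro ballI impI, rule ccontr)
      fix i j assume ij: "i \<noteq> j" and "(\<lambda>c. i * 2 ^ k + c) ` {..<2 ^ kk i} \<inter> (\<lambda>c. j * 2 ^ k + c) ` {..<2 ^ kk j} \<noteq> {}"
      then obtain c d where cd: "c < 2 ^ kk i" "d < 2 ^ kk j" "i * 2 ^ k + c = j * 2 ^ k + d" by auto
      have "(i * 2 ^ k + c) div 2 ^ k = i" "(j * 2 ^ k + d) div 2 ^ k = j" using lt[OF cd(1)] lt[OF cd(2)] by simp_all
      with cd(3) ij show False by simp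
    qed
  qed simp
  also have "\<dots> = (\<Sum>i\<in>I. 2 ^ kk i)" by (intro sum.cong refl) (simp add: card_image)
  finally show "card ?S = (\<Sum>i\<in>I. 2 ^ kk i)" unfolding eq .
qed

context tensor_model
begin

text \<open>Concatenating \<open>2 ^ j\<close> copies of the vector \<open>dyadic_vec s L\<close> gives, up to an error bounded
  independently of \<open>L\<close>, a spread copy of \<open>2 powr (s * j)\<close> times this vector.  Hence
  coefficients of the form \<open>2 powr (s * j)\<close> can be traded for multiplicities.\<close>

lemma dyadic_compare:
  fixes kk :: "nat \<Rightarrow> nat"
  assumes D: "\<And>n. n \<ge> 1 \<Longrightarrow> lam n \<le> D * real n powr s"
    and I: "I \<subseteq> {..<n}" and kk: "\<And>i. kk i \<le> k"
  defines "a \<equiv> (\<lambda>i. if i \<in> I then 2 powr (s * real (kk i)) else 0)"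
    and "w \<equiv> (\<lambda>y. if y \<in> {y. y div 2 ^ k \<in> I \<and> y mod 2 ^ k < 2 ^ kk (y div 2 ^ k)} then 1 else 0)"
    and "E \<equiv> (\<Sum>i\<in>I. real (kk i) * (D * 2 powr (s * real (kk i))))"
  shows "N (tens (2 ^ L) a (dyadic_vec s L)) \<le> N (tens (2 ^ L) w (dyadic_vec s L)) + 2 * E"
    and "N (tens (2 ^ L) w (dyadic_vec s L)) \<le> N (tens (2 ^ L) a (dyadic_vec s L)) + 2 * E"
proof -
  have finI: "finite I" using I finite_subset by blast
  \<comment> \<open>Slot \<open>i\<close> of length \<open>Q\<close> holds everything that belongs
    to coordinate \<open>i\<close>; it is long enough for all exponents \<open>kk i \<le> k\<close>
    at once.\<close>
  define Q :: nat where "Q = 2 ^ (L + k)"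
  have Q0: "Q > 0" by (simp add: Q_def)
  have leQ: "2 ^ (L + kk i) \<le> Q" for i
    unfolding Q_def by (rule power_increasing) (use kk in auto)
  \<comment> \<open>Level \<open>j\<close> in slot \<open>i\<close>: the slot is used up to length
    \<open>2 ^ (L + kk i)\<close>, so that levels up to \<open>L + kk i\<close> are
    available.\<close>
  define T where "T i j = {x::nat. \<exists>c<2 ^ j. x = i * Q + c * 2 ^ (L + kk i - j)}" for i j
  have memT: "x \<in> T i j \<longleftrightarrow> x div Q = i \<and> x mod Q < 2 ^ (L + kk i) \<and> 2 ^ (L + kk i - j) dvd x mod Q"
    if "j \<le> L + kk i" for x i j
  proof -
    have pw: "(2::nat) ^ (L + kk i) = 2 ^ j * 2 ^ (L + kk i - j)" using that by (simp add: power_add[symmetric])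
    show ?thesis
    proof
      assume "x \<in> T i j"
      then obtain c where c: "c < 2 ^ j" "x = i * Q + c * 2 ^ (L + kk i - j)" by (auto simp: T_def)
      have lt: "c * 2 ^ (L + kk i - j) < 2 ^ (L + kk i)" unfolding pw using c(1) by simp
      then have "c * 2 ^ (L + kk i - j) < Q" using leQ[of i] by linarith
      then have "x div Q = i" "x mod Q = c * 2 ^ (L + kk i - j)" using c(2) Q0 by simp_all
      then show "x div Q = i \<and> x mod Q < 2 ^ (L + kk i) \<and> 2 ^ (L + kk i - j) dvd x mod Q" using lt by simp
    next
      assume A: "x div Q = i \<and> x mod Q < 2 ^ (L + kk i) \<and> 2 ^ (L + kk i - j) dvd x mod Q"
      then obtain c where c: "x mod Q = c * 2 ^ (L + kk i - j)" by (metis dvd_def mult.commute)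
      with A have "c * 2 ^ (L + kk i - j) < 2 ^ j * 2 ^ (L + kk i - j)" using pw by simp
      then have "c < 2 ^ j" by simp
      moreover have "x = i * Q + c * 2 ^ (L + kk i - j)" using c A by (metis div_mult_mod_eq)
      ultimately show "x \<in> T i j" by (auto simp: T_def)
    qed
  qed
  have Tfin: "card (T i j) = 2 ^ j" "finite (T i j)" for i j
    unfolding T_def by (intro card_multiples_shift; simp)+
  define q where "q i j x = (if x \<in> T i j then 2 powr (s * real (kk i) - s * real j) else 0)" for i j x
  \<comment> \<open>The weight compensates the number of points, so the bound does not depend on the
    level \<open>j\<close>.\<close>
  have Nq: "N (q i j) \<le> D * 2 powr (s * real (kk i))" for i j
  proof -
    have "N (q i j) = 2 powr (s * real (kk i) - s * real j) * lam (2 ^ j)"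
      unfolding q_def by (subst N_indicator[OF Tfin(2)]) (simp add: Tfin)
    also have "\<dots> \<le> 2 powr (s * real (kk i) - s * real j) * (D * real (2 ^ j) powr s)"
      by (intro mult_left_mono D) auto
    also have "real (2 ^ j) powr s = 2 powr (s * real j)"
      by (simp add: powr_powr powr_realpow[symmetric] mult.commute)
    also have "2 powr (s * real (kk i) - s * real j) * (D * 2 powr (s * real j)) = D * 2 powr (s * real (kk i))"
      by (simp add: powr_diff)
    finally show ?thesis .
  qed
  have bq: "below (n * Q) (q i j)" if "i \<in> I" "j \<le> L + kk i" for i j
  proof -
    have "x < n * Q" if "x \<in> T i j" for x
    proof -
      have "x div Q < n" using memT[OF \<open>j \<le> L + kk i\<close>] that \<open>i \<in> I\<close> I by auto
      then show ?thesis using Q0 by (simp add: div_less_iff_less_mult)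
    qed
    then show ?thesis by (auto simp: below_def q_def dest: leD)
  qed
  \<comment> \<open>The levels \<open>0..L\<close> form the stretched \<open>a \<otimes> v\<close>,
    the levels \<open>kk i..L + kk i\<close> form \<open>w \<otimes> v\<close>. \<open>X\<close> and
    \<open>Z\<close> complete both to all levels up to \<open>L + kk i\<close> and contain
    \<open>kk i\<close> levels per slot whatever \<open>L\<close> is; hence \<open>E\<close> is free
    of \<open>L\<close>.\<close>
  define A where "A x = (\<Sum>i\<in>I. \<Sum>j\<in>{..L}. q i j x)" for x
  define B where "B x = (\<Sum>i\<in>I. \<Sum>j\<in>{kk i..L + kk i}. q i j x)" for x
  define X where "X x = (\<Sum>i\<in>I. \<Sum>j\<in>{L<..L + kk i}. q i j x)" for x
  define Z where "Z x = (\<Sum>i\<in>I. \<Sum>j\<in>{..<kk i}. q i j x)" for x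
  have bA: "below (n * Q) A" unfolding A_def by (intro below_sum) (auto intro: bq)
  have bB: "below (n * Q) B" unfolding B_def by (intro below_sum) (auto intro: bq)
  have bX: "below (n * Q) X" unfolding X_def by (intro below_sum) (auto intro: bq)
  have bZ: "below (n * Q) Z" unfolding Z_def by (intro below_sum) (auto intro: bq)
  have Nsum: "N (\<lambda>x. \<Sum>i\<in>I. \<Sum>j\<in>J i. q i j x) \<le> E"
    if J: "\<And>i. finite (J i)" "\<And>i. card (J i) = kk i" "\<And>i j. j \<in> J i \<Longrightarrow> j \<le> L + kk i" for J :: "nat \<Rightarrow> nat set"
  proof -
    have "N (\<lambda>x. \<Sum>i\<in>I. \<Sum>j\<in>J i. q i j x) \<le> (\<Sum>i\<in>I. N (\<lambda>x. \<Sum>j\<in>J i. q i j x))"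
      by (rule N_sum[of _ "n * Q"]) (use finI J in \<open>auto intro!: below_sum bq\<close>)
    also have "\<dots> \<le> (\<Sum>i\<in>I. \<Sum>j\<in>J i. N (q i j))"
      by (intro sum_mono N_sum[of _ "n * Q"]) (use J in \<open>auto intro!: bq\<close>)
    also have "\<dots> \<le> (\<Sum>i\<in>I. \<Sum>j\<in>J i. D * 2 powr (s * real (kk i)))" by (intro sum_mono Nq)
    finally show ?thesis by (simp add: E_def J)
  qed
  have NX: "N X \<le> E" unfolding X_def by (rule Nsum) auto
  have NZ: "N Z \<le> E" unfolding Z_def by (rule Nsum) auto
  have eq: "A x + X x = B x + Z x" for x
  proof -
    have "(\<Sum>j\<in>{..L}. q i j x) + (\<Sum>j\<in>{L<..L + kk i}. q i j x) = (\<Sum>j\<in>{kk i..L + kk i}. q i j x) + (\<Sum>j\<in>{..<kk i}. q i j x)" for i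
    proof -
      have "(\<Sum>j\<in>{..L}. q i j x) + (\<Sum>j\<in>{L<..L + kk i}. q i j x) = (\<Sum>j\<in>{..L} \<union> {L<..L + kk i}. q i j x)"
        by (rule sum.union_disjoint[symmetric]) auto
      also have "{..L} \<union> {L<..L + kk i} = {kk i..L + kk i} \<union> {..<kk i}" by auto
      also have "(\<Sum>j\<in>{kk i..L + kk i} \<union> {..<kk i}. q i j x) = (\<Sum>j\<in>{kk i..L + kk i}. q i j x) + (\<Sum>j\<in>{..<kk i}. q i j x)"
        by (rule sum.union_disjoint) auto
      finally show ?thesis .
    qed
    then show ?thesis by (simp add: A_def B_def X_def Z_def sum.distrib[symmetric])
  qed
  have AB: "N A \<le> N B + 2 * E" using N_diff_le[OF bA bB bX eq bZ] NX NZ by linarith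
  have BA: "N B \<le> N A + 2 * E" using N_diff_le[OF bB bA bZ eq[symmetric] bX] NX NZ by linarith
  \<comment> \<open>In slot \<open>i\<close> the copy of \<open>v\<close> is stretched by the factor
    \<open>2 ^ kk i\<close>. The support of \<open>A\<close> lies in the range of
    \<open>\<kappa>\<close>, so \<open>spread\<close> applies.\<close>
  define \<kappa> where "\<kappa> y = (y div 2 ^ L) * Q + (y mod 2 ^ L) * 2 ^ kk (y div 2 ^ L)" for y
  have \<kappa>lt: "(y mod 2 ^ L) * 2 ^ kk i < 2 ^ (L + kk i)" for y i :: nat
    by (simp add: power_add)
  have \<kappa>div: "\<kappa> y div Q = y div 2 ^ L" and \<kappa>mod: "\<kappa> y mod Q = (y mod 2 ^ L) * 2 ^ kk (y div 2 ^ L)" for y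
  proof -
    have "(y mod 2 ^ L) * 2 ^ kk (y div 2 ^ L) < Q" using \<kappa>lt[of y "y div 2 ^ L"] leQ[of "y div 2 ^ L"] by linarith
    then show "\<kappa> y div Q = y div 2 ^ L" "\<kappa> y mod Q = (y mod 2 ^ L) * 2 ^ kk (y div 2 ^ L)"
      using Q0 by (simp_all add: \<kappa>_def)
  qed
  have NA: "N (tens (2 ^ L) a (dyadic_vec s L)) = N A"
  proof -
    have "N (\<lambda>y. A (\<kappa> y)) = N A"
    proof (rule spread[OF bA])
      show "strict_mono \<kappa>"
      proof (rule strict_monoI)
        fix y z :: nat assume yz: "y < z"
        show "\<kappa> y < \<kappa> z"
        proof (cases "y div 2 ^ L = z div 2 ^ L")
          case True
          then have "y mod 2 ^ L < z mod 2 ^ L" using yz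
            by (metis div_mult_mod_eq nat_add_left_cancel_less)
          then show ?thesis using True by (simp add: \<kappa>_def)
        next
          case False
          then have "y div 2 ^ L < z div 2 ^ L" using yz by (meson div_le_mono le_neq_implies_less less_imp_le)
          then have "\<kappa> y div Q < \<kappa> z div Q" by (simp add: \<kappa>div)
          then show ?thesis by (meson div_le_mono leD leI)
        qed
      qed
      show "{i. A i \<noteq> 0} \<subseteq> range \<kappa>"
      proof
        fix x assume "x \<in> {i. A i \<noteq> 0}"
        then have "(\<Sum>i\<in>I. \<Sum>j\<in>{..L}. q i j x) \<noteq> 0" by (simp add: A_def)
        then obtain i where i: "i \<in> I" "(\<Sum>j\<in>{..L}. q i j x) \<noteq> 0"
          by (rule sum.not_neutral_contains_not_neutral)
        then obtain j where "j \<in> {..L}" "q i j x \<noteq> 0" by (meson sum.not_neutral_contains_not_neutral)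
        then have j: "j \<le> L" "x \<in> T i j" by (auto simp: q_def split: if_splits)
        then obtain c where c: "c < 2 ^ j" "x = i * Q + c * 2 ^ (L + kk i - j)" by (auto simp: T_def)
        have "L + kk i - j = (L - j) + kk i" using j by simp
        then have x: "x = i * Q + (c * 2 ^ (L - j)) * 2 ^ kk i" using c by (simp add: power_add)
        have "(2::nat) ^ L = 2 ^ j * 2 ^ (L - j)" using j by (simp add: power_add[symmetric])
        then have "c * 2 ^ (L - j) < 2 ^ L" using c by simp
        then have "x = \<kappa> (i * 2 ^ L + c * 2 ^ (L - j))" unfolding \<kappa>_def x by simp
        then show "x \<in> range \<kappa>" by blast
      qed
    qed
    moreover have "A (\<kappa> y) = tens (2 ^ L) a (dyadic_vec s L) y" for y
    proof -
      define i0 where "i0 = y div 2 ^ L"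
      define r where "r = y mod 2 ^ L"
      have r: "r < 2 ^ L" by (simp add: r_def)
      have dv: "2 ^ (L + kk i0 - j) dvd r * 2 ^ kk i0 \<longleftrightarrow> 2 ^ (L - j) dvd r" if "j \<le> L" for j
      proof -
        have "L + kk i0 - j = (L - j) + kk i0" using that by simp
        then show ?thesis by (simp add: power_add)
      qed
      have qq: "q i j (\<kappa> y) = (if i = i0 then 2 powr (s * real (kk i0)) * (if 2 ^ (L - j) dvd r then 2 powr (- (s * real j)) else 0) else 0)"
        if "j \<le> L" for i j
      proof (cases "i = i0")
        case True
        have "\<kappa> y \<in> T i0 j \<longleftrightarrow> 2 ^ (L - j) dvd r"
          using that \<kappa>lt[of y i0] dv[OF that] by (subst memT) (auto simp: \<kappa>div \<kappa>mod i0_def[symmetric] r_def[symmetric])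
        then show ?thesis using True by (simp add: q_def powr_add[symmetric])
      next
        case False
        have "\<kappa> y \<notin> T i j" using False that by (subst memT) (auto simp: \<kappa>div i0_def)
        then show ?thesis using False by (simp add: q_def)
      qed
      have "A (\<kappa> y) = (\<Sum>i\<in>I. if i = i0 then 2 powr (s * real (kk i0)) * dyadic_vec s L r else 0)"
        unfolding A_def using r by (intro sum.cong refl) (simp add: qq dyadic_vec_def sum_distrib_left)
      also have "\<dots> = tens (2 ^ L) a (dyadic_vec s L) y"
        using finI by (simp add: tens_def a_def i0_def r_def)
      finally show ?thesis .
    qed
    ultimately show ?thesis by simp
  qed
  have NB: "tens (2 ^ L) w (dyadic_vec s L) = B"
  proof
    fix x
    define i0 where "i0 = x div Q"
    define t where "t = x mod Q"
    have d1: "x div 2 ^ L div 2 ^ k = i0" by (simp add: i0_def Q_def power_add div_mult2_eq)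
    have tt: "t = 2 ^ L * (x div 2 ^ L mod 2 ^ k) + x mod 2 ^ L"
      by (simp add: t_def Q_def power_add mod_mult2_eq)
    have d2: "x div 2 ^ L mod 2 ^ k < 2 ^ kk i0 \<longleftrightarrow> t < 2 ^ (L + kk i0)"
    proof -
      have "t div 2 ^ L = x div 2 ^ L mod 2 ^ k" unfolding tt by simp
      moreover have "t div 2 ^ L < 2 ^ kk i0 \<longleftrightarrow> t < 2 ^ kk i0 * 2 ^ L" by (rule div_less_iff_less_mult) simp
      ultimately show ?thesis by (simp add: power_add mult.commute)
    qed
    have dv: "2 ^ (L - j) dvd t \<longleftrightarrow> 2 ^ (L - j) dvd x mod 2 ^ L" for j
    proof -
      have "2 ^ (L - j) dvd (2::nat) ^ L * (x div 2 ^ L mod 2 ^ k)"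
        by (intro dvd_mult2 le_imp_power_dvd) simp
      then show ?thesis unfolding tt by (rule dvd_add_right_iff)
    qed
    have "(\<Sum>j\<in>{kk i..L + kk i}. q i j x) =
        (if i = i0 then (if t < 2 ^ (L + kk i0) then dyadic_vec s L (x mod 2 ^ L) else 0) else 0)" for i
    proof -
      have "(\<Sum>j\<in>{kk i..L + kk i}. q i j x) = (\<Sum>j\<le>L. q i (j + kk i) x)"
        by (rule sum.reindex_bij_witness[of _ "\<lambda>j. j + kk i" "\<lambda>j. j - kk i"]) auto
      also have "\<dots> = (\<Sum>j\<le>L. if i = i0 then (if t < 2 ^ (L + kk i0) then (if 2 ^ (L - j) dvd x mod 2 ^ L then 2 powr (- (s * real j)) else 0) else 0) else 0)"
      proof (rule sum.cong[OF refl])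
        fix j assume "j \<in> {..L}"
        then have "x \<in> T i (j + kk i) \<longleftrightarrow> i = i0 \<and> t < 2 ^ (L + kk i) \<and> 2 ^ (L - j) dvd x mod 2 ^ L"
          by (subst memT) (auto simp: i0_def[symmetric] t_def[symmetric] dv)
        then show "q i (j + kk i) x = (if i = i0 then (if t < 2 ^ (L + kk i0) then (if 2 ^ (L - j) dvd x mod 2 ^ L then 2 powr (- (s * real j)) else 0) else 0) else 0)"
          by (auto simp: q_def algebra_simps)
      qed
      also have "\<dots> = (if i = i0 then (if t < 2 ^ (L + kk i0) then dyadic_vec s L (x mod 2 ^ L) else 0) else 0)"
        by (simp add: dyadic_vec_def)
      finally show ?thesis .
    qed
    then have "B x = (if i0 \<in> I then (if t < 2 ^ (L + kk i0) then dyadic_vec s L (x mod 2 ^ L) else 0) else 0)"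
      unfolding B_def using finI by simp
    then show "tens (2 ^ L) w (dyadic_vec s L) x = B x"
      by (simp add: tens_def w_def d1 d2)
  qed
  show "N (tens (2 ^ L) a (dyadic_vec s L)) \<le> N (tens (2 ^ L) w (dyadic_vec s L)) + 2 * E"
    using AB unfolding NA NB .
  show "N (tens (2 ^ L) w (dyadic_vec s L)) \<le> N (tens (2 ^ L) a (dyadic_vec s L)) + 2 * E"
    using BA unfolding NA NB .
qed

text \<open>Combine \<open>dyadic_compare\<close> with the tensor estimates and divide by the norm
  of \<open>dyadic_vec s L\<close>: the error does not depend on \<open>L\<close> and vanishes in
  the limit, and each of the two tensor estimates leaves a factor \<open>K\<close>.\<close>

lemma lp_dyadic:
  fixes kk :: "nat \<Rightarrow> nat"
  assumes D: "\<And>n. n \<ge> 1 \<Longrightarrow> lam n \<le> D * real n powr s"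
    and unb: "\<And>B. \<exists>L. B < N (dyadic_vec s L)"
    and I: "I \<subseteq> {..<n}" and kk: "\<And>i. kk i \<le> k"
  defines "a \<equiv> (\<lambda>i. if i \<in> I then 2 powr (s * real (kk i)) else 0)"
  shows "N a \<le> K ^ 2 * lam (\<Sum>i\<in>I. 2 ^ kk i)" and "lam (\<Sum>i\<in>I. 2 ^ kk i) \<le> K ^ 2 * N a"
proof -
  have finI: "finite I" using I finite_subset by blast
  define S where "S = {y. y div 2 ^ k \<in> I \<and> y mod 2 ^ k < 2 ^ kk (y div 2 ^ k)}"
  have S: "card S = (\<Sum>i\<in>I. 2 ^ kk i)" "finite S" unfolding S_def by (rule card_block_set[OF finI kk])+
  define w :: "nat \<Rightarrow> real" where "w = (\<lambda>y. if y \<in> S then 1 else 0)"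
  have Nw: "N w = lam (\<Sum>i\<in>I. 2 ^ kk i)" unfolding w_def by (subst N_indicator[OF S(2)]) (simp add: S)
  define E where "E = (\<Sum>i\<in>I. real (kk i) * (D * 2 powr (s * real (kk i))))"
  have ba: "below n a" using I by (auto simp: below_def a_def)
  obtain m where bw: "below m w"
  proof -
    have "below (Suc (Max (insert 0 S))) w"
      unfolding below_def w_def using S(2) by (auto simp: Suc_le_eq)
    then show ?thesis by (rule that)
  qed
  have cmp: "N (tens (2 ^ L) a (dyadic_vec s L)) \<le> N (tens (2 ^ L) w (dyadic_vec s L)) + 2 * E"
    "N (tens (2 ^ L) w (dyadic_vec s L)) \<le> N (tens (2 ^ L) a (dyadic_vec s L)) + 2 * E" for L
    unfolding a_def w_def S_def E_def by (rule dyadic_compare[OF D I kk]; simp)+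
  have key: False if "x > K ^ 2 * y" "\<And>L. x * N (dyadic_vec s L) \<le> K * (K * (y * N (dyadic_vec s L)) + 2 * E)" for x y
  proof -
    define d where "d = x - K ^ 2 * y"
    have d: "d > 0" using that(1) by (simp add: d_def)
    obtain L where L: "2 * K * E / d < N (dyadic_vec s L)" using unb by blast
    then have "2 * K * E < d * N (dyadic_vec s L)" using d by (simp add: field_simps)
    moreover have "d * N (dyadic_vec s L) \<le> 2 * K * E"
      using that(2)[of L] by (simp add: d_def algebra_simps power2_eq_square)
    ultimately show False by simp
  qed
  have "N a * N (dyadic_vec s L) \<le> K * (K * (N w * N (dyadic_vec s L)) + 2 * E)" for L
  proof -
    have "N a * N (dyadic_vec s L) \<le> K * N (tens (2 ^ L) a (dyadic_vec s L))"
      by (rule tens_lower[OF ba below_dyadic_vec])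
    also have "\<dots> \<le> K * (N (tens (2 ^ L) w (dyadic_vec s L)) + 2 * E)"
      by (intro mult_left_mono cmp(1)) (use K_pos in simp_all)
    also have "\<dots> \<le> K * (K * (N w * N (dyadic_vec s L)) + 2 * E)"
      by (intro mult_left_mono add_right_mono tens_upper[OF bw below_dyadic_vec]) (use K_pos in simp)
    finally show ?thesis .
  qed
  then show "N a \<le> K ^ 2 * lam (\<Sum>i\<in>I. 2 ^ kk i)" using key[of "N w" "N a"] Nw by fastforce
  have "N w * N (dyadic_vec s L) \<le> K * (K * (N a * N (dyadic_vec s L)) + 2 * E)" for L
  proof -
    have "N w * N (dyadic_vec s L) \<le> K * N (tens (2 ^ L) w (dyadic_vec s L))"
      by (rule tens_lower[OF bw below_dyadic_vec])
    also have "\<dots> \<le> K * (N (tens (2 ^ L) a (dyadic_vec s L)) + 2 * E)"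
      by (intro mult_left_mono cmp(2)) (use K_pos in simp_all)
    also have "\<dots> \<le> K * (K * (N a * N (dyadic_vec s L)) + 2 * E)"
      by (intro mult_left_mono add_right_mono tens_upper[OF ba below_dyadic_vec]) (use K_pos in simp)
    finally show ?thesis .
  qed
  then show "lam (\<Sum>i\<in>I. 2 ^ kk i) \<le> K ^ 2 * N a" using key[of "N a" "N w"] Nw by fastforce
qed

text \<open>A vector with coefficients \<open>2 powr (s * kk i)\<close> has the integer
  \<open>S = \<Sum> 2 ^ kk i\<close> as sum of its \<open>1/s\<close>-th powers, and its norm is
  comparable to \<open>lam S\<close>, hence to \<open>S powr s\<close>. An arbitrary vector is
  rounded to this form.\<close>

lemma lp_estimate:
  assumes s: "0 < s" and D0: "D > 0"
    and D: "\<And>n. n \<ge> 1 \<Longrightarrow> real n powr s \<le> D * lam n \<and> lam n \<le> D * real n powr s"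
    and unb: "\<And>B. \<exists>L. B < N (dyadic_vec s L)"
  shows "\<exists>D'>0. \<forall>n f. below n f \<longrightarrow>
    N f \<le> D' * (\<Sum>i<n. \<bar>f i\<bar> powr (1/s)) powr s \<and> (\<Sum>i<n. \<bar>f i\<bar> powr (1/s)) powr s \<le> D' * N f"
proof -
  \<comment> \<open>One factor for each loss: unconditionality, rounding of the
    \<open>1/s\<close>-th powers by at most 2, \<open>lp_dyadic\<close>, and the growth of
    \<open>lam\<close>.\<close>
  define D' where "D' = C * 2 powr s * K ^ 2 * D"
  have D'0: "D' > 0" using C_pos K_pos D0 by (simp add: D'_def)
  have "N f \<le> D' * (\<Sum>i<n. \<bar>f i\<bar> powr (1/s)) powr s \<and> (\<Sum>i<n. \<bar>f i\<bar> powr (1/s)) powr s \<le> D' * N f"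
    if bf: "below n f" for n f
  proof (cases "f = (\<lambda>_. 0)")
    case True
    then show ?thesis by (simp add: N_zero)
  next
    case False
    define I where "I = {i. f i \<noteq> 0}"
    have I: "I \<subseteq> {..<n}" using below_lt[OF bf] by (auto simp: I_def)
    have finI: "finite I" using I finite_subset by blast
    have Ine: "I \<noteq> {}" using False by (auto simp: I_def)
    \<comment> \<open>Division by the smallest nonzero modulus makes all logarithms nonnegative, so
      that the exponents \<open>kk i\<close> can be natural numbers.\<close>
    define \<mu> where "\<mu> = Min ((\<lambda>i. \<bar>f i\<bar>) ` I)"
    have "\<mu> \<in> (\<lambda>i. \<bar>f i\<bar>) ` I" unfolding \<mu>_def using finI Ine by (intro Min_in) auto
    then have \<mu>0: "\<mu> > 0" by (auto simp: I_def)
    have \<mu>le: "\<mu> \<le> \<bar>f i\<bar>" if "i \<in> I" for i unfolding \<mu>_def using finI that by simp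
    define g where "g i = \<bar>f i\<bar> / \<mu>" for i
    have g1: "g i \<ge> 1" if "i \<in> I" for i using \<mu>le[OF that] \<mu>0 by (simp add: g_def)
    have g0: "g i = 0" if "i \<notin> I" for i using that by (simp add: g_def I_def)
    define kk where "kk i = (if i \<in> I then nat \<lfloor>log 2 (g i powr (1/s))\<rfloor> else 0)" for i
    define k where "k = (\<Sum>i\<in>I. kk i)"
    have kk: "kk i \<le> k" for i
      unfolding k_def using finI by (cases "i \<in> I") (auto intro: member_le_sum simp: kk_def)
    have kb: "2 powr real (kk i) \<le> g i powr (1/s)" "g i powr (1/s) \<le> 2 * 2 powr real (kk i)" if "i \<in> I" for i
    proof -
      have ge1: "1 \<le> g i powr (1/s)" using g1[OF that] s by (intro ge_one_powr_ge_zero) auto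
      define x where "x = log 2 (g i powr (1/s))"
      have x0: "0 \<le> x" unfolding x_def by (subst zero_le_log_cancel_iff) (use ge1 in auto)
      have gx: "g i powr (1/s) = 2 powr x" unfolding x_def by (subst powr_log_cancel) (use ge1 in auto)
      have kx: "real (kk i) \<le> x" "x \<le> real (kk i) + 1" using that x0 by (auto simp: kk_def x_def[symmetric])
      show "2 powr real (kk i) \<le> g i powr (1/s)" using kx(1) by (simp add: gx)
      have "2 powr x \<le> 2 powr (1 + real (kk i))" using kx(2) by simp
      then show "g i powr (1/s) \<le> 2 * 2 powr real (kk i)" by (simp add: gx powr_add)
    qed
    define a where "a = (\<lambda>i. if i \<in> I then 2 powr (s * real (kk i)) else 0)"
    have ba: "below n a" using I by (auto simp: below_def a_def)
    have gpow: "(g i powr (1/s)) powr s = g i" if "i \<in> I" for i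
      using s g1[OF that] by (simp add: powr_powr)
    have apow: "a i = (2 powr real (kk i)) powr s" if "i \<in> I" for i
      using that by (simp add: a_def powr_powr mult.commute)
    have ag: "a i \<le> g i" "g i \<le> 2 powr s * a i" for i
    proof -
      show "a i \<le> g i"
      proof (cases "i \<in> I")
        case True
        have "(2 powr real (kk i)) powr s \<le> (g i powr (1/s)) powr s"
          by (rule powr_mono2) (use s kb(1)[OF True] in auto)
        then show ?thesis using gpow[OF True] apow[OF True] by simp
      qed (simp add: a_def g0)
      show "g i \<le> 2 powr s * a i"
      proof (cases "i \<in> I")
        case True
        have "(g i powr (1/s)) powr s \<le> (2 * 2 powr real (kk i)) powr s"
          by (rule powr_mono2) (use s kb(2)[OF True] in auto)
        then show ?thesis using gpow[OF True] apow[OF True] by (simp add: powr_mult)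
      qed (simp add: g0 a_def)
    qed
    have a_nn: "0 \<le> a i" for i by (simp add: a_def)
    have g_nn: "0 \<le> g i" for i using \<mu>0 by (simp add: g_def)
    have bg: "below n g" using bf by (simp add: below_def g_def)
    define S where "S = (\<Sum>i\<in>I. (2::nat) ^ kk i)"
    have S1: "S \<ge> 1"
    proof -
      obtain i where "i \<in> I" using Ine by blast
      then have "(2::nat) ^ kk i \<le> S" unfolding S_def using finI by (intro member_le_sum) auto
      moreover have "1 \<le> (2::nat) ^ kk i" by simp
      ultimately show ?thesis by linarith
    qed
    have realS: "real S = (\<Sum>i\<in>I. 2 powr real (kk i))" by (simp add: S_def powr_realpow)
    define G where "G = (\<Sum>i<n. g i powr (1/s))"
    have GI: "G = (\<Sum>i\<in>I. g i powr (1/s))"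
      unfolding G_def by (rule sum.mono_neutral_right) (use I g0 in auto)
    have G: "real S \<le> G" "G \<le> 2 * real S"
      unfolding realS GI sum_distrib_left by (intro sum_mono kb; simp)+
    have lp: "N a \<le> K ^ 2 * lam S" "lam S \<le> K ^ 2 * N a"
      using lp_dyadic[where D=D and s=s and I=I and n=n and kk=kk and k=k] D unb I kk unfolding S_def a_def by blast+
    have Nfa: "N f \<le> C * (\<mu> * (2 powr s * N a))" "\<mu> * N a \<le> C * N f"
    proof -
      have e: "N (\<lambda>i. (\<mu> * 2 powr s) * a i) = (\<mu> * 2 powr s) * N a" using scale[OF ba, of "\<mu> * 2 powr s"] \<mu>0 by simp
      have "N f \<le> C * N (\<lambda>i. (\<mu> * 2 powr s) * a i)"
      proof (rule mono[OF below_scale[OF ba]])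
        fix i
        have "\<bar>f i\<bar> = \<mu> * g i" using \<mu>0 by (simp add: g_def)
        also have "\<dots> \<le> \<mu> * (2 powr s * a i)" by (intro mult_left_mono ag) (use \<mu>0 in simp)
        also have "\<dots> \<le> \<bar>\<mu> * 2 powr s * a i\<bar>" by (simp add: mult.assoc)
        finally show "\<bar>f i\<bar> \<le> \<bar>\<mu> * 2 powr s * a i\<bar>" .
      qed
      then show "N f \<le> C * (\<mu> * (2 powr s * N a))" unfolding e by (simp only: mult.assoc)
      have e: "N (\<lambda>i. \<mu> * a i) = \<mu> * N a" using scale[OF ba, of \<mu>] \<mu>0 by simp
      have "N (\<lambda>i. \<mu> * a i) \<le> C * N f"
      proof (rule mono[OF bf])
        fix i
        have "\<bar>\<mu> * a i\<bar> = \<mu> * a i" using \<mu>0 a_nn by simp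
        also have "\<dots> \<le> \<mu> * g i" by (intro mult_left_mono ag) (use \<mu>0 in simp)
        also have "\<dots> = \<bar>f i\<bar>" using \<mu>0 by (simp add: g_def)
        finally show "\<bar>\<mu> * a i\<bar> \<le> \<bar>f i\<bar>" .
      qed
      then show "\<mu> * N a \<le> C * N f" by (simp add: e)
    qed
    have norm: "(\<Sum>i<n. \<bar>f i\<bar> powr (1/s)) powr s = \<mu> * G powr s"
    proof -
      have "(\<Sum>i<n. \<bar>f i\<bar> powr (1/s)) = (\<Sum>i<n. \<mu> powr (1/s) * g i powr (1/s))"
        using \<mu>0 by (intro sum.cong refl) (simp add: g_def powr_mult[symmetric])
      also have "\<dots> = \<mu> powr (1/s) * G" by (simp add: G_def sum_distrib_left)
      finally show ?thesis using \<mu>0 s G(1) by (simp add: powr_mult powr_powr)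
    qed
    have 1: "N f \<le> D' * (\<mu> * G powr s)"
    proof -
      have "N f \<le> C * (\<mu> * (2 powr s * N a))" by (rule Nfa)
      also have "\<dots> \<le> C * (\<mu> * (2 powr s * (K ^ 2 * (D * real S powr s))))"
        using C_pos \<mu>0 conjunct2[OF D[OF S1]] by (intro mult_left_mono order.trans[OF lp(1)]) auto
      also have "\<dots> \<le> C * (\<mu> * (2 powr s * (K ^ 2 * (D * G powr s))))"
        using C_pos \<mu>0 K_pos D0 s G by (intro mult_left_mono powr_mono2) auto
      finally show ?thesis by (simp add: D'_def algebra_simps)
    qed
    have 2: "\<mu> * G powr s \<le> D' * N f"
    proof -
      have "G powr s \<le> (2 * real S) powr s" using s G by (intro powr_mono2) auto
      also have "\<dots> = 2 powr s * real S powr s" by (simp add: powr_mult)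
      also have "\<dots> \<le> 2 powr s * (D * (K ^ 2 * N a))"
      proof (rule mult_left_mono)
        have "real S powr s \<le> D * lam S" using D[OF S1] by blast
        also have "\<dots> \<le> D * (K ^ 2 * N a)" using D0 lp(2) by (intro mult_left_mono) auto
        finally show "real S powr s \<le> D * (K ^ 2 * N a)" .
      qed simp
      finally have "\<mu> * G powr s \<le> \<mu> * (2 powr s * (D * (K ^ 2 * N a)))" using \<mu>0 by simp
      also have "\<dots> = 2 powr s * D * K ^ 2 * (\<mu> * N a)" by simp
      also have "\<dots> \<le> 2 powr s * D * K ^ 2 * (C * N f)"
        using D0 K_pos by (intro mult_left_mono Nfa) auto
      finally show ?thesis by (simp add: D'_def algebra_simps)
    qed
    show ?thesis using 1 2 unfolding norm by simp
  qed
  with D'0 show ?thesis by blast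
qed

end


section \<open>Duality and the dichotomy\<close>

lemma sum_div_mod:
  fixes F :: "nat \<Rightarrow> nat \<Rightarrow> real"
  assumes "m > 0"
  shows "(\<Sum>x<n * m. F (x div m) (x mod m)) = (\<Sum>i<n. \<Sum>j<m. F i j)"
proof -
  have "(\<Sum>x<n * m. F (x div m) (x mod m)) = (\<Sum>i<n. sum (\<lambda>x. F (x div m) (x mod m)) {i * m..<i * m + m})"
    by (rule sum.nat_group[symmetric])
  also have "\<dots> = (\<Sum>i<n. \<Sum>j<m. F i j)"
  proof (rule sum.cong[OF refl])
    fix i
    have "sum (\<lambda>x. F (x div m) (x mod m)) {i * m..<i * m + m} = (\<Sum>j\<in>{0..<m}. F ((i * m + j) div m) ((i * m + j) mod m))"
      by (subst sum.atLeastLessThan_shift_0) simp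
    also have "\<dots> = (\<Sum>j<m. F i j)" by (rule sum.cong) (use assms in \<open>auto simp: atLeast0LessThan\<close>)
    finally show "sum (\<lambda>x. F (x div m) (x mod m)) {i * m..<i * m + m} = (\<Sum>j<m. F i j)" .
  qed
  finally show ?thesis .
qed

lemma powr_bounded_imp_nonpos:
  fixes x B :: real
  assumes "\<And>n. n \<ge> 1 \<Longrightarrow> real n powr x \<le> B"
  shows "x \<le> 0"
proof (rule ccontr)
  assume "\<not> x \<le> 0"
  then have x: "x > 0" by simp
  have B: "B > 0" using assms[of 1] by simp
  obtain n :: nat where n: "(B + 1) powr (1/x) < real n" using reals_Archimedean2 by blast
  have "0 < (B + 1) powr (1/x)" using B by simp
  then have "n \<ge> 1" using n by (cases n) auto
  have "B + 1 = ((B + 1) powr (1/x)) powr x" using B x by (simp add: powr_powr)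
  also have "\<dots> \<le> real n powr x" using n x by (intro powr_mono2) auto
  also have "\<dots> \<le> B" by (rule assms) fact
  finally show False by simp
qed

text \<open>Young's inequality, applied to the normalized terms; \<open>s\<close> and
  \<open>t\<close> are the reciprocals of the conjugate exponents.\<close>

lemma Hoelder_sum:
  fixes x y :: "nat \<Rightarrow> real"
  assumes s: "0 < s" "0 < t" "s + t = 1" and nn: "\<And>i. 0 \<le> x i" "\<And>i. 0 \<le> y i"
  shows "(\<Sum>i<n. x i * y i) \<le> (\<Sum>i<n. x i powr (1/s)) powr s * (\<Sum>i<n. y i powr (1/t)) powr t"
proof -
  define X where "X = (\<Sum>i<n. x i powr (1/s))"
  define Y where "Y = (\<Sum>i<n. y i powr (1/t))"
  have XY: "0 \<le> X" "0 \<le> Y" unfolding X_def Y_def by (auto intro: sum_nonneg)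
  show ?thesis
  proof (cases "X = 0 \<or> Y = 0")
    case True
    then have "(\<forall>i<n. x i = 0) \<or> (\<forall>i<n. y i = 0)"
      unfolding X_def Y_def by (auto simp: sum_nonneg_eq_0_iff)
    then have "(\<Sum>i<n. x i * y i) = 0" by (intro sum.neutral) auto
    then show ?thesis by simp
  next
    case False
    then have XY: "0 < X" "0 < Y" using XY by auto
    have "(\<Sum>i<n. (x i / X powr s) * (y i / Y powr t)) \<le> (\<Sum>i<n. s * (x i powr (1/s) / X) + t * (y i powr (1/t) / Y))"
    proof (rule sum_mono)
      fix i
      have "(x i / X powr s) * (y i / Y powr t) \<le> (x i / X powr s) powr (1/s) / (1/s) + (y i / Y powr t) powr (1/t) / (1/t)"
        by (rule Youngs_inequality) (use s nn in auto)
      also have "(x i / X powr s) powr (1/s) = x i powr (1/s) / X" using s XY nn by (simp add: powr_divide powr_powr)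
      also have "(y i / Y powr t) powr (1/t) = y i powr (1/t) / Y" using s XY nn by (simp add: powr_divide powr_powr)
      finally show "(x i / X powr s) * (y i / Y powr t) \<le> s * (x i powr (1/s) / X) + t * (y i powr (1/t) / Y)"
        by (simp add: mult.commute)
    qed
    also have "\<dots> = s * (X / X) + t * (Y / Y)"
      by (simp add: sum.distrib sum_distrib_left[symmetric] sum_divide_distrib[symmetric] X_def[symmetric] Y_def[symmetric])
    also have "\<dots> = 1" using XY s by simp
    also have "(\<Sum>i<n. (x i / X powr s) * (y i / Y powr t)) = (\<Sum>i<n. x i * y i) / (X powr s * Y powr t)"
      by (simp add: sum_divide_distrib)
    finally show ?thesis using XY by (simp add: X_def[symmetric] Y_def[symmetric] field_simps)
  qed
qed

text \<open>\<open>M\<close> is the dual norm of \<open>N\<close> up to the constant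
  \<open>R\<close>. The assumptions are symmetric in the two norms, so that every result on
  \<open>N\<close> passes to \<open>M\<close>.\<close>

locale dual_models = N: subsym N C c + M: subsym M C' c'
  for N M :: "(nat \<Rightarrow> real) \<Rightarrow> real" and C c C' c' :: real +
  fixes K R :: real
  assumes K_pos: "K > 0" and R_pos: "R > 0"
    and tens_N: "below n a \<Longrightarrow> below m b \<Longrightarrow> N (tens m a b) \<le> K * (N a * N b)"
    and tens_M: "below n a \<Longrightarrow> below m b \<Longrightarrow> M (tens m a b) \<le> K * (M a * M b)"
    and pairing: "below n a \<Longrightarrow> below n b \<Longrightarrow> (\<Sum>i<n. a i * b i) \<le> N a * M b"
    and norming_N: "below n a \<Longrightarrow> \<exists>b. below n b \<and> M b \<le> R \<and> N a \<le> (\<Sum>i<n. a i * b i)"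
    and norming_M: "below n b \<Longrightarrow> \<exists>a. below n a \<and> N a \<le> R \<and> M b \<le> (\<Sum>i<n. a i * b i)"
begin

lemma dual_models_sym: "dual_models M N C' c' C c K R"
proof (unfold_locales, fact K_pos, fact R_pos, fact tens_M, fact tens_N)
  fix n a b assume "below n a" "below n b"
  then show "(\<Sum>i<n. a i * b i) \<le> M a * N b" using pairing[of n b a] by (simp add: mult.commute)
next
  fix n a assume "below n a"
  then show "\<exists>b. below n b \<and> N b \<le> R \<and> M a \<le> (\<Sum>i<n. a i * b i)" using norming_M[of n a] by (simp add: mult.commute)
next
  fix n b assume "below n b"
  then show "\<exists>a. below n a \<and> M a \<le> R \<and> N b \<le> (\<Sum>i<n. a i * b i)" using norming_N[of n b] by (simp add: mult.commute)
qed

text \<open>Let \<open>a'\<close> and \<open>b'\<close> norm \<open>a\<close> and \<open>b\<close>.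
  The pairing of \<open>tens m a b\<close> with \<open>tens m a' b'\<close> factors into the two
  pairings, and the upper estimate for \<open>M\<close> bounds the latter vector by
  \<open>K * (R * R)\<close>.\<close>

lemma tens_lower_N:
  assumes a: "below n a" and b: "below m b"
  shows "N a * N b \<le> (K * (R * R)) * N (tens m a b)"
proof (cases "m = 0")
  case True
  then have "b = (\<lambda>_. 0)" using b by (auto simp: below_def)
  then show ?thesis by (simp add: N.N_zero tens_def)
next
  case False
  obtain a' where a': "below n a'" "M a' \<le> R" "N a \<le> (\<Sum>i<n. a i * a' i)" using norming_N[OF a] by blast
  obtain b' where b': "below m b'" "M b' \<le> R" "N b \<le> (\<Sum>i<m. b i * b' i)" using norming_N[OF b] by blast
  have "N a * N b \<le> (\<Sum>i<n. a i * a' i) * (\<Sum>i<m. b i * b' i)"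
    using a'(3) b'(3) N.N_nonneg[OF a] N.N_nonneg[OF b] by (intro mult_mono) auto
  also have "\<dots> = (\<Sum>i<n. \<Sum>j<m. (a i * a' i) * (b j * b' j))" by (rule sum_product)
  also have "\<dots> = (\<Sum>x<n * m. tens m a b x * tens m a' b' x)"
    using False by (subst sum_div_mod[symmetric]) (auto simp: tens_def algebra_simps)
  also have "\<dots> \<le> N (tens m a b) * M (tens m a' b')"
    by (rule pairing[OF below_tens[OF a b] below_tens[OF a'(1) b'(1)]])
  also have "\<dots> \<le> N (tens m a b) * (K * (R * R))"
  proof (rule mult_left_mono)
    have "M (tens m a' b') \<le> K * (M a' * M b')" by (rule tens_M[OF a'(1) b'(1)])
    also have "\<dots> \<le> K * (R * R)"
      using a' b' K_pos R_pos M.N_nonneg[OF a'(1)] M.N_nonneg[OF b'(1)] by (intro mult_left_mono mult_mono) auto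
    finally show "M (tens m a' b') \<le> K * (R * R)" .
    show "0 \<le> N (tens m a b)" by (rule N.N_nonneg[OF below_tens[OF a b]])
  qed
  finally show ?thesis by (simp add: mult.commute)
qed

lemma tensor_model_N: "tensor_model N C c (K * (1 + R * R))"
proof unfold_locales
  have R2: "0 < R * R" using R_pos by simp
  show "0 < K * (1 + R * R)" using K_pos R2 by (intro mult_pos_pos) auto
  fix n m a b assume ab: "below n a" "below m b"
  have nn: "0 \<le> N a * N b" "0 \<le> N (tens m a b)"
    using N.N_nonneg[OF ab(1)] N.N_nonneg[OF ab(2)] N.N_nonneg[OF below_tens[OF ab]] by auto
  have "K * (N a * N b) \<le> K * (1 + R * R) * (N a * N b)"
    using K_pos R2 nn by (intro mult_right_mono) auto
  then show "N (tens m a b) \<le> K * (1 + R * R) * (N a * N b)" using tens_N[OF ab] by linarith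
  have "K * (R * R) * N (tens m a b) \<le> K * (1 + R * R) * N (tens m a b)"
    using K_pos R2 nn by (intro mult_right_mono) auto
  then show "N a * N b \<le> K * (1 + R * R) * N (tens m a b)" using tens_lower_N[OF ab] by linarith
qed

text \<open>Pairing the indicator with itself gives the lower bound. For the upper one, a norming
  vector of the indicator may be replaced by its average, which \<open>average_le\<close>
  controls.\<close>

lemma lam_product:
  shows "real n \<le> N.lam n * M.lam n" and "N.lam n * M.lam n \<le> 2 * C * R * real n"
proof -
  define u :: "nat \<Rightarrow> real" where "u = (\<lambda>i. if i < n then 1 else 0)"
  have u: "below n u" by (simp add: below_def u_def)
  have "real n = (\<Sum>i<n. u i * u i)" by (simp add: u_def)
  also have "\<dots> \<le> N u * M u" by (rule pairing[OF u u])
  finally show "real n \<le> N.lam n * M.lam n" by (simp add: N.lam_def M.lam_def u_def)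
  obtain a where a: "below n a" "N a \<le> R" "M u \<le> (\<Sum>i<n. a i * u i)" using norming_M[OF u] by blast
  have "N.lam n \<ge> 0" unfolding N.lam_def using N.N_nonneg[OF u] by (simp add: u_def)
  have "M.lam n \<le> \<bar>\<Sum>i<n. a i\<bar>" using a(3) by (simp add: M.lam_def u_def)
  then have "N.lam n * M.lam n \<le> N.lam n * \<bar>\<Sum>i<n. a i\<bar>" using \<open>N.lam n \<ge> 0\<close> by (rule mult_left_mono)
  also have "\<dots> \<le> 2 * C * real n * N a" using N.average_le[OF a(1)] by (simp add: mult.commute)
  also have "\<dots> \<le> 2 * C * real n * R" using a(2) N.C_pos by (intro mult_left_mono) auto
  finally show "N.lam n * M.lam n \<le> 2 * C * R * real n" by (simp add: mult_ac)
qed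

text \<open>Hoelder's inequality against a norming vector bounds \<open>N\<close> from above;
  testing with the extremal vector of that inequality bounds it from below.\<close>

lemma lp_transfer:
  assumes s: "0 < s" "0 < t" "s + t = 1" and D0: "D > 0"
    and M_lp: "\<And>n f. below n f \<Longrightarrow> M f \<le> D * (\<Sum>i<n. \<bar>f i\<bar> powr (1/t)) powr t
      \<and> (\<Sum>i<n. \<bar>f i\<bar> powr (1/t)) powr t \<le> D * M f"
    and f: "below n f"
  shows "N f \<le> (D * (1 + R)) * (\<Sum>i<n. \<bar>f i\<bar> powr (1/s)) powr s"
    and "(\<Sum>i<n. \<bar>f i\<bar> powr (1/s)) powr s \<le> (D * (1 + R)) * N f"
proof -
  define S where "S = (\<Sum>i<n. \<bar>f i\<bar> powr (1/s))"
  obtain b where b: "below n b" "M b \<le> R" "N f \<le> (\<Sum>i<n. f i * b i)" using norming_N[OF f] by blast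
  have "N f \<le> (\<Sum>i<n. \<bar>f i\<bar> * \<bar>b i\<bar>)"
    by (rule order.trans[OF b(3)], rule sum_mono) (metis abs_ge_self abs_mult)
  also have "\<dots> \<le> S powr s * (\<Sum>i<n. \<bar>b i\<bar> powr (1/t)) powr t"
    unfolding S_def by (rule Hoelder_sum) (use s in auto)
  also have "\<dots> \<le> S powr s * (D * R)"
  proof (rule mult_left_mono)
    have "(\<Sum>i<n. \<bar>b i\<bar> powr (1/t)) powr t \<le> D * M b" using M_lp[OF b(1)] by blast
    also have "\<dots> \<le> D * R" using b(2) D0 by (intro mult_left_mono) auto
    finally show "(\<Sum>i<n. \<bar>b i\<bar> powr (1/t)) powr t \<le> D * R" .
  qed simp
  also have "\<dots> \<le> S powr s * (D * (1 + R))" using D0 by (intro mult_left_mono) auto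
  finally show "N f \<le> (D * (1 + R)) * (\<Sum>i<n. \<bar>f i\<bar> powr (1/s)) powr s" by (simp add: S_def mult.commute)
  \<comment> \<open>The equality case of Hoelder's inequality: both \<open>f i * g i\<close> and
    \<open>\<bar>g i\<bar> powr (1/t)\<close> equal
    \<open>\<bar>f i\<bar> powr (1/s)\<close>.\<close>
  define g where "g i = sgn (f i) * \<bar>f i\<bar> powr (t/s)" for i
  have g: "below n g" using f by (simp add: below_def g_def)
  have "1/s = 1 + t/s" using s by (simp add: field_simps)
  then have "f i * g i = \<bar>f i\<bar> powr (1/s)" for i
    by (cases "f i = 0") (auto simp: g_def powr_add sgn_if)
  then have "S = (\<Sum>i<n. f i * g i)" by (simp add: S_def)
  also have "\<dots> \<le> N f * M g" by (rule pairing[OF f g])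
  also have "\<dots> \<le> N f * (D * S powr t)"
  proof (rule mult_left_mono)
    have "\<bar>g i\<bar> powr (1/t) = \<bar>f i\<bar> powr (1/s)" for i
      using s by (cases "f i = 0") (auto simp: g_def abs_mult powr_powr)
    then show "M g \<le> D * S powr t" using M_lp[OF g] by (simp add: S_def)
  qed (rule N.N_nonneg[OF f])
  finally have key: "S \<le> N f * (D * S powr t)" .
  have "S powr s \<le> D * N f"
  proof (cases "S = 0")
    case True
    then show ?thesis using D0 N.N_nonneg[OF f] by simp
  next
    case False
    moreover have "S \<ge> 0" unfolding S_def by (intro sum_nonneg) auto
    ultimately have S: "S > 0" by simp
    have "S powr s * S powr t = S" using S s by (simp add: powr_add[symmetric])
    then have "S powr s * S powr t \<le> (D * N f) * S powr t" using key by (simp add: mult_ac)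
    then show ?thesis using S by simp
  qed
  also have "\<dots> \<le> (D * (1 + R)) * N f" using D0 R_pos N.N_nonneg[OF f] by (intro mult_right_mono) auto
  finally show "(\<Sum>i<n. \<bar>f i\<bar> powr (1/s)) powr s \<le> (D * (1 + R)) * N f" by (simp add: S_def)
qed

text \<open>The two fundamental functions have exponents with \<open>s + t = 1\<close>. For
  \<open>s = 0\<close> the norms of indicators are bounded, the \<open>c\<^sub>0\<close> case,
  stated as an upper bound because \<open>coord\<close> is the matching lower one. For
  \<open>s = 1\<close> the same holds for \<open>M\<close>, so the sign vector of \<open>f\<close>
  has bounded \<open>M\<close>-norm and shows that \<open>N\<close> is of type
  \<open>l\<^sub>1\<close>.\<close>

theorem c0_or_lp:
  "(\<exists>D>0. \<forall>n f \<mu>. below n f \<longrightarrow> (\<forall>i. \<bar>f i\<bar> \<le> \<mu>) \<longrightarrow> N f \<le> D * \<mu>) \<or>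
   (\<exists>p\<ge>1. \<exists>D>0. \<forall>n f. below n f \<longrightarrow> N f \<le> D * (\<Sum>i<n. \<bar>f i\<bar> powr p) powr (1/p)
      \<and> (\<Sum>i<n. \<bar>f i\<bar> powr p) powr (1/p) \<le> D * N f)"
proof -
  interpret TN: tensor_model N C c "K * (1 + R * R)" by (rule tensor_model_N)
  interpret TM: tensor_model M C' c' "K * (1 + R * R)" by (rule dual_models.tensor_model_N[OF dual_models_sym])
  obtain s D where s: "0 \<le> s" "s \<le> 1" "D > 0"
    and D: "\<And>n. n \<ge> 1 \<Longrightarrow> real n powr s \<le> D * N.lam n \<and> N.lam n \<le> D * real n powr s"
    using TN.lam_exponent by blast
  obtain t D' where t: "0 \<le> t" "t \<le> 1" "D' > 0"
    and D': "\<And>n. n \<ge> 1 \<Longrightarrow> real n powr t \<le> D' * M.lam n \<and> M.lam n \<le> D' * real n powr t"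
    using TM.lam_exponent by blast
  \<comment> \<open>Since \<open>N.lam n * M.lam n\<close> is of order \<open>n\<close>, either sign
    of \<open>1 - (s + t)\<close> would make a positive power of \<open>n\<close> bounded.\<close>
  have "1 - (s + t) \<le> 0"
  proof (rule powr_bounded_imp_nonpos)
    fix n :: nat assume n: "n \<ge> 1"
    have "real n \<le> N.lam n * M.lam n" by (rule lam_product)
    also have "\<dots> \<le> (D * real n powr s) * (D' * real n powr t)"
      using D[OF n] D'[OF n] N.lam_pos[OF n] M.lam_pos[OF n] s t by (intro mult_mono) auto
    also have "\<dots> = D * D' * real n powr (s + t)" by (simp add: powr_add)
    finally show "real n powr (1 - (s + t)) \<le> D * D'" using n by (simp add: powr_diff field_simps)
  qed
  moreover have "(s + t) - 1 \<le> 0"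
  proof (rule powr_bounded_imp_nonpos)
    fix n :: nat assume n: "n \<ge> 1"
    have "real n powr (s + t) = real n powr s * real n powr t" by (simp add: powr_add)
    also have "\<dots> \<le> (D * N.lam n) * (D' * M.lam n)"
      using D[OF n] D'[OF n] N.lam_pos[OF n] M.lam_pos[OF n] s t by (intro mult_mono) auto
    also have "\<dots> = D * D' * (N.lam n * M.lam n)" by simp
    also have "\<dots> \<le> D * D' * (2 * C * R * real n)" using s t by (intro mult_left_mono lam_product) auto
    finally show "real n powr (s + t - 1) \<le> D * D' * (2 * C * R)" using n by (simp add: powr_diff field_simps)
  qed
  ultimately have st: "s + t = 1" by linarith
  consider "s = 0" | "s = 1" | "0 < s" "0 < t" using s t st by linarith
  then show ?thesis
  proof cases
    case 1
    have "N f \<le> (C * D) * \<mu>" if f: "below n f" "\<forall>i. \<bar>f i\<bar> \<le> \<mu>" for n f \<mu>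
    proof (cases "n = 0")
      case True
      then have "f = (\<lambda>_. 0)" using f by (auto simp: below_def)
      then show ?thesis using f N.C_pos s by (simp add: N.N_zero)
    next
      case False
      have "\<mu> \<ge> 0" using f(2) abs_ge_zero order_trans by blast
      have "N f \<le> C * (\<mu> * N.lam n)" by (rule N.N_le_sup) (use f in auto)
      also have "\<dots> \<le> C * (\<mu> * D)" using D[of n] False 1 N.C_pos \<open>\<mu> \<ge> 0\<close> by (intro mult_left_mono) auto
      finally show ?thesis by (simp add: mult_ac)
    qed
    moreover have "C * D > 0" using N.C_pos s by simp
    ultimately show ?thesis by blast
  next
    case 2
    then have t0: "t = 0" using st by simp
    define B where "B = N.lam 1 + C' * D'"
    have l1: "N.lam 1 > 0" by (rule N.lam_pos) simp
    have B: "B > 0" using l1 M.C_pos t by (simp add: B_def add_pos_pos)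
    have "N f \<le> B * (\<Sum>i<n. \<bar>f i\<bar> powr 1) powr (1/1) \<and> (\<Sum>i<n. \<bar>f i\<bar> powr 1) powr (1/1) \<le> B * N f"
      if f: "below n f" for n f
    proof -
      have e: "(\<Sum>i<n. \<bar>f i\<bar> powr 1) powr (1/1) = (\<Sum>i<n. \<bar>f i\<bar>)" by (simp add: sum_nonneg)
      have nn: "0 \<le> N f" by (rule N.N_nonneg[OF f])
      have "N f \<le> (\<Sum>i<n. \<bar>f i\<bar>) * N.lam 1" by (rule N.N_le_sum[OF f])
      also have "\<dots> \<le> (\<Sum>i<n. \<bar>f i\<bar>) * B" unfolding B_def using M.C_pos t by (intro mult_left_mono) (auto intro: sum_nonneg)
      finally have 1: "N f \<le> B * (\<Sum>i<n. \<bar>f i\<bar>)" by (simp add: mult.commute)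
      have g: "below n (\<lambda>i. sgn (f i))" using f by (simp add: below_def)
      have Mg: "M (\<lambda>i. sgn (f i)) \<le> C' * D'"
      proof (cases "n = 0")
        case True
        then have "f = (\<lambda>_. 0)" using f by (auto simp: below_def)
        then show ?thesis using M.C_pos t by (simp add: M.N_zero)
      next
        case False
        have "M (\<lambda>i. sgn (f i)) \<le> C' * (1 * M.lam n)" by (rule M.N_le_sup[OF g]) (simp add: abs_sgn_eq)
        also have "\<dots> \<le> C' * D'" using D'[of n] False t0 M.C_pos by (intro mult_left_mono) auto
        finally show ?thesis .
      qed
      have "(\<Sum>i<n. \<bar>f i\<bar>) = (\<Sum>i<n. f i * sgn (f i))" by (simp add: abs_sgn)
      also have "\<dots> \<le> N f * M (\<lambda>i. sgn (f i))" by (rule pairing[OF f g])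
      also have "\<dots> \<le> N f * B" unfolding B_def using Mg l1 nn by (intro mult_left_mono) auto
      finally show ?thesis unfolding e using 1 by (simp add: mult.commute)
    qed
    then show ?thesis using B by (intro disjI2 exI[of _ "1::real"]) auto
  next
    case 3
    have "\<exists>D>0. \<forall>n f. below n f \<longrightarrow> N f \<le> D * (\<Sum>i<n. \<bar>f i\<bar> powr (1/s)) powr s
      \<and> (\<Sum>i<n. \<bar>f i\<bar> powr (1/s)) powr s \<le> D * N f"
    proof (cases "\<forall>B. \<exists>L. B < N (dyadic_vec s L)")
      case True
      then show ?thesis using TN.lp_estimate[OF 3(1) s(3) D] by blast
    next
      case False
      then obtain B where B: "\<And>L. N (dyadic_vec s L) \<le> B" by (metis not_le_imp_less)
      have "\<exists>L. A < M (dyadic_vec t L)" for A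
      proof -
        obtain L :: nat where L: "\<bar>B\<bar> * \<bar>A\<bar> < real L" using reals_Archimedean2 by blast
        have nn: "0 \<le> M (dyadic_vec t L)" by (rule M.N_nonneg[OF below_dyadic_vec])
        have "real L + 1 \<le> (\<Sum>i<2 ^ L. dyadic_vec s L i * dyadic_vec t L i)" by (rule dyadic_pairing[OF st])
        also have "\<dots> \<le> N (dyadic_vec s L) * M (dyadic_vec t L)" by (rule pairing[OF below_dyadic_vec below_dyadic_vec])
        also have "\<dots> \<le> \<bar>B\<bar> * M (dyadic_vec t L)" using B[of L] nn by (intro mult_right_mono) auto
        finally have "\<bar>B\<bar> * \<bar>A\<bar> < \<bar>B\<bar> * M (dyadic_vec t L)" using L by simp
        then have "\<bar>A\<bar> < M (dyadic_vec t L)" by (rule mult_left_less_imp_less) simp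
        then show ?thesis by (intro exI[of _ L]) linarith
      qed
      then obtain D2 where D2: "D2 > 0" "\<And>n f. below n f \<Longrightarrow> M f \<le> D2 * (\<Sum>i<n. \<bar>f i\<bar> powr (1/t)) powr t
          \<and> (\<Sum>i<n. \<bar>f i\<bar> powr (1/t)) powr t \<le> D2 * M f"
        using TM.lp_estimate[OF 3(2) t(3) D'] by blast
      have "D2 * (1 + R) > 0" using D2 R_pos by simp
      then show ?thesis using lp_transfer[OF 3 st D2] by blast
    qed
    moreover have "1/s \<ge> 1" using 3 s by simp
    ultimately show ?thesis by (intro disjI2 exI[of _ "1/s"]) auto
  qed
qed

end

section \<open>Extraction of spreading models\<close>

text \<open>A form of the spreading model property that is stable under subsequences and limits: the
  error is uniform over coefficients bounded by \<open>\<mu>\<close>, but no rate depending on \<open>k 0\<close> is demanded.\<close>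

definition spm :: "(nat \<Rightarrow> 'b::real_normed_vector) \<Rightarrow> ((nat \<Rightarrow> real) \<Rightarrow> real) \<Rightarrow> bool" where
  "spm y M \<longleftrightarrow> (\<forall>n \<epsilon>. \<epsilon> > 0 \<longrightarrow> (\<exists>m. \<forall>f k \<mu>. below n f \<longrightarrow> (\<forall>i. \<bar>f i\<bar> \<le> \<mu>) \<longrightarrow> strict_mono k \<longrightarrow> m \<le> k 0 \<longrightarrow>
     \<bar>norm (\<Sum>i<n. f i *\<^sub>R y (k i)) - M f\<bar> \<le> \<epsilon> * \<mu>))"

section \<open>Stabilizing norms by Ramsey's theorem\<close>

text \<open>Colour each \<open>n\<close>-element set of indices by the integer part of the norm in
  units of \<open>\<eta>\<close>. The norms are bounded, so finitely many colours occur, and on a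
  homogeneous set the norm varies by at most \<open>\<eta>\<close>.\<close>

lemma ramsey_norm_single:
  fixes x :: "nat \<Rightarrow> 'b::real_normed_vector"
    and n :: nat and g :: "nat \<Rightarrow> real"
  assumes B: "\<And>i. norm (x i) \<le> B" and \<eta>: "\<eta> > 0"
  shows "\<exists>r::nat \<Rightarrow> nat. strict_mono r \<and> (\<forall>k l::nat \<Rightarrow> nat. strict_mono k \<longrightarrow> strict_mono l \<longrightarrow>
    \<bar>norm (\<Sum>i<n. g i *\<^sub>R x (r (k i))) - norm (\<Sum>i<n. g i *\<^sub>R x (r (l i)))\<bar> \<le> \<eta>)"
proof -
  define S where "S X = norm (\<Sum>i<n. g i *\<^sub>R x (sorted_list_of_set X ! i))" for X
  define A where "A = (\<Sum>i<n. \<bar>g i\<bar> * B)"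
  have SA: "S X \<le> A" for X
    unfolding S_def A_def by (rule sum_norm_le) (auto intro: mult_left_mono B)
  define col where "col X = nat \<lfloor>S X / \<eta>\<rfloor>" for X
  define s where "s = Suc (nat \<lfloor>A / \<eta>\<rfloor>)"
  have "col X < s" for X
    unfolding col_def s_def less_Suc_eq_le by (intro nat_mono floor_mono divide_right_mono SA) (use \<eta> in simp)
  then obtain Y t where Y: "infinite Y" "\<And>X. X \<subseteq> Y \<Longrightarrow> finite X \<Longrightarrow> card X = n \<Longrightarrow> col X = t"
    using Ramsey[of "UNIV :: nat set" n col s] by auto
  define r where "r = enumerate Y"
  have r: "strict_mono r" unfolding r_def by (rule strict_mono_enumerate[OF Y(1)])
  have rY: "r i \<in> Y" for i unfolding r_def by (rule enumerate_in_set[OF Y(1)])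
  have key: "norm (\<Sum>i<n. g i *\<^sub>R x (r (k i))) = S ((\<lambda>i. r (k i)) ` {..<n})"
    "col ((\<lambda>i. r (k i)) ` {..<n}) = t" if k: "strict_mono k" for k
  proof -
    have rk: "strict_mono (\<lambda>i. r (k i))" using strict_mono_o[OF r k] by (simp add: o_def)
    define xs where "xs = map (\<lambda>i. r (k i)) [0..<n]"
    have "sorted_wrt (<) xs"
      unfolding xs_def sorted_wrt_map using rk by (auto simp: sorted_wrt_upt strict_mono_def intro!: sorted_wrt_mono_rel[OF _ sorted_wrt_upt])
    then have "sorted_list_of_set (set xs) = xs"
      by (simp add: strict_sorted_iff sorted_list_of_set.idem_if_sorted_distinct)
    moreover have "set xs = (\<lambda>i. r (k i)) ` {..<n}" by (auto simp: xs_def)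
    ultimately show "norm (\<Sum>i<n. g i *\<^sub>R x (r (k i))) = S ((\<lambda>i. r (k i)) ` {..<n})"
      by (simp add: S_def xs_def)
    show "col ((\<lambda>i. r (k i)) ` {..<n}) = t"
    proof (rule Y(2))
      show "card ((\<lambda>i. r (k i)) ` {..<n}) = n"
        using rk by (subst card_image) (auto intro: inj_on_subset[OF strict_mono_imp_inj_on])
    qed (use rY in auto)
  qed
  have Snn: "0 \<le> S X" for X by (simp add: S_def)
  have "\<bar>S X - S Z\<bar> \<le> \<eta>" if "col X = col Z" for X Z
  proof -
    have fl: "\<lfloor>S X / \<eta>\<rfloor> = \<lfloor>S Z / \<eta>\<rfloor>"
      using that Snn \<eta> unfolding col_def by (subst (asm) eq_nat_nat_iff) auto
    have "\<bar>S X / \<eta> - S Z / \<eta>\<bar> < 1" using fl by linarith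
    then have "\<bar>(S X - S Z) / \<eta>\<bar> < 1" by (simp add: diff_divide_distrib)
    then show ?thesis using \<eta> by (simp add: abs_divide)
  qed
  then show ?thesis using r key by (intro exI[of _ r]) auto
qed

lemma ramsey_norm_finite:
  fixes x :: "nat \<Rightarrow> 'b::real_normed_vector"
    and n :: nat and G :: "(nat \<Rightarrow> real) set"
  assumes "finite G" and B: "\<And>i. norm (x i) \<le> B" and \<eta>: "\<eta> > 0"
  shows "\<exists>r::nat \<Rightarrow> nat. strict_mono r \<and> (\<forall>g\<in>G. \<forall>k l::nat \<Rightarrow> nat. strict_mono k \<longrightarrow> strict_mono l \<longrightarrow>
    \<bar>norm (\<Sum>i<n. g i *\<^sub>R x (r (k i))) - norm (\<Sum>i<n. g i *\<^sub>R x (r (l i)))\<bar> \<le> \<eta>)"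
  using assms(1)
proof (induction G rule: finite_induct)
  case empty
  show ?case by (intro exI[of _ id]) (simp add: strict_mono_def)
next
  case (insert g G)
  then obtain r :: "nat \<Rightarrow> nat" where r: "strict_mono r" and rG: "\<And>g (k::nat \<Rightarrow> nat) (l::nat \<Rightarrow> nat). g \<in> G \<Longrightarrow> strict_mono k \<Longrightarrow> strict_mono l \<Longrightarrow>
    \<bar>norm (\<Sum>i<n. g i *\<^sub>R x (r (k i))) - norm (\<Sum>i<n. g i *\<^sub>R x (r (l i)))\<bar> \<le> \<eta>" by blast
  obtain r' :: "nat \<Rightarrow> nat" where r': "strict_mono r'" and rg: "\<And>(k::nat \<Rightarrow> nat) (l::nat \<Rightarrow> nat). strict_mono k \<Longrightarrow> strict_mono l \<Longrightarrow>
    \<bar>norm (\<Sum>i<n. g i *\<^sub>R x (r (r' (k i)))) - norm (\<Sum>i<n. g i *\<^sub>R x (r (r' (l i))))\<bar> \<le> \<eta>"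
    using ramsey_norm_single[of "\<lambda>i. x (r i)" B \<eta> g n] B \<eta> by blast
  have o: "strict_mono (\<lambda>i. r' (k i))" if "strict_mono k" for k
    using strict_mono_o[OF r' that] by (simp add: o_def)
  have "strict_mono (r \<circ> r')" by (rule strict_mono_o[OF r r'])
  then show ?case using rg rG[OF _ o o] by (intro exI[of _ "\<lambda>i. r (r' i)"]) (auto simp: o_def)
qed

text \<open>A grid of mesh \<open>1 / q\<close> reduces the cube to finitely many coefficient
  vectors. These get the error \<open>\<eta> / 2\<close>, and \<open>q\<close> is chosen so that
  rounding costs \<open>\<eta> / 4\<close> in each of the two norms.\<close>

lemma ramsey_norm_cube:
  fixes x :: "nat \<Rightarrow> 'b::real_normed_vector"
    and n :: nat
  assumes B: "\<And>i. norm (x i) \<le> B" and \<eta>: "\<eta> > 0"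
  shows "\<exists>r::nat \<Rightarrow> nat. strict_mono r \<and> (\<forall>f k l. below n f \<longrightarrow> (\<forall>i. \<bar>f i\<bar> \<le> 1) \<longrightarrow> strict_mono k \<longrightarrow> strict_mono l \<longrightarrow>
    \<bar>norm (\<Sum>i<n. f i *\<^sub>R x (r (k i))) - norm (\<Sum>i<n. f i *\<^sub>R x (r (l i)))\<bar> \<le> \<eta>)"
proof -
  have B0: "0 \<le> B" using B[of 0] norm_ge_zero order_trans by blast
  obtain q :: nat where q: "4 * real n * B / \<eta> < real q" using reals_Archimedean2 by blast
  have "0 \<le> 4 * real n * B / \<eta>" using B0 \<eta> by simp
  then have q0: "real q > 0" using q by linarith
  have qB: "real n * (1 / real q * B) \<le> \<eta> / 4" using q q0 \<eta> by (simp add: field_simps)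
  define G where "G = (\<lambda>h i. if i < n then real_of_int (h i) / real q else 0) ` (PiE {..<n} (\<lambda>_. {- int q..int q}))"
  have "finite G" unfolding G_def by (intro finite_imageI finite_PiE) auto
  then obtain r :: "nat \<Rightarrow> nat" where r: "strict_mono r" and rG: "\<And>g (k::nat \<Rightarrow> nat) (l::nat \<Rightarrow> nat). g \<in> G \<Longrightarrow> strict_mono k \<Longrightarrow> strict_mono l \<Longrightarrow>
    \<bar>norm (\<Sum>i<n. g i *\<^sub>R x (r (k i))) - norm (\<Sum>i<n. g i *\<^sub>R x (r (l i)))\<bar> \<le> \<eta> / 2"
    using ramsey_norm_finite[of G x B "\<eta> / 2" n] B \<eta> by fastforce
  have "\<bar>norm (\<Sum>i<n. f i *\<^sub>R x (r (k i))) - norm (\<Sum>i<n. f i *\<^sub>R x (r (l i)))\<bar> \<le> \<eta>"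
    if f: "\<forall>i. \<bar>f i\<bar> \<le> 1" and kl: "strict_mono k" "strict_mono l" for f k l
  proof -
    define h where "h = restrict (\<lambda>i. \<lfloor>real q * f i\<rfloor>) {..<n}"
    have "h \<in> PiE {..<n} (\<lambda>_. {- int q..int q})"
    proof -
      have "- int q \<le> \<lfloor>real q * f i\<rfloor>" "\<lfloor>real q * f i\<rfloor> \<le> int q" for i
      proof -
        have "- 1 \<le> f i" "f i \<le> 1" using f by (auto simp: abs_le_iff)
        then have "- real q \<le> real q * f i" "real q * f i \<le> real q"
          using q0 mult_left_mono[of "-1" "f i" "real q"] mult_left_mono[of "f i" 1 "real q"] by auto
        then show "- int q \<le> \<lfloor>real q * f i\<rfloor>" "\<lfloor>real q * f i\<rfloor> \<le> int q" by linarith+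
      qed
      then show ?thesis by (auto simp: h_def)
    qed
    define g where "g i = (if i < n then real_of_int (h i) / real q else 0)" for i
    have gG: "g \<in> G" unfolding G_def g_def using \<open>h \<in> _\<close> by blast
    have fg: "\<bar>f i - g i\<bar> \<le> 1 / real q" if "i < n" for i
    proof -
      have "\<bar>real q * f i - real_of_int \<lfloor>real q * f i\<rfloor>\<bar> \<le> 1" by linarith
      then have "\<bar>(real q * f i - real_of_int \<lfloor>real q * f i\<rfloor>) / real q\<bar> \<le> 1 / real q"
        using q0 by (simp add: abs_divide divide_right_mono)
      moreover have "(real q * f i - real_of_int \<lfloor>real q * f i\<rfloor>) / real q = f i - g i"
        using that q0 by (simp add: g_def h_def diff_divide_distrib)
      ultimately show ?thesis by simp
    qed
    have close: "\<bar>norm (\<Sum>i<n. f i *\<^sub>R z i) - norm (\<Sum>i<n. g i *\<^sub>R z i)\<bar> \<le> \<eta> / 4" if "\<And>i. norm (z i) \<le> B" for z :: "nat \<Rightarrow> 'b"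
    proof -
      have "\<bar>norm (\<Sum>i<n. f i *\<^sub>R z i) - norm (\<Sum>i<n. g i *\<^sub>R z i)\<bar> \<le> norm ((\<Sum>i<n. f i *\<^sub>R z i) - (\<Sum>i<n. g i *\<^sub>R z i))"
        by (rule norm_triangle_ineq3)
      also have "\<dots> = norm (\<Sum>i<n. (f i - g i) *\<^sub>R z i)" by (simp add: sum_subtractf scaleR_diff_left)
      also have "\<dots> \<le> (\<Sum>i<n. 1 / real q * B)"
        by (rule sum_norm_le) (use fg that in \<open>auto intro!: mult_mono simp del: times_divide_eq_left\<close>)
      also have "\<dots> \<le> \<eta> / 4" using qB by simp
      finally show ?thesis .
    qed
    have "\<bar>norm (\<Sum>i<n. g i *\<^sub>R x (r (k i))) - norm (\<Sum>i<n. g i *\<^sub>R x (r (l i)))\<bar> \<le> \<eta> / 2"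
      by (rule rG[OF gG kl])
    moreover have "\<bar>norm (\<Sum>i<n. f i *\<^sub>R x (r (k i))) - norm (\<Sum>i<n. g i *\<^sub>R x (r (k i)))\<bar> \<le> \<eta> / 4" by (rule close) (rule B)
    moreover have "\<bar>norm (\<Sum>i<n. f i *\<^sub>R x (r (l i))) - norm (\<Sum>i<n. g i *\<^sub>R x (r (l i)))\<bar> \<le> \<eta> / 4" by (rule close) (rule B)
    ultimately show ?thesis by linarith
  qed
  with r show ?thesis by blast
qed

text \<open>Diagonalize over \<open>n\<close> with error \<open>1 / (n + 1)\<close> for vectors of
  length \<open>n\<close>: from index \<open>n + 1\<close> on, the diagonal sequence has the
  property for \<open>n\<close>. Hence the norms along \<open>m, m + 1, ...\<close> are Cauchy, and
  their limit is the model.\<close>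

lemma spm_subsequence_exists:
  fixes y :: "nat \<Rightarrow> 'b::real_normed_vector"
  assumes B: "\<And>i. norm (y i) \<le> B"
  shows "\<exists>r M. strict_mono r \<and> spm (\<lambda>i. y (r i)) M"
proof -
  define P where "P n s \<longleftrightarrow> (\<forall>f k l. below n f \<longrightarrow> (\<forall>i. \<bar>f i\<bar> \<le> 1) \<longrightarrow> strict_mono k \<longrightarrow> strict_mono l \<longrightarrow>
    \<bar>norm (\<Sum>i<n. f i *\<^sub>R y (s (k i))) - norm (\<Sum>i<n. f i *\<^sub>R y (s (l i)))\<bar> \<le> 1 / real (Suc n))" for n and s :: "nat \<Rightarrow> nat"
  have PD: "\<bar>norm (\<Sum>i<n. f i *\<^sub>R y (s (k i))) - norm (\<Sum>i<n. f i *\<^sub>R y (s (l i)))\<bar> \<le> 1 / real (Suc n)"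
    if "P n s" "below n f" "\<forall>i. \<bar>f i\<bar> \<le> 1" "strict_mono k" "strict_mono l" for n s f k l
    using that unfolding P_def by blast
  interpret subseqs P
  proof
    fix n and s :: "nat \<Rightarrow> nat"
    show "\<exists>r'. strict_mono r' \<and> P n (s \<circ> r')"
      using ramsey_norm_cube[of "\<lambda>i. y (s i)" B "1 / real (Suc n)" n] B unfolding P_def o_def by auto
  qed
  define d where "d = diagseq"
  have d: "strict_mono d" unfolding d_def by (rule subseq_diagseq)
  have hered: "P n (s \<circ> r)" if "strict_mono r" "P n s" for n r s
    unfolding P_def
  proof (intro allI impI)
    fix f k l assume "below n f" "\<forall>i. \<bar>f i\<bar> \<le> 1" and k: "strict_mono (k::nat \<Rightarrow> nat)" and l: "strict_mono (l::nat \<Rightarrow> nat)"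
    moreover have "strict_mono (\<lambda>i. r (k i))" "strict_mono (\<lambda>i. r (l i))"
      using strict_mono_o[OF that(1) k] strict_mono_o[OF that(1) l] by (simp_all add: o_def)
    ultimately show "\<bar>norm (\<Sum>i<n. f i *\<^sub>R y ((s \<circ> r) (k i))) - norm (\<Sum>i<n. f i *\<^sub>R y ((s \<circ> r) (l i)))\<bar> \<le> 1 / real (Suc n)"
      using that(2) unfolding P_def o_def by blast
  qed
  have Pd: "P n (diagseq \<circ> ((+) (Suc n)))" for n
    by (rule diagseq_holds) (rule hered)
  have unit: "\<bar>norm (\<Sum>i<n. f i *\<^sub>R y (d (k i))) - norm (\<Sum>i<n. f i *\<^sub>R y (d (l i)))\<bar> \<le> 1 / real (Suc n)"
    if f: "below n f" "\<forall>i. \<bar>f i\<bar> \<le> 1" and k: "strict_mono k" "Suc n \<le> k 0" and l: "strict_mono l" "Suc n \<le> l 0" for n f k l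
  proof -
    have sh: "strict_mono (\<lambda>i. k i - Suc n) \<and> (\<forall>i. Suc n + (k i - Suc n) = k i)" if "strict_mono k" "Suc n \<le> k 0" for k :: "nat \<Rightarrow> nat"
    proof -
      have ge: "Suc n \<le> k i" for i using that strict_mono_less_eq[of k 0 i] by (meson le0 le_trans)
      have "strict_mono (\<lambda>i. k i - Suc n)" using that(1) ge by (auto simp: strict_mono_def intro!: diff_less_mono)
      moreover have "Suc n + (k i - Suc n) = k i" for i using ge[of i] by (rule le_add_diff_inverse)
      ultimately show ?thesis by blast
    qed
    show ?thesis
      using PD[OF Pd f conjunct1[OF sh[OF k]] conjunct1[OF sh[OF l]]]
        conjunct2[OF sh[OF k]] conjunct2[OF sh[OF l]] by (simp add: d_def)
  qed
  \<comment> \<open>A vector of length \<open>n\<close> is also one of any length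
    \<open>q \<ge> n\<close>, which makes the error as small as desired; dividing by
    \<open>\<mu>\<close> reduces to the unit cube.\<close>
  have main: "\<bar>norm (\<Sum>i<n. f i *\<^sub>R y (d (k i))) - norm (\<Sum>i<n. f i *\<^sub>R y (d (l i)))\<bar> \<le> \<mu> / real (Suc q)"
    if f: "below n f" "\<forall>i. \<bar>f i\<bar> \<le> \<mu>" and q: "n \<le> q" and k: "strict_mono k" "Suc q \<le> k 0" and l: "strict_mono l" "Suc q \<le> l 0" for n f k l \<mu> q
  proof (cases "\<mu> > 0")
    case False
    then have "f i = 0" for i using f(2) by (metis abs_ge_zero abs_le_zero_iff linorder_not_less order_antisym_conv order_trans)
    moreover have "\<mu> \<ge> 0" using f(2) abs_ge_zero order_trans by blast
    ultimately show ?thesis by simp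
  next
    case True
    define g where "g i = f i / \<mu>" for i
    have g: "below q g" "\<forall>i. \<bar>g i\<bar> \<le> 1"
      using f True below_mono[OF f(1) q] by (auto simp: g_def below_def abs_divide)
    have e: "norm (\<Sum>i<n. f i *\<^sub>R y (d (k i))) = \<mu> * norm (\<Sum>i<q. g i *\<^sub>R y (d (k i)))" for k
    proof -
      have "(\<Sum>i<n. f i *\<^sub>R y (d (k i))) = (\<Sum>i<q. f i *\<^sub>R y (d (k i)))"
        by (rule sum.mono_neutral_left) (use q belowD[OF f(1)] in auto)
      also have "\<dots> = \<mu> *\<^sub>R (\<Sum>i<q. g i *\<^sub>R y (d (k i)))"
        unfolding scaleR_sum_right using True by (simp add: g_def)
      finally show ?thesis using True by simp
    qed
    have "\<bar>norm (\<Sum>i<q. g i *\<^sub>R y (d (k i))) - norm (\<Sum>i<q. g i *\<^sub>R y (d (l i)))\<bar> \<le> 1 / real (Suc q)"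
      by (rule unit[OF g k l])
    then have "\<mu> * \<bar>norm (\<Sum>i<q. g i *\<^sub>R y (d (k i))) - norm (\<Sum>i<q. g i *\<^sub>R y (d (l i)))\<bar> \<le> \<mu> * (1 / real (Suc q))"
      using True by (intro mult_left_mono) auto
    then show ?thesis unfolding e right_diff_distrib[symmetric] abs_mult using True by simp
  qed
  \<comment> \<open>Summing over the support makes \<open>M f\<close> independent of the length
    \<open>n\<close> used to describe \<open>f\<close>.\<close>
  define M where "M f = lim (\<lambda>m. norm (\<Sum>i | f i \<noteq> 0. f i *\<^sub>R y (d (m + i))))" for f
  have Mlim: "(\<lambda>m. norm (\<Sum>i<n. f i *\<^sub>R y (d (m + i)))) \<longlonglongrightarrow> M f" if f: "below n f" for f n
  proof -
    obtain \<mu> where \<mu>0: "\<mu> > 0" and f\<mu>: "\<forall>i. \<bar>f i\<bar> \<le> \<mu>" using below_bounded[OF f] by blast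
    have e: "(\<Sum>i | f i \<noteq> 0. f i *\<^sub>R y (d (m + i))) = (\<Sum>i<n. f i *\<^sub>R y (d (m + i)))" for m
      by (rule sum.mono_neutral_left) (use below_lt[OF f] in auto)
    have "Cauchy (\<lambda>m. norm (\<Sum>i<n. f i *\<^sub>R y (d (m + i))))"
    proof (rule metric_CauchyI)
      fix \<epsilon> :: real assume \<epsilon>: "\<epsilon> > 0"
      obtain q0 :: nat where q0: "\<mu> / \<epsilon> < real q0" using reals_Archimedean2 by blast
      define q where "q = max n q0"
      have q: "\<mu> / real (Suc q) < \<epsilon>"
      proof -
        have "\<mu> / \<epsilon> < real (Suc q)" using q0 by (simp add: q_def)
        then show ?thesis using \<epsilon> by (simp add: field_simps)
      qed
      have "dist (norm (\<Sum>i<n. f i *\<^sub>R y (d (m + i)))) (norm (\<Sum>i<n. f i *\<^sub>R y (d (m' + i)))) < \<epsilon>"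
        if "m \<ge> Suc q" "m' \<ge> Suc q" for m m'
        using main[OF f f\<mu>, of q "\<lambda>i. m + i" "\<lambda>i. m' + i"] that q by (simp add: dist_real_def strict_mono_def q_def)
      then show "\<exists>M. \<forall>m\<ge>M. \<forall>n'\<ge>M. dist (norm (\<Sum>i<n. f i *\<^sub>R y (d (m + i)))) (norm (\<Sum>i<n. f i *\<^sub>R y (d (n' + i)))) < \<epsilon>" by blast
    qed
    then have "convergent (\<lambda>m. norm (\<Sum>i<n. f i *\<^sub>R y (d (m + i))))" by (rule Cauchy_convergent)
    then show ?thesis unfolding M_def e by (simp add: convergent_LIMSEQ_iff)
  qed
  have "spm (\<lambda>i. y (d i)) M"
    unfolding spm_def
  proof (intro allI impI)
    fix n :: nat and \<epsilon> :: real assume \<epsilon>: "\<epsilon> > 0"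
    obtain q0 :: nat where q0: "1 / \<epsilon> < real q0" using reals_Archimedean2 by blast
    define q where "q = max n q0"
    have q: "1 / real (Suc q) \<le> \<epsilon>"
    proof -
      have "1 / \<epsilon> < real (Suc q)" using q0 by (simp add: q_def)
      then show ?thesis using \<epsilon> by (simp add: field_simps)
    qed
    have "\<bar>norm (\<Sum>i<n. f i *\<^sub>R y (d (k i))) - M f\<bar> \<le> \<epsilon> * \<mu>"
      if f: "below n f" "\<forall>i. \<bar>f i\<bar> \<le> \<mu>" and k: "strict_mono k" "Suc q \<le> k 0" for f k \<mu>
    proof -
      have \<mu>: "\<mu> \<ge> 0" using f(2) abs_ge_zero order_trans by blast
      have "(\<lambda>m. \<bar>norm (\<Sum>i<n. f i *\<^sub>R y (d (k i))) - norm (\<Sum>i<n. f i *\<^sub>R y (d (m + i)))\<bar>) \<longlonglongrightarrow> \<bar>norm (\<Sum>i<n. f i *\<^sub>R y (d (k i))) - M f\<bar>"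
        by (intro tendsto_intros Mlim f)
      moreover have "\<forall>m\<ge>Suc q. \<bar>norm (\<Sum>i<n. f i *\<^sub>R y (d (k i))) - norm (\<Sum>i<n. f i *\<^sub>R y (d (m + i)))\<bar> \<le> \<mu> / real (Suc q)"
        using main[OF f _ k, of "\<lambda>i. _ + i"] by (auto simp: strict_mono_def q_def)
      ultimately have "\<bar>norm (\<Sum>i<n. f i *\<^sub>R y (d (k i))) - M f\<bar> \<le> \<mu> / real (Suc q)" by (intro Lim_bounded) auto
      also have "\<dots> \<le> \<epsilon> * \<mu>" using mult_right_mono[OF q \<mu>] by simp
      finally show ?thesis .
    qed
    then show "\<exists>m. \<forall>f k \<mu>. below n f \<longrightarrow> (\<forall>i. \<bar>f i\<bar> \<le> \<mu>) \<longrightarrow> strict_mono k \<longrightarrow> m \<le> k 0 \<longrightarrow>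
        \<bar>norm (\<Sum>i<n. f i *\<^sub>R y (d (k i))) - M f\<bar> \<le> \<epsilon> * \<mu>" by blast
  qed
  with d show ?thesis by blast
qed

section \<open>Properties of the limit norm\<close>

lemma spm_tendsto:
  assumes "spm y M" and f: "below n f"
    and k: "\<And>m. strict_mono (k m)" "\<And>m. m \<le> k m 0"
  shows "(\<lambda>m. norm (\<Sum>i<n. f i *\<^sub>R y (k m i))) \<longlonglongrightarrow> M f"
proof (rule metric_LIMSEQ_I)
  fix \<epsilon> :: real assume \<epsilon>: "\<epsilon> > 0"
  obtain \<mu> where \<mu>0: "\<mu> > 0" and f\<mu>: "\<forall>i. \<bar>f i\<bar> \<le> \<mu>" using below_bounded[OF f] by blast
  define \<epsilon>' where "\<epsilon>' = \<epsilon> / (2 * \<mu>)"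
  have "\<epsilon>' > 0" using \<epsilon> \<mu>0 by (simp add: \<epsilon>'_def)
  then obtain m where m: "\<And>f k \<nu>. below n f \<Longrightarrow> \<forall>i. \<bar>f i\<bar> \<le> \<nu> \<Longrightarrow> strict_mono k \<Longrightarrow> m \<le> k 0 \<Longrightarrow>
     \<bar>norm (\<Sum>i<n. f i *\<^sub>R y (k i)) - M f\<bar> \<le> \<epsilon>' * \<nu>"
    using assms(1) unfolding spm_def by meson
  have "dist (norm (\<Sum>i<n. f i *\<^sub>R y (k p i))) (M f) < \<epsilon>" if "p \<ge> m" for p
  proof -
    have "\<bar>norm (\<Sum>i<n. f i *\<^sub>R y (k p i)) - M f\<bar> \<le> \<epsilon>' * \<mu>"
      by (rule m[OF f f\<mu> k(1)]) (use k(2)[of p] that in linarith)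
    also have "\<dots> < \<epsilon>" using \<epsilon> \<mu>0 by (simp add: \<epsilon>'_def)
    finally show ?thesis by (simp add: dist_real_def)
  qed
  then show "\<exists>m. \<forall>p\<ge>m. dist (norm (\<Sum>i<n. f i *\<^sub>R y (k p i))) (M f) < \<epsilon>" by blast
qed

lemma spm_tendsto_shift:
  assumes "spm y M" "below n f"
  shows "(\<lambda>m. norm (\<Sum>i<n. f i *\<^sub>R y (i + m))) \<longlonglongrightarrow> M f"
  by (rule spm_tendsto[OF assms]) (auto simp: strict_mono_def)

lemma spm_triangle:
  assumes "spm y M" "below n f" "below n g"
  shows "M (\<lambda>i. f i + g i) \<le> M f + M g"
proof (rule LIMSEQ_le)
  show "(\<lambda>m. norm (\<Sum>i<n. (f i + g i) *\<^sub>R y (i + m))) \<longlonglongrightarrow> M (\<lambda>i. f i + g i)"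
    by (rule spm_tendsto_shift[OF assms(1) below_add[OF assms(2,3)]])
  show "(\<lambda>m. norm (\<Sum>i<n. f i *\<^sub>R y (i + m)) + norm (\<Sum>i<n. g i *\<^sub>R y (i + m))) \<longlonglongrightarrow> M f + M g"
    by (intro tendsto_add spm_tendsto_shift assms)
  show "\<exists>N. \<forall>m\<ge>N. norm (\<Sum>i<n. (f i + g i) *\<^sub>R y (i + m)) \<le> norm (\<Sum>i<n. f i *\<^sub>R y (i + m)) + norm (\<Sum>i<n. g i *\<^sub>R y (i + m))"
    by (auto simp: scaleR_add_left sum.distrib norm_triangle_ineq)
qed

lemma spm_scale:
  assumes "spm y M" "below n f"
  shows "M (\<lambda>i. t * f i) = \<bar>t\<bar> * M f"
proof (rule LIMSEQ_unique)
  show "(\<lambda>m. norm (\<Sum>i<n. (t * f i) *\<^sub>R y (i + m))) \<longlonglongrightarrow> M (\<lambda>i. t * f i)"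
    by (rule spm_tendsto_shift[OF assms(1) below_scale[OF assms(2)]])
  have "(\<lambda>m. \<bar>t\<bar> * norm (\<Sum>i<n. f i *\<^sub>R y (i + m))) \<longlonglongrightarrow> \<bar>t\<bar> * M f"
    by (intro tendsto_mult_left spm_tendsto_shift assms)
  then show "(\<lambda>m. norm (\<Sum>i<n. (t * f i) *\<^sub>R y (i + m))) \<longlonglongrightarrow> \<bar>t\<bar> * M f"
    by (simp add: scaleR_scaleR[symmetric] scaleR_sum_right[symmetric] del: scaleR_scaleR)
qed

text \<open>Along the index sequences \<open>k i + m\<close> and \<open>i + m\<close> the two
  arguments produce the same sum of vectors, so the limits agree.\<close>

lemma spm_spread:
  assumes "spm y M" and f: "below n f" and k: "strict_mono k" "{i. f i \<noteq> 0} \<subseteq> range k"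
  shows "M (\<lambda>i. f (k i)) = M f"
proof (rule LIMSEQ_unique)
  have ki: "i \<le> k i" for i using k(1) by (rule strict_mono_imp_increasing)
  have b: "below n (\<lambda>i. f (k i))" unfolding below_def using belowD[OF f] ki by (meson le_trans)
  show "(\<lambda>m. norm (\<Sum>i<n. f (k i) *\<^sub>R y (k i + m))) \<longlonglongrightarrow> M (\<lambda>i. f (k i))"
    by (rule spm_tendsto[OF assms(1) b]) (use k(1) in \<open>auto simp: strict_mono_def\<close>)
  have "(\<Sum>i<n. f (k i) *\<^sub>R y (k i + m)) = (\<Sum>i<n. f i *\<^sub>R y (i + m))" for m
  proof -
    have inj: "inj_on k {..<n}" using k(1) by (meson inj_on_subset strict_mono_imp_inj_on subset_UNIV)
    have "(\<Sum>i<n. f (k i) *\<^sub>R y (k i + m)) = (\<Sum>j\<in>k ` {..<n}. f j *\<^sub>R y (j + m))"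
      by (simp add: sum.reindex[OF inj])
    also have "\<dots> = (\<Sum>j\<in>{i. f i \<noteq> 0}. f j *\<^sub>R y (j + m))"
    proof (rule sum.mono_neutral_right)
      show "{i. f i \<noteq> 0} \<subseteq> k ` {..<n}"
      proof
        fix j assume j: "j \<in> {i. f i \<noteq> 0}"
        then obtain i where i: "j = k i" using k(2) by blast
        have "j < n" using below_lt[OF f] j by simp
        then have "i < n" using i ki[of i] by simp
        then show "j \<in> k ` {..<n}" using i by blast
      qed
    qed auto
    also have "\<dots> = (\<Sum>i<n. f i *\<^sub>R y (i + m))"
      by (rule sum.mono_neutral_left) (use below_lt[OF f] in auto)
    finally show ?thesis .
  qed
  then show "(\<lambda>m. norm (\<Sum>i<n. f (k i) *\<^sub>R y (k i + m))) \<longlonglongrightarrow> M f"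
    using spm_tendsto_shift[OF assms(1) f] by simp
qed

lemma spm_subseq:
  assumes "spm y M" "strict_mono r"
  shows "spm (\<lambda>i. y (r i)) M"
  unfolding spm_def
proof (intro allI impI)
  fix n and \<epsilon> :: real assume "\<epsilon> > 0"
  then obtain m where m: "\<And>f k \<mu>. below n f \<Longrightarrow> \<forall>i. \<bar>f i\<bar> \<le> \<mu> \<Longrightarrow> strict_mono k \<Longrightarrow> m \<le> k 0 \<Longrightarrow>
     \<bar>norm (\<Sum>i<n. f i *\<^sub>R y (k i)) - M f\<bar> \<le> \<epsilon> * \<mu>"
    using assms(1) unfolding spm_def by meson
  have "\<bar>norm (\<Sum>i<n. f i *\<^sub>R y (r (k i))) - M f\<bar> \<le> \<epsilon> * \<mu>"
    if "below n f" "\<forall>i. \<bar>f i\<bar> \<le> \<mu>" "strict_mono k" "m \<le> k 0" for f k \<mu>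
  proof -
    have "k 0 \<le> r (k 0)" using assms(2) by (rule strict_mono_imp_increasing)
    then show ?thesis
      using m[of f \<mu> "\<lambda>i. r (k i)"] that strict_mono_o[OF assms(2) that(3)] by (simp add: o_def)
  qed
  then show "\<exists>m. \<forall>f k \<mu>. below n f \<longrightarrow> (\<forall>i. \<bar>f i\<bar> \<le> \<mu>) \<longrightarrow> strict_mono k \<longrightarrow> m \<le> k 0 \<longrightarrow>
     \<bar>norm (\<Sum>i<n. f i *\<^sub>R y (r (k i))) - M f\<bar> \<le> \<epsilon> * \<mu>" by blast
qed

section \<open>From stabilized sequences to spreading models\<close>

text \<open>\<open>M unit0\<close> is the limit of the norms of the vectors of a sequence with model
  \<open>M\<close>, hence the factor by which a model is normalized.\<close>

definition unit0 :: "nat \<Rightarrow> real" where "unit0 i = (if i = 0 then 1 else 0)"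

lemma below_unit0: "below 1 unit0"
  by (simp add: below_def unit0_def)

text \<open>The norms converge to \<open>M unit0\<close>, so normalizing the vectors is
  asymptotically division by a constant, a perturbation that is small on \<open>n\<close> terms at a
  time.\<close>

lemma spm_normalize:
  fixes y :: "nat \<Rightarrow> 'b::real_normed_vector"
  assumes "spm y M" and l: "M unit0 > 0"
  shows "spm (\<lambda>i. y i /\<^sub>R norm (y i)) (\<lambda>f. M f / M unit0)"
  unfolding spm_def
proof (intro allI impI)
  fix n and \<epsilon> :: real assume \<epsilon>: "\<epsilon> > 0"
  define l where "l = M unit0"
  define z where "z i = y i /\<^sub>R norm (y i)" for i
  have l0: "l > 0" using l by (simp add: l_def)
  have "\<epsilon> * l / 2 > 0" using \<epsilon> l0 by simp
  then obtain m1 where m1: "\<And>f k \<mu>. below n f \<Longrightarrow> \<forall>i. \<bar>f i\<bar> \<le> \<mu> \<Longrightarrow> strict_mono k \<Longrightarrow> m1 \<le> k 0 \<Longrightarrow>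
     \<bar>norm (\<Sum>i<n. f i *\<^sub>R y (k i)) - M f\<bar> \<le> \<epsilon> * l / 2 * \<mu>"
    using assms(1) unfolding spm_def by meson
  have "(\<lambda>m. norm (y m)) \<longlonglongrightarrow> l"
    using spm_tendsto_shift[OF assms(1) below_unit0] by (simp add: unit0_def l_def)
  then have "(\<lambda>m. norm (y m) / l) \<longlonglongrightarrow> l / l" by (intro tendsto_divide tendsto_const) (use l0 in auto)
  then have lim: "(\<lambda>m. norm (y m) / l) \<longlonglongrightarrow> 1" using l0 by simp
  \<comment> \<open>The bound \<open>1/2\<close> keeps \<open>y m\<close> nonzero for late
    \<open>m\<close>; the other bound makes the total error of \<open>n\<close> terms at most
    \<open>\<epsilon> / 2\<close>.\<close>
  define \<epsilon>1 where "\<epsilon>1 = min (\<epsilon> / (2 * real (Suc n))) (1/2)"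
  have \<epsilon>1: "\<epsilon>1 > 0" "\<epsilon>1 < 1" "real n * \<epsilon>1 \<le> \<epsilon> / 2"
  proof -
    show "\<epsilon>1 > 0" "\<epsilon>1 < 1" using \<epsilon> by (auto simp: \<epsilon>1_def)
    have "real n * \<epsilon>1 \<le> real (Suc n) * (\<epsilon> / (2 * real (Suc n)))"
      using \<epsilon> by (intro mult_mono) (auto simp: \<epsilon>1_def)
    also have "\<dots> = \<epsilon> / 2" by (simp del: of_nat_Suc)
    finally show "real n * \<epsilon>1 \<le> \<epsilon> / 2" .
  qed
  obtain m2 where m2: "\<And>m. m \<ge> m2 \<Longrightarrow> \<bar>norm (y m) / l - 1\<bar> < \<epsilon>1"
    using metric_LIMSEQ_D[OF lim \<epsilon>1(1)] by (auto simp: dist_real_def)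
  have zy: "norm (z m - y m /\<^sub>R l) \<le> \<epsilon>1" if "m \<ge> m2" for m
  proof -
    have ym: "norm (y m) > 0" using m2[OF that] \<epsilon>1 by (cases "y m = 0") auto
    have "z m - y m /\<^sub>R l = (1 / norm (y m) - 1 / l) *\<^sub>R y m" by (simp add: z_def scaleR_diff_left inverse_eq_divide)
    then have "norm (z m - y m /\<^sub>R l) = \<bar>(1 / norm (y m) - 1 / l) * norm (y m)\<bar>" by (simp add: abs_mult)
    also have "(1 / norm (y m) - 1 / l) * norm (y m) = 1 - norm (y m) / l" using ym by (simp add: left_diff_distrib)
    finally show ?thesis using m2[OF that] by linarith
  qed
  have "\<bar>norm (\<Sum>i<n. f i *\<^sub>R z (k i)) - M f / l\<bar> \<le> \<epsilon> * \<mu>"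
    if f: "below n f" "\<forall>i. \<bar>f i\<bar> \<le> \<mu>" and k: "strict_mono k" "max m1 m2 \<le> k 0" for f k \<mu>
  proof -
    have \<mu>: "\<mu> \<ge> 0" using f(2) abs_ge_zero order_trans by blast
    have k2: "k i \<ge> m2" for i using k strict_mono_less_eq[of k 0 i] by (meson le0 le_trans max.cobounded2)
    have a: "norm (\<Sum>i<n. f i *\<^sub>R (y (k i) /\<^sub>R l)) = norm (\<Sum>i<n. f i *\<^sub>R y (k i)) / l"
    proof -
      have "(\<Sum>i<n. f i *\<^sub>R (y (k i) /\<^sub>R l)) = (\<Sum>i<n. f i *\<^sub>R y (k i)) /\<^sub>R l"
        by (simp add: scaleR_sum_right mult.commute)
      then show ?thesis using l0 by (simp add: inverse_eq_divide)
    qed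
    have "\<bar>norm (\<Sum>i<n. f i *\<^sub>R z (k i)) - norm (\<Sum>i<n. f i *\<^sub>R (y (k i) /\<^sub>R l))\<bar>
        \<le> norm ((\<Sum>i<n. f i *\<^sub>R z (k i)) - (\<Sum>i<n. f i *\<^sub>R (y (k i) /\<^sub>R l)))" by (rule norm_triangle_ineq3)
    also have "\<dots> = norm (\<Sum>i<n. f i *\<^sub>R (z (k i) - y (k i) /\<^sub>R l))" by (simp add: sum_subtractf scaleR_diff_right)
    also have "\<dots> \<le> (\<Sum>i<n. \<mu> * \<epsilon>1)"
      by (rule sum_norm_le) (use f zy k2 \<mu> in \<open>auto intro!: mult_mono\<close>)
    also have "\<dots> = real n * \<epsilon>1 * \<mu>" by simp
    also have "\<dots> \<le> \<epsilon> / 2 * \<mu>" by (rule mult_right_mono[OF \<epsilon>1(3) \<mu>])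
    finally have 1: "\<bar>norm (\<Sum>i<n. f i *\<^sub>R z (k i)) - norm (\<Sum>i<n. f i *\<^sub>R y (k i)) / l\<bar> \<le> \<epsilon> / 2 * \<mu>" unfolding a .
    have "\<bar>norm (\<Sum>i<n. f i *\<^sub>R y (k i)) - M f\<bar> \<le> \<epsilon> * l / 2 * \<mu>" by (rule m1[OF f k(1)]) (use k(2) in simp)
    then have "\<bar>(norm (\<Sum>i<n. f i *\<^sub>R y (k i)) - M f) / l\<bar> \<le> \<epsilon> * l / 2 * \<mu> / l"
      unfolding abs_divide using l0 by (simp only: abs_of_pos divide_right_mono less_imp_le)
    also have "\<dots> = \<epsilon> / 2 * \<mu>" using l0 by simp
    finally have "\<bar>norm (\<Sum>i<n. f i *\<^sub>R y (k i)) / l - M f / l\<bar> \<le> \<epsilon> / 2 * \<mu>" by (simp add: diff_divide_distrib)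
    with 1 show ?thesis by linarith
  qed
  then show "\<exists>m. \<forall>f k \<mu>. below n f \<longrightarrow> (\<forall>i. \<bar>f i\<bar> \<le> \<mu>) \<longrightarrow> strict_mono k \<longrightarrow> m \<le> k 0 \<longrightarrow>
     \<bar>norm (\<Sum>i<n. f i *\<^sub>R (y (k i) /\<^sub>R norm (y (k i)))) - M f / M unit0\<bar> \<le> \<epsilon> * \<mu>"
    unfolding z_def l_def by blast
qed

lemma below_trunc: "below (Suc n) (trunc n a)"
  by (simp add: below_def trunc_def)

text \<open>The coordinate bound turns an error relative to \<open>\<mu>\<close> into one relative
  to \<open>M f\<close>. A subsequence with \<open>r n\<close> beyond the threshold for length
  \<open>n\<close> then has the rate demanded for \<open>n \<le> k 1\<close>.\<close>

lemma spm_generates: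
  fixes z :: "nat \<Rightarrow> 'b::real_normed_vector"
  assumes sp: "spm z M" and c: "c > 0" and lower: "\<And>n f j. below n f \<Longrightarrow> c * \<bar>f j\<bar> \<le> M f"
  shows "\<exists>r. strict_mono r \<and> generates_spreading_model (\<lambda>i. z (r i)) M"
proof -
  \<comment> \<open>For \<open>t n \<le> 1/2\<close> one has
    \<open>1 \<le> (1 - t n) * (1 + 2 * t n)\<close>, so \<open>2 * t n\<close> serves as the error
    on both sides.\<close>
  define t where "t n = 1 / real (n + 2)" for n
  have t: "0 < t n" "t n \<le> 1/2" for n by (auto simp: t_def field_simps)
  have "\<forall>n. \<exists>m. \<forall>f k \<mu>. below n f \<longrightarrow> (\<forall>i. \<bar>f i\<bar> \<le> \<mu>) \<longrightarrow> strict_mono k \<longrightarrow> m \<le> k 0 \<longrightarrow>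
     \<bar>norm (\<Sum>i<n. f i *\<^sub>R z (k i)) - M f\<bar> \<le> (t n * c) * \<mu>"
    using sp t c unfolding spm_def by (meson mult_pos_pos)
  then obtain m where m: "\<And>n f k \<mu>. below n f \<Longrightarrow> \<forall>i. \<bar>f i\<bar> \<le> \<mu> \<Longrightarrow> strict_mono k \<Longrightarrow> m n \<le> k 0 \<Longrightarrow>
     \<bar>norm (\<Sum>i<n. f i *\<^sub>R z (k i)) - M f\<bar> \<le> (t n * c) * \<mu>" by metis
  define r where "r i = (\<Sum>j\<le>i. Suc (m j))" for i
  have r: "strict_mono r" unfolding r_def by (simp add: strict_mono_Suc_iff)
  have rm: "m i \<le> r i" for i unfolding r_def
    by (rule order.trans[of _ "Suc (m i)"]) (auto intro!: member_le_sum)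
  have rmono: "r i \<le> r j" if "i \<le> j" for i j using r that by (simp add: strict_mono_less_eq)
  have semi: "sm_seminorm M"
    unfolding sm_seminorm_def
  proof (intro conjI allI)
    fix n a b
    have "trunc n (\<lambda>i. a i + b i) = (\<lambda>i. trunc n a i + trunc n b i)" by (auto simp: trunc_def)
    then show "M (trunc n (\<lambda>i. a i + b i)) \<le> M (trunc n a) + M (trunc n b)"
      using spm_triangle[OF sp below_trunc below_trunc] by simp
  next
    fix n t a
    have "trunc n (\<lambda>i. t * a i) = (\<lambda>i. t * trunc n a i)" by (auto simp: trunc_def)
    then show "M (trunc n (\<lambda>i. t * a i)) = \<bar>t\<bar> * M (trunc n a)"
      using spm_scale[OF sp below_trunc] by simp
  qed
  have bound: "M (trunc n a) / (1 + 2 * t n) \<le> norm (\<Sum>i=1..n. a i *\<^sub>R z (r (k i))) \<and>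
      norm (\<Sum>i=1..n. a i *\<^sub>R z (r (k i))) \<le> (1 + 2 * t n) * M (trunc n a)"
    if k: "strict_mono_on {1..n} k" "n \<le> k 1" for n a k
  proof (cases "n = 0")
    case True
    have "M (\<lambda>i. 0 * unit0 i) = 0" using spm_scale[OF sp below_unit0, of 0] by simp
    moreover have "trunc n a = (\<lambda>i. 0 * unit0 i)" using True by (auto simp: trunc_def)
    ultimately show ?thesis using True by simp
  next
    case False
    \<comment> \<open>Spreading models number their vectors from 1 and \<open>spm\<close> from 0;
      spreading along \<open>Suc\<close> absorbs the shift.\<close>
    define f where "f i = trunc n a (Suc i)" for i
    have bf: "below n f" by (simp add: below_def f_def trunc_def)
    have Mf: "M f = M (trunc n a)"
      unfolding f_def
    proof (rule spm_spread[OF sp below_trunc])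
      show "strict_mono Suc" by (simp add: strict_mono_def)
      show "{i. trunc n a i \<noteq> 0} \<subseteq> range Suc" by (auto simp: trunc_def image_iff split: if_splits) (metis Suc_le_D One_nat_def)
    qed
    \<comment> \<open>\<open>k\<close> is increasing on \<open>{1..n}\<close> only; it is continued
      so as to be strictly increasing on \<open>nat\<close>, as \<open>spm\<close> asks.\<close>
    define \<kappa> where "\<kappa> i = (if i < n then r (k (Suc i)) else r (k n) + i)" for i
    have \<kappa>: "strict_mono \<kappa>"
    proof (rule strict_monoI)
      fix i j :: nat assume ij: "i < j"
      have k': "k (Suc i) < k (Suc j)" if "j < n" using k(1) ij that by (auto simp: strict_mono_on_def)
      have kn: "k (Suc i) \<le> k n" if "i < n"
        using k(1) that by (cases "Suc i = n") (auto simp: strict_mono_on_def intro: less_imp_le)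
      show "\<kappa> i < \<kappa> j"
      proof (cases "j < n")
        case True
        then show ?thesis using ij k' r by (simp add: \<kappa>_def strict_mono_less)
      next
        case False
        then show ?thesis using ij kn rmono by (fastforce simp: \<kappa>_def)
      qed
    qed
    have \<kappa>0: "m n \<le> \<kappa> 0"
      using rm[of n] rmono[OF k(2)] False by (simp add: \<kappa>_def)
    have sumeq: "(\<Sum>i<n. f i *\<^sub>R z (\<kappa> i)) = (\<Sum>i=1..n. a i *\<^sub>R z (r (k i)))"
      by (rule sum.reindex_bij_witness[of _ "\<lambda>i. i - 1" Suc]) (auto simp: f_def trunc_def \<kappa>_def)
    define \<mu> where "\<mu> = Max ((\<lambda>i. \<bar>f i\<bar>) ` {..<n})"
    have "\<mu> \<in> (\<lambda>i. \<bar>f i\<bar>) ` {..<n}" unfolding \<mu>_def using False by (intro Max_in) auto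
    then obtain j where j: "\<mu> = \<bar>f j\<bar>" by blast
    have \<mu>: "\<forall>i. \<bar>f i\<bar> \<le> \<mu>"
    proof
      fix i
      show "\<bar>f i\<bar> \<le> \<mu>"
      proof (cases "i < n")
        case True
        then show ?thesis unfolding \<mu>_def by (intro Max_ge) auto
      next
        case False
        then show ?thesis using belowD[OF bf] j by simp
      qed
    qed
    have "\<bar>norm (\<Sum>i<n. f i *\<^sub>R z (\<kappa> i)) - M f\<bar> \<le> (t n * c) * \<mu>" by (rule m[OF bf \<mu> \<kappa> \<kappa>0])
    also have "\<dots> \<le> t n * M f" using mult_left_mono[OF lower[OF bf, of j], of "t n"] t[of n] j by simp
    finally have dev: "\<bar>norm (\<Sum>i=1..n. a i *\<^sub>R z (r (k i))) - M (trunc n a)\<bar> \<le> t n * M (trunc n a)"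
      unfolding sumeq Mf .
    define S where "S = norm (\<Sum>i=1..n. a i *\<^sub>R z (r (k i)))"
    define A where "A = M (trunc n a)"
    have A0: "A \<ge> 0" unfolding A_def Mf[symmetric] using lower[OF bf, of 0] c by (smt (verit) mult_nonneg_nonneg)
    have S: "S \<le> (1 + t n) * A" "(1 - t n) * A \<le> S"
      using dev unfolding S_def[symmetric] A_def[symmetric] by (auto simp: algebra_simps abs_le_iff)
    have "(1 + t n) * A \<le> (1 + 2 * t n) * A" using t[of n] A0 by (intro mult_right_mono) auto
    moreover have "A \<le> S * (1 + 2 * t n)"
    proof -
      have "1 \<le> (1 - t n) * (1 + 2 * t n)"
        using t[of n] mult_left_mono[of "t n" "1/2" "2 * t n"] by (simp add: algebra_simps)
      then have "A \<le> (1 - t n) * (1 + 2 * t n) * A" using mult_right_mono[OF _ A0] by fastforce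
      also have "\<dots> = ((1 - t n) * A) * (1 + 2 * t n)" by simp
      also have "\<dots> \<le> S * (1 + 2 * t n)" using S(2) t[of n] by (intro mult_right_mono) auto
      finally show ?thesis .
    qed
    ultimately show ?thesis
      unfolding S_def[symmetric] A_def[symmetric] using S(1) t[of n] by (auto simp: field_simps)
  qed
  have "generates_spreading_model (\<lambda>i. z (r i)) M"
    unfolding generates_spreading_model_def
  proof (intro conjI semi exI[of _ "\<lambda>n. 2 * t n"] allI impI)
    show "decseq (\<lambda>n. 2 * t n)" by (auto simp: decseq_def t_def frac_le)
    have "(\<lambda>n. 1 / real (n + 2)) \<longlonglongrightarrow> 0"
      using LIMSEQ_ignore_initial_segment[OF lim_1_over_n, of 2] by simp
    then show "(\<lambda>n. 2 * t n) \<longlonglongrightarrow> 0" unfolding t_def by (rule tendsto_mult_right_zero)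
  qed (use bound in blast)+
  with r show ?thesis by blast
qed

section \<open>Schreier unconditional sequences in spaces with a unique spreading model\<close>

text \<open>Collects what the basis, its coordinate functionals and their subsequences have in
  common, so that everything below serves \<open>X\<close> and its dual at once. Reflexivity enters
  through \<open>block_weakly_null\<close>. Index 0 is kept out of \<open>G\<close> because the
  basis starts at 1.\<close>

locale schreier_seq =
  fixes u :: "nat \<Rightarrow> 'b::real_normed_vector" and C B :: real
  assumes norm_ge: "i \<ge> 1 \<Longrightarrow> 1 \<le> norm (u i)"
    and norm_le: "norm (u i) \<le> B"
    and schreier: "finite G \<Longrightarrow> 0 \<notin> G \<Longrightarrow> F \<subseteq> G \<Longrightarrow> F \<in> schreier1 \<Longrightarrow>
      norm (\<Sum>i\<in>F. a i *\<^sub>R u i) \<le> C * norm (\<Sum>i\<in>G. a i *\<^sub>R u i)"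
    and block_weakly_null: "(\<And>i. norm (y i) \<le> B') \<Longrightarrow>
      (\<And>i. i \<ge> 1 \<Longrightarrow> \<exists>A a. finite A \<and> A \<subseteq> {i..} \<and> y i = (\<Sum>t\<in>A. a t *\<^sub>R u t)) \<Longrightarrow> weakly_null y"
    and uniq: "weak_sm (x :: nat \<Rightarrow> 'b) N \<Longrightarrow> weak_sm (y :: nat \<Rightarrow> 'b) M \<Longrightarrow> sm_equiv N M"
begin

lemma C_pos: "C > 0"
proof -
  have "{1} \<in> schreier1" by (simp add: schreier1_def)
  then have "norm (u 1) \<le> C * norm (u 1)" using schreier[of "{1}" "{1}" "\<lambda>_. 1"] by simp
  moreover have "norm (u 1) > 0" using norm_ge[of 1, OF order_refl] by linarith
  ultimately show ?thesis by (smt (verit) mult_nonpos_nonneg)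
qed

text \<open>Any set of at most \<open>n\<close> indices that are all at least \<open>n\<close> is
  Schreier, so \<open>n\<close> late vectors are suppression unconditional without restriction on
  the subset.\<close>

lemma schreier_strict_mono:
  assumes k: "strict_mono k" "1 \<le> k 0" "n \<le> k 0" and A: "A \<subseteq> {..<n}"
  shows "norm (\<Sum>i\<in>A. f i *\<^sub>R u (k i)) \<le> C * norm (\<Sum>i<n. f i *\<^sub>R u (k i))"
proof -
  have inj: "inj_on k S" for S using k(1) by (meson inj_on_subset strict_mono_imp_inj_on subset_UNIV)
  define a where "a t = f (the_inv_into UNIV k t)" for t
  have a: "a (k i) = f i" for i unfolding a_def by (simp add: the_inv_into_f_f[OF inj])
  have k0: "k 0 \<le> k i" for i using k(1) by (simp add: strict_mono_less_eq)
  have finA: "finite A" using A finite_subset by blast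
  have "norm (\<Sum>t\<in>k ` A. a t *\<^sub>R u t) \<le> C * norm (\<Sum>t\<in>k ` {..<n}. a t *\<^sub>R u t)"
  proof (rule schreier)
    show "0 \<notin> k ` {..<n}" using k0 k(2) by (metis One_nat_def image_iff not_less_eq_eq order_trans zero_le)
    show "k ` A \<in> schreier1"
    proof -
      have "card (k ` A) \<le> n" using A card_mono[of "{..<n}" A] card_image_le[OF finA, of k] by simp
      also have "n \<le> Min (k ` A)" if "k ` A \<noteq> {}"
        using that finA k0 k(3) by (subst Min_ge_iff) (auto intro: order.trans)
      finally show ?thesis using finA by (auto simp: schreier1_def)
    qed
  qed (use A in auto)
  then show ?thesis by (simp add: sum.reindex[OF inj] a)
qed

section \<open>Unconditionality of the spreading model\<close>

context
  fixes N assumes spN: "spm u N"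
begin

lemma spm_u_nonneg: "below n f \<Longrightarrow> 0 \<le> N f"
  by (rule LIMSEQ_le_const[OF spm_tendsto_shift[OF spN]]) auto

lemma spm_u_suppress:
  assumes f: "below n f"
  shows "N (\<lambda>i. if i \<in> A then f i else 0) \<le> C * N f"
proof (rule LIMSEQ_le)
  define k where "k m i = i + (m + n + 1)" for m i :: nat
  have k: "strict_mono (k m)" "m \<le> k m 0" "1 \<le> k m 0" "n \<le> k m 0" for m by (auto simp: k_def strict_mono_def)
  have b: "below n (\<lambda>i. if i \<in> A then f i else 0)" using f by (simp add: below_def)
  show "(\<lambda>m. norm (\<Sum>i<n. (if i \<in> A then f i else 0) *\<^sub>R u (k m i))) \<longlonglongrightarrow> N (\<lambda>i. if i \<in> A then f i else 0)"
    by (rule spm_tendsto[OF spN b k(1,2)])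
  show "(\<lambda>m. C * norm (\<Sum>i<n. f i *\<^sub>R u (k m i))) \<longlonglongrightarrow> C * N f"
    by (intro tendsto_mult_left spm_tendsto[OF spN f k(1,2)])
  have "norm (\<Sum>i<n. (if i \<in> A then f i else 0) *\<^sub>R u (k m i)) \<le> C * norm (\<Sum>i<n. f i *\<^sub>R u (k m i))" for m
  proof -
    have "(\<Sum>i<n. (if i \<in> A then f i else 0) *\<^sub>R u (k m i)) = (\<Sum>i\<in>A \<inter> {..<n}. f i *\<^sub>R u (k m i))"
      by (rule sum.mono_neutral_cong_right) auto
    then show ?thesis using schreier_strict_mono[OF k(1,3,4), of "A \<inter> {..<n}" f] by simp
  qed
  then show "\<exists>N. \<forall>m\<ge>N. norm (\<Sum>i<n. (if i \<in> A then f i else 0) *\<^sub>R u (k m i)) \<le> C * norm (\<Sum>i<n. f i *\<^sub>R u (k m i))" by blast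
qed

lemma spm_u_coord:
  assumes f: "below n f"
  shows "(1 / C) * \<bar>f j\<bar> \<le> N f"
proof (cases "j < n")
  case False
  then show ?thesis using belowD[OF f] spm_u_nonneg[OF f] by simp
next
  case True
  define k where "k m i = i + (m + n + 1)" for m i :: nat
  have k: "strict_mono (k m)" "m \<le> k m 0" "1 \<le> k m 0" "n \<le> k m 0" for m by (auto simp: k_def strict_mono_def)
  have "\<bar>f j\<bar> \<le> C * norm (\<Sum>i<n. f i *\<^sub>R u (k m i))" for m
  proof -
    have "\<bar>f j\<bar> * 1 \<le> \<bar>f j\<bar> * norm (u (k m j))" by (intro mult_left_mono norm_ge) (auto simp: k_def)
    also have "\<dots> = norm (\<Sum>i\<in>{j}. f i *\<^sub>R u (k m i))" by simp
    also have "\<dots> \<le> C * norm (\<Sum>i<n. f i *\<^sub>R u (k m i))"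
      by (rule schreier_strict_mono[OF k(1,3,4)]) (use True in auto)
    finally show ?thesis by simp
  qed
  moreover have "(\<lambda>m. C * norm (\<Sum>i<n. f i *\<^sub>R u (k m i))) \<longlonglongrightarrow> C * N f"
    by (intro tendsto_mult_left spm_tendsto[OF spN f k(1,2)])
  ultimately have "\<bar>f j\<bar> \<le> C * N f" by (intro LIMSEQ_le_const) auto
  then show ?thesis using C_pos by (simp add: field_simps)
qed

text \<open>Separating the coordinates with sign 1 from those with sign -1 takes two suppressions,
  hence the factor 2.\<close>

lemma spm_u_signs:
  assumes g: "below n g" and \<theta>: "\<And>i. \<bar>\<theta> i\<bar> = 1"
  shows "N (\<lambda>i. \<theta> i * g i) \<le> 2 * C * N g"
proof -
  define A where "A = {i. \<theta> i = 1}"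
  have eq: "(\<lambda>i. \<theta> i * g i) = (\<lambda>i. (if i \<in> A then g i else 0) + (-1) * (if i \<in> - A then g i else 0))"
  proof
    fix i
    have "\<theta> i = 1 \<or> \<theta> i = -1" using \<theta>[of i] by linarith
    then show "\<theta> i * g i = (if i \<in> A then g i else 0) + (-1) * (if i \<in> - A then g i else 0)" by (auto simp: A_def)
  qed
  have b: "below n (\<lambda>i. if i \<in> S then g i else 0)" for S using g by (simp add: below_def)
  have "N (\<lambda>i. \<theta> i * g i) \<le> N (\<lambda>i. if i \<in> A then g i else 0) + N (\<lambda>i. (-1) * (if i \<in> - A then g i else 0))"
    unfolding eq by (rule spm_triangle[OF spN b below_scale[OF b]])
  also have "N (\<lambda>i. (-1) * (if i \<in> - A then g i else 0)) = N (\<lambda>i. if i \<in> - A then g i else 0)"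
    by (subst spm_scale[OF spN b]) simp
  also have "N (\<lambda>i. if i \<in> A then g i else 0) + N (\<lambda>i. if i \<in> - A then g i else 0) \<le> C * N g + C * N g"
    by (intro add_mono spm_u_suppress[OF g])
  finally show ?thesis by simp
qed

text \<open>Induction on the set of coordinates where \<open>\<bar>\<theta> i\<bar>\<close> may
  differ from 1. In one such coordinate \<open>\<theta>\<close> is a convex combination of
  multipliers with values 1 and -1, so the constant of the sign case is preserved.\<close>

lemma spm_u_multiplier:
  assumes g: "below n g" and "finite A"
  shows "(\<forall>i. \<bar>\<theta> i\<bar> \<le> 1) \<longrightarrow> (\<forall>i. i \<notin> A \<longrightarrow> \<bar>\<theta> i\<bar> = 1) \<longrightarrow> N (\<lambda>i. \<theta> i * g i) \<le> 2 * C * N g"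
  using assms(2)
proof (induction A arbitrary: \<theta> rule: finite_induct)
  case empty
  then show ?case using spm_u_signs[OF g] by blast
next
  case (insert j A)
  show ?case
  proof (intro impI)
    assume \<theta>: "\<forall>i. \<bar>\<theta> i\<bar> \<le> 1" "\<forall>i. i \<notin> insert j A \<longrightarrow> \<bar>\<theta> i\<bar> = 1"
    have j: "0 \<le> (1 + \<theta> j) / 2" "0 \<le> (1 - \<theta> j) / 2" using \<theta>(1)[rule_format, of j] by (auto simp: abs_le_iff)
    define \<theta>1 where "\<theta>1 = \<theta>(j := 1)"
    define \<theta>2 where "\<theta>2 = \<theta>(j := -1)"
    have b: "below n (\<lambda>i. \<theta> i * g i)" for \<theta> using g by (simp add: below_def)
    have 1: "N (\<lambda>i. \<theta>1 i * g i) \<le> 2 * C * N g" "N (\<lambda>i. \<theta>2 i * g i) \<le> 2 * C * N g"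
      using insert.IH[of \<theta>1] insert.IH[of \<theta>2] \<theta> by (auto simp: \<theta>1_def \<theta>2_def)
    have eq: "(\<lambda>i. \<theta> i * g i) = (\<lambda>i. (1 + \<theta> j) / 2 * (\<theta>1 i * g i) + (1 - \<theta> j) / 2 * (\<theta>2 i * g i))"
      by (auto simp: \<theta>1_def \<theta>2_def field_simps)
    have "N (\<lambda>i. \<theta> i * g i) \<le> N (\<lambda>i. (1 + \<theta> j) / 2 * (\<theta>1 i * g i)) + N (\<lambda>i. (1 - \<theta> j) / 2 * (\<theta>2 i * g i))"
      unfolding arg_cong[OF eq, of N] by (rule spm_triangle[OF spN below_scale[OF b] below_scale[OF b]])
    also have "\<dots> = (1 + \<theta> j) / 2 * N (\<lambda>i. \<theta>1 i * g i) + (1 - \<theta> j) / 2 * N (\<lambda>i. \<theta>2 i * g i)"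
      using j by (simp only: spm_scale[OF spN b] abs_of_nonneg)
    also have "\<dots> \<le> (1 + \<theta> j) / 2 * (2 * C * N g) + (1 - \<theta> j) / 2 * (2 * C * N g)"
      by (intro add_mono mult_left_mono 1 j)
    also have "\<dots> = 2 * C * N g" by (simp add: field_simps)
    finally show "N (\<lambda>i. \<theta> i * g i) \<le> 2 * C * N g" .
  qed
qed

lemma spm_u_subsym: "subsym N (2 * C) (1 / C)"
proof
  show "N (\<lambda>i. f i + g i) \<le> N f + N g" if "below n f" "below n g" for n f g
    by (rule spm_triangle[OF spN that])
  show "N (\<lambda>i. t * f i) = \<bar>t\<bar> * N f" if "below n f" for n f t
    by (rule spm_scale[OF spN that])
  show "N (\<lambda>i. f (k i)) = N f" if "below n f" "strict_mono k" "{i. f i \<noteq> 0} \<subseteq> range k" for n f k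
    by (rule spm_spread[OF spN that])
  show "(1 / C) * \<bar>f j\<bar> \<le> N f" if "below n f" for n f j
    by (rule spm_u_coord[OF that])
  show "0 < 1 / C" using C_pos by simp
  show "N f \<le> 2 * C * N g" if g: "below n g" and fg: "\<And>i. \<bar>f i\<bar> \<le> \<bar>g i\<bar>" for n f g
  proof -
    define \<theta> where "\<theta> i = (if g i = 0 then 1 else f i / g i)" for i
    have "(\<lambda>i. \<theta> i * g i) = f"
    proof
      fix i show "\<theta> i * g i = f i" using fg[of i] by (auto simp: \<theta>_def)
    qed
    moreover have "\<forall>i. \<bar>\<theta> i\<bar> \<le> 1" using fg by (auto simp: \<theta>_def abs_divide divide_le_eq)
    moreover have "\<forall>i. i \<notin> {..<n} \<longrightarrow> \<bar>\<theta> i\<bar> = 1" using belowD[OF g] by (auto simp: \<theta>_def)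
    ultimately show ?thesis using spm_u_multiplier[OF g, of "{..<n}" \<theta>] by simp
  qed
qed

end

section \<open>Block sequences and uniqueness\<close>

text \<open>The normalized blocks are weakly null and a subsequence generates \<open>M\<close>
  divided by \<open>M unit0\<close>, which puts this model within reach of \<open>uniq\<close>. The
  lower bound excludes a degenerate \<open>M\<close>.\<close>

lemma block_weak_sm:
  assumes sp: "spm y M" and c: "c > 0" and lower: "\<And>n f j. below n f \<Longrightarrow> c * \<bar>f j\<bar> \<le> M f"
    and y0: "\<And>i. i \<ge> 1 \<Longrightarrow> y i \<noteq> 0"
    and blk: "\<And>i. i \<ge> 1 \<Longrightarrow> \<exists>A a. finite A \<and> A \<subseteq> {i..} \<and> y i = (\<Sum>t\<in>A. a t *\<^sub>R u t)"
  shows "\<exists>x :: nat \<Rightarrow> 'b. weak_sm x (\<lambda>f. M f / M unit0)" and "M unit0 > 0"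
proof -
  have "c * \<bar>unit0 0\<bar> \<le> M unit0" by (rule lower[OF below_unit0])
  then show l: "M unit0 > 0" using c by (simp add: unit0_def)
  define z where "z i = y i /\<^sub>R norm (y i)" for i
  have spz: "spm z (\<lambda>f. M f / M unit0)" unfolding z_def by (rule spm_normalize[OF sp l])
  have "(c / M unit0) * \<bar>f j\<bar> \<le> M f / M unit0" if "below n f" for n f j
    using lower[OF that, of j] l by (simp add: divide_right_mono)
  moreover have "c / M unit0 > 0" using c l by simp
  ultimately obtain r where r: "strict_mono r" and gen: "generates_spreading_model (\<lambda>i. z (r i)) (\<lambda>f. M f / M unit0)"
    using spm_generates[OF spz, of "c / M unit0"] by blast
  have ri: "i \<le> r i" for i using r by (rule strict_mono_imp_increasing)
  have "normalized_seq (\<lambda>i. z (r i))"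
    unfolding normalized_seq_def
  proof (intro allI impI)
    fix i :: nat assume "i \<ge> 1"
    then have "y (r i) \<noteq> 0" using y0[of "r i"] ri[of i] by simp
    then show "norm (z (r i)) = 1" by (simp add: z_def)
  qed
  moreover have "weakly_null (\<lambda>i. z (r i))"
  proof (rule block_weakly_null[of _ 1])
    show "norm (z (r i)) \<le> 1" for i by (cases "y (r i) = 0") (simp_all add: z_def)
    show "\<exists>A a. finite A \<and> A \<subseteq> {i..} \<and> z (r i) = (\<Sum>t\<in>A. a t *\<^sub>R u t)" if "i \<ge> 1" for i
    proof -
      have "r i \<ge> 1" using that ri[of i] by simp
      then obtain A a where A: "finite A" "A \<subseteq> {r i..}" "y (r i) = (\<Sum>t\<in>A. a t *\<^sub>R u t)" using blk by blast
      have "z (r i) = (\<Sum>t\<in>A. (a t / norm (y (r i))) *\<^sub>R u t)"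
        unfolding z_def A(3) by (simp add: scaleR_sum_right divide_inverse mult.commute)
      moreover have "A \<subseteq> {i..}" using A(2) ri[of i] by (auto dest: order.trans)
      ultimately show ?thesis using A(1)
        by (intro exI[of _ A] exI[of _ "\<lambda>t. a t / norm (y (r i))"] conjI)
    qed
  qed
  ultimately show "\<exists>x :: nat \<Rightarrow> 'b. weak_sm x (\<lambda>f. M f / M unit0)" using gen unfolding weak_sm_def by blast
qed

lemma u_weak_sm:
  assumes spN: "spm u N"
  shows "\<exists>x :: nat \<Rightarrow> 'b. weak_sm x (\<lambda>f. N f / N unit0)" and "N unit0 > 0"
proof -
  have y0: "u i \<noteq> 0" if "i \<ge> 1" for i using norm_ge[OF that] by auto
  have blk: "\<exists>A a. finite A \<and> A \<subseteq> {i..} \<and> u i = (\<Sum>t\<in>A. a t *\<^sub>R u t)" if "i \<ge> 1" for i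
    by (intro exI[of _ "{i}"] exI[of _ "\<lambda>_. 1"]) auto
  have "1 / C > 0" using C_pos by simp
  note c = this
  show "\<exists>x :: nat \<Rightarrow> 'b. weak_sm x (\<lambda>f. N f / N unit0)"
    by (rule block_weak_sm(1)[OF spN c]) (rule spm_u_coord[OF spN] y0 blk; assumption)+
  show "N unit0 > 0"
    by (rule block_weak_sm(2)[OF spN c]) (rule spm_u_coord[OF spN] y0 blk; assumption)+
qed

text \<open>Uniqueness, applied to the normalized models of the block sequence and of a subsequence
  of \<open>u\<close>.\<close>

lemma block_dominated:
  assumes spN: "spm u N"
    and sp: "spm y M" and c: "c > 0" and lower: "\<And>n f j. below n f \<Longrightarrow> c * \<bar>f j\<bar> \<le> M f"
    and y0: "\<And>i. i \<ge> 1 \<Longrightarrow> y i \<noteq> 0"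
    and blk: "\<And>i. i \<ge> 1 \<Longrightarrow> \<exists>A a. finite A \<and> A \<subseteq> {i..} \<and> y i = (\<Sum>t\<in>A. a t *\<^sub>R u t)"
  shows "\<exists>D>0. \<forall>n f. below n f \<longrightarrow> M f \<le> D * N f"
proof -
  have "\<exists>x :: nat \<Rightarrow> 'b. weak_sm x (\<lambda>f. M f / M unit0)"
    by (rule block_weak_sm(1)[OF sp c]) (rule lower y0 blk; assumption)+
  then obtain x :: "nat \<Rightarrow> 'b" where x: "weak_sm x (\<lambda>f. M f / M unit0)" by blast
  have M0: "M unit0 > 0"
    by (rule block_weak_sm(2)[OF sp c]) (rule lower y0 blk; assumption)+
  obtain x' :: "nat \<Rightarrow> 'b" where x': "weak_sm x' (\<lambda>f. N f / N unit0)" using u_weak_sm(1)[OF spN] by blast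
  have N0: "N unit0 > 0" by (rule u_weak_sm(2)[OF spN])
  have "sm_equiv (\<lambda>f. M f / M unit0) (\<lambda>f. N f / N unit0)" by (rule uniq[OF x x'])
  then obtain D where D: "D > 0" "\<And>n a. M (trunc n a) / M unit0 \<le> D * (N (trunc n a) / N unit0)"
    unfolding sm_equiv_def by blast
  define D' where "D' = D * M unit0 / N unit0"
  have "M f \<le> D' * N f" if f: "below n f" for n f
  proof -
    \<comment> \<open>\<open>sm_equiv\<close> speaks of vectors supported in \<open>{1..n}\<close>,
      hence the shift by one.\<close>
    define f' where "f' i = (if i = 0 then 0 else f (i - 1))" for i
    have tr: "trunc n f' = f'" using belowD[OF f] by (auto simp: trunc_def f'_def fun_eq_iff)
    have b: "below (Suc n) f'" using below_trunc[of n f'] tr by simp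
    have ff: "f = (\<lambda>i. f' (Suc i))" by (simp add: f'_def)
    have rg: "{i. f' i \<noteq> 0} \<subseteq> range Suc"
    proof
      fix x assume "x \<in> {i. f' i \<noteq> 0}"
      then have "x \<noteq> 0" by (metis (mono_tags) f'_def mem_Collect_eq)
      then have "x = Suc (x - 1)" by simp
      then show "x \<in> range Suc" by blast
    qed
    have sS: "strict_mono Suc" by (simp add: strict_mono_def)
    have "M f = M f'" by (subst ff) (rule spm_spread[OF sp b sS rg])
    moreover have "N f = N f'" by (subst ff) (rule spm_spread[OF spN b sS rg])
    ultimately show ?thesis using D(2)[of n f'] M0 N0 unfolding tr by (simp add: D'_def field_simps)
  qed
  moreover have "D' > 0" using D M0 N0 by (simp add: D'_def)
  ultimately show ?thesis by blast
qed

section \<open>The upper tensor estimate\<close>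

text \<open>A Schreier projection of the block combination with coefficients \<open>aa p\<close>
  onto the \<open>p\<close>-th pieces is \<open>(1/2) ^ p\<close> times the tensor product. So
  \<open>(1/2) ^ p * N (tens (mm p) (aa p) (bb p))\<close> is at most \<open>C * M (aa p)\<close>,
  hence at most \<open>C * D * N (aa p)\<close>, and the excess \<open>4 ^ p\<close> gives
  \<open>2 ^ p < C * D\<close> for every \<open>p\<close>.\<close>

lemma tensor_upper:
  assumes spN: "spm u N"
  shows "\<exists>K>0. \<forall>n a m b. below n a \<longrightarrow> below m b \<longrightarrow> N (tens m a b) \<le> K * (N a * N b)"
proof (rule ccontr)
  assume neg: "\<not> ?thesis"
  interpret S: subsym N "2 * C" "1 / C" by (rule spm_u_subsym[OF spN])
  have "\<exists>n a m b. below n a \<and> below m b \<and> N b = 1 \<and> m > 0 \<and> 4 ^ p * N a < N (tens m a b)" for p :: nat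
  proof -
    have "(4::real) ^ p > 0" by simp
    then obtain n a m b where ab: "below n a" "below m b" "\<not> N (tens m a b) \<le> 4 ^ p * (N a * N b)"
      using neg by blast
    have nz: "b \<noteq> (\<lambda>_. 0)"
    proof
      assume "b = (\<lambda>_. 0)"
      then show False using ab(3) by (simp add: tens_def S.N_zero)
    qed
    then obtain j where "b j \<noteq> 0" by auto
    then have Nb: "N b > 0" by (rule S.N_pos[OF ab(2)])
    have m: "m > 0" using below_lt[OF ab(2) \<open>b j \<noteq> 0\<close>] by simp
    define b' where "b' i = (1 / N b) * b i" for i
    have b': "below m b'" unfolding b'_def by (rule below_scale[OF ab(2)])
    have Nb': "N b' = 1" unfolding b'_def using S.scale[OF ab(2), of "1 / N b"] Nb by simp
    have "tens m a b' = (\<lambda>i. (1 / N b) * tens m a b i)" by (auto simp: tens_def b'_def)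
    then have "N (tens m a b') = N (tens m a b) / N b"
      using S.scale[OF below_tens[OF ab(1,2)], of "1 / N b"] Nb by simp
    moreover have "4 ^ p * N a < N (tens m a b) / N b" using ab(3) Nb by (simp add: field_simps)
    ultimately show ?thesis using ab(1) b' Nb' m by metis
  qed
  then obtain nn aa mm bb where nn: "\<And>p. below (nn p) (aa p)" and bb: "\<And>p. below (mm p) (bb p)"
    and Nbb: "\<And>p. N (bb p) = 1" and mm: "\<And>p. mm p > 0"
    and big: "\<And>p. 4 ^ p * N (aa p) < N (tens (mm p) (aa p) (bb p))" by metis
  \<comment> \<open>\<open>Q p\<close> is the offset of the \<open>p\<close>-th piece inside a
    block. \<open>\<beta>\<close> is the infinite concatenation of the weighted pieces, and block
    \<open>i\<close> uses those with \<open>p \<le> i\<close>.\<close>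
  define Q where "Q p = (\<Sum>i<p. mm i)" for p
  have QS: "Q (Suc p) = Q p + mm p" for p by (simp add: Q_def)
  have Qmono: "Q p \<le> Q p'" if "p \<le> p'" for p p' unfolding Q_def by (rule sum_mono2) (use that in auto)
  define \<beta> where "\<beta> t = (let p = LEAST p. t < Q (Suc p) in (1/2) ^ p * bb p (t - Q p))" for t
  have \<beta>: "\<beta> (Q p + j) = (1/2) ^ p * bb p j" if "j < mm p" for p j
  proof -
    have "(LEAST p'. Q p + j < Q (Suc p')) = p"
    proof (rule Least_equality)
      show "Q p + j < Q (Suc p)" using that by (simp add: QS)
      fix p' assume "Q p + j < Q (Suc p')"
      then show "p \<le> p'" using Qmono[of "Suc p'" p] by (meson not_less_eq_eq leD le_add1 order.strict_trans1)
    qed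
    then show ?thesis by (simp add: \<beta>_def)
  qed
  \<comment> \<open>Far out in \<open>u\<close> the vector \<open>bb p\<close> has a norm close to
    \<open>N (bb p) = 1\<close>. Its coordinates are bounded by \<open>\<mu>\<close>, so precision
    \<open>1 / \<mu>\<close> allows an error of 1, which is enough.\<close>
  have "\<exists>s. \<forall>k. strict_mono k \<longrightarrow> s \<le> k 0 \<longrightarrow> norm (\<Sum>i<mm p. bb p i *\<^sub>R u (k i)) \<le> 2" for p
  proof -
    define \<mu> where "\<mu> = C * 1"
    have b\<mu>: "\<forall>i. \<bar>bb p i\<bar> \<le> \<mu>"
      using S.coord[OF bb] C_pos by (auto simp: \<mu>_def Nbb field_simps)
    have \<mu>: "\<mu> > 0" using C_pos by (simp add: \<mu>_def)
    then have "1 / \<mu> > 0" by simp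
    then obtain m where "\<And>f k \<nu>. below (mm p) f \<Longrightarrow> \<forall>i. \<bar>f i\<bar> \<le> \<nu> \<Longrightarrow> strict_mono k \<Longrightarrow> m \<le> k 0 \<Longrightarrow>
        \<bar>norm (\<Sum>i<mm p. f i *\<^sub>R u (k i)) - N f\<bar> \<le> 1 / \<mu> * \<nu>"
      using spN unfolding spm_def by meson
    from this[OF bb b\<mu>] have "\<bar>norm (\<Sum>i<mm p. bb p i *\<^sub>R u (k i)) - 1\<bar> \<le> 1" if "strict_mono k" "m \<le> k 0" for k
      using that \<mu> by (simp add: Nbb)
    then show ?thesis by (intro exI[of _ m]) (auto simp: abs_le_iff)
  qed
  then obtain s where s: "\<And>p k. strict_mono k \<Longrightarrow> s p \<le> k 0 \<Longrightarrow> norm (\<Sum>i<mm p. bb p i *\<^sub>R u (k i)) \<le> 2" by metis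
  \<comment> \<open>Block \<open>i\<close> starts at \<open>P i\<close>, after the previous blocks,
    after \<open>i\<close>, and after the thresholds \<open>s p\<close> of all its pieces. Its
    \<open>p\<close>-th piece thus has norm at most \<open>2 * (1/2) ^ p\<close>.\<close>
  define P where "P i = (\<Sum>t\<le>i. Q (Suc t) + s t + 1)" for i
  have PS: "P i + Q (Suc i) \<le> P (Suc i)" for i using Qmono[of "Suc i" "Suc (Suc i)"] by (simp add: P_def)
  have Pmono: "P i \<le> P j" if "i \<le> j" for i j unfolding P_def by (rule sum_mono2) (use that in auto)
  have Ps: "s p \<le> P i" if "p \<le> i" for p i
  proof -
    have "s p \<le> Q (Suc p) + s p + 1" by simp
    also have "\<dots> \<le> P i" unfolding P_def by (rule member_le_sum) (use that in auto)
    finally show ?thesis .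
  qed
  have Pi: "i < P i" for i
  proof (induction i)
    case (Suc i)
    then show ?case by (simp add: P_def)
  qed (simp add: P_def)
  have PP: "P i + Q (Suc i) \<le> P j" if "i < j" for i j
    using PS[of i] Pmono[of "Suc i" j] that by simp
  define y where "y i = (\<Sum>t<Q (Suc i). \<beta> t *\<^sub>R u (P i + t))" for i
  have group: "(\<Sum>t<Q p. g t) = (\<Sum>p'<p. \<Sum>j<mm p'. g (Q p' + j))" for p and g :: "nat \<Rightarrow> 'b"
  proof (induction p)
    case (Suc p)
    have "(\<Sum>t<Q (Suc p). g t) = (\<Sum>t<Q p. g t) + (\<Sum>t\<in>{Q p..<Q p + mm p}. g t)"
      unfolding QS by (simp add: sum.atLeastLessThan_concat atLeast0LessThan[symmetric])
    also have "(\<Sum>t\<in>{Q p..<Q p + mm p}. g t) = (\<Sum>j<mm p. g (Q p + j))"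
      by (subst sum.atLeastLessThan_shift_0) (simp add: atLeast0LessThan)
    finally show ?case by (simp add: Suc)
  qed (simp add: Q_def)
  have ynorm: "norm (y i) \<le> 4" for i
  proof -
    have "norm (y i) \<le> (\<Sum>p<Suc i. norm (\<Sum>j<mm p. \<beta> (Q p + j) *\<^sub>R u (P i + (Q p + j))))"
      unfolding y_def group by (rule norm_sum)
    also have "\<dots> \<le> (\<Sum>p<Suc i. (1/2) ^ p * 2)"
    proof (rule sum_mono)
      fix p assume "p \<in> {..<Suc i}"
      then have p: "p \<le> i" by simp
      have "(\<Sum>j<mm p. \<beta> (Q p + j) *\<^sub>R u (P i + (Q p + j))) = (1/2) ^ p *\<^sub>R (\<Sum>j<mm p. bb p j *\<^sub>R u (P i + Q p + j))"
        unfolding scaleR_sum_right by (intro sum.cong refl) (simp add: \<beta> add.assoc)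
      moreover have "norm (\<Sum>j<mm p. bb p j *\<^sub>R u (P i + Q p + j)) \<le> 2"
        by (rule s) (use Ps[OF p] in \<open>auto simp: strict_mono_def\<close>)
      ultimately show "norm (\<Sum>j<mm p. \<beta> (Q p + j) *\<^sub>R u (P i + (Q p + j))) \<le> (1/2) ^ p * 2" by simp
    qed
    also have "\<dots> = (\<Sum>p<Suc i. (1/2) ^ p) * 2" by (simp only: sum_distrib_right)
    also have "(\<Sum>p<Suc i. (1/2::real) ^ p) \<le> 2" by (subst geometric_sum) (auto simp: field_simps)
    finally show ?thesis by simp
  qed
  define cy where "cy i t = (if P i \<le> t \<and> t < P i + Q (Suc i) then \<beta> (t - P i) else 0)" for i t
  have ycy: "y i = (\<Sum>t\<in>G. cy i t *\<^sub>R u t)" if "finite G" "{P i..<P i + Q (Suc i)} \<subseteq> G" for i G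
  proof -
    have "(\<Sum>t\<in>G. cy i t *\<^sub>R u t) = (\<Sum>t\<in>{P i..<P i + Q (Suc i)}. \<beta> (t - P i) *\<^sub>R u t)"
      by (rule sum.mono_neutral_cong_right) (use that in \<open>auto simp: cy_def\<close>)
    also have "\<dots> = y i" unfolding y_def
      by (subst sum.atLeastLessThan_shift_0) (simp add: atLeast0LessThan)
    finally show ?thesis by simp
  qed
  text \<open>The vectors \<open>y i\<close> are blocks, so Schreier unconditionality allows one to project onto
    a small part of each of them.\<close>
  have proj: "norm (\<Sum>x\<in>X. (f (\<iota> x) * \<beta> (\<tau> x)) *\<^sub>R u (P (l (\<iota> x)) + \<tau> x)) \<le> C * norm (\<Sum>i<n. f i *\<^sub>R y (l i))"
    if l: "strict_mono l" and X: "finite X" "card X \<le> P (l 0)"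
      and \<iota>\<tau>: "\<And>x. x \<in> X \<Longrightarrow> \<iota> x < n \<and> \<tau> x < Q (Suc (l (\<iota> x)))"
      and inj: "inj_on (\<lambda>x. P (l (\<iota> x)) + \<tau> x) X"
    for l n f and X :: "nat set" and \<iota> \<tau> :: "nat \<Rightarrow> nat"
  proof -
    define G where "G = {1..<P (l n)}"
    define \<kappa> where "\<kappa> x = P (l (\<iota> x)) + \<tau> x" for x
    define co where "co t = (\<Sum>i<n. f i * cy (l i) t)" for t
    have ll: "l i < l j" if "i < j" for i j using l that by (simp add: strict_mono_def)
    have G: "(\<Sum>i<n. f i *\<^sub>R y (l i)) = (\<Sum>t\<in>G. co t *\<^sub>R u t)"
    proof -
      have "(\<Sum>i<n. f i *\<^sub>R y (l i)) = (\<Sum>i<n. f i *\<^sub>R (\<Sum>t\<in>G. cy (l i) t *\<^sub>R u t))"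
      proof (intro sum.cong refl arg_cong[of _ _ "scaleR _"] ycy)
        fix i assume "i \<in> {..<n}"
        then show "{P (l i)..<P (l i) + Q (Suc (l i))} \<subseteq> G"
          using PP[OF ll, of i n] Pi[of "l i"] by (auto simp: G_def)
      qed (simp add: G_def)
      also have "\<dots> = (\<Sum>t\<in>G. co t *\<^sub>R u t)"
        unfolding co_def scaleR_sum_left scaleR_sum_right by (subst sum.swap) simp
      finally show ?thesis .
    qed
    have co: "co (\<kappa> x) = f (\<iota> x) * \<beta> (\<tau> x)" if "x \<in> X" for x
    proof -
      define i where "i = \<iota> x"
      have i: "i < n" "\<tau> x < Q (Suc (l i))" using \<iota>\<tau>[OF that] by (auto simp: i_def)
      have "cy (l i') (\<kappa> x) = (if i' = i then \<beta> (\<tau> x) else 0)" if "i' < n" for i'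
      proof -
        consider "i' = i" | "i' < i" | "i < i'" by linarith
        then show ?thesis
        proof cases
          case 1
          then show ?thesis using i by (simp add: cy_def \<kappa>_def i_def)
        next
          case 2
          then show ?thesis using PP[OF ll[OF 2]] by (auto simp: cy_def \<kappa>_def i_def)
        next
          case 3
          then show ?thesis using PP[OF ll[OF 3]] i by (auto simp: cy_def \<kappa>_def i_def)
        qed
      qed
      then have "co (\<kappa> x) = (\<Sum>i'<n. if i' = i then f i * \<beta> (\<tau> x) else 0)"
        unfolding co_def by (intro sum.cong refl) auto
      then show ?thesis using i by (simp add: i_def)
    qed
    have \<kappa>ge: "P (l 0) \<le> \<kappa> x" for x
      unfolding \<kappa>_def using Pmono[of "l 0" "l (\<iota> x)"] l by (simp add: strict_mono_less_eq trans_le_add1)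
    have "norm (\<Sum>t\<in>\<kappa> ` X. co t *\<^sub>R u t) \<le> C * norm (\<Sum>t\<in>G. co t *\<^sub>R u t)"
    proof (rule schreier)
      show "\<kappa> ` X \<subseteq> G"
      proof
        fix t assume "t \<in> \<kappa> ` X"
        then obtain x where x: "x \<in> X" "t = \<kappa> x" by blast
        have "\<kappa> x < P (l (\<iota> x)) + Q (Suc (l (\<iota> x)))" using \<iota>\<tau>[OF x(1)] by (simp add: \<kappa>_def)
        also have "\<dots> \<le> P (l n)" by (rule PP[OF ll]) (use \<iota>\<tau>[OF x(1)] in simp)
        finally show "t \<in> G" using x \<kappa>ge[of x] Pi[of "l 0"] by (simp add: G_def)
      qed
      show "\<kappa> ` X \<in> schreier1"
      proof -
        have "card (\<kappa> ` X) \<le> P (l 0)" using X card_image_le[OF X(1), of \<kappa>] by simp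
        also have "P (l 0) \<le> Min (\<kappa> ` X)" if "\<kappa> ` X \<noteq> {}"
          using that X(1) \<kappa>ge by (subst Min_ge_iff) auto
        finally show ?thesis using X(1) by (auto simp: schreier1_def)
      qed
    qed (auto simp: G_def)
    also have "(\<Sum>t\<in>\<kappa> ` X. co t *\<^sub>R u t) = (\<Sum>x\<in>X. co (\<kappa> x) *\<^sub>R u (\<kappa> x))"
      using inj by (subst sum.reindex) (auto simp: \<kappa>_def[abs_def])
    also have "\<dots> = (\<Sum>x\<in>X. (f (\<iota> x) * \<beta> (\<tau> x)) *\<^sub>R u (P (l (\<iota> x)) + \<tau> x))"
      by (intro sum.cong refl) (simp only: co, simp add: \<kappa>_def)
    finally show ?thesis unfolding G .
  qed
  \<comment> \<open>The piece \<open>p = 0\<close> is present in every block; a nonzero coordinate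
    of it shows that no block vanishes and gives the coordinate bound for \<open>M\<close>.\<close>
  obtain j0 where j0: "bb 0 j0 \<noteq> 0"
  proof -
    have "bb 0 \<noteq> (\<lambda>_. 0)" using Nbb[of 0] S.N_zero by (metis zero_neq_one)
    then show ?thesis using that by auto
  qed
  have j0m: "j0 < mm 0" using below_lt[OF bb j0] .
  have \<beta>0: "\<beta> j0 \<noteq> 0" using \<beta>[OF j0m] j0 by (simp add: Q_def)
  have j0Q: "j0 < Q (Suc i)" for i using j0m Qmono[of "Suc 0" "Suc i"] by (simp add: Q_def)
  have coordy: "\<bar>\<beta> j0\<bar> * \<bar>f j\<bar> \<le> C * norm (\<Sum>i<n. f i *\<^sub>R y (l i))" if l: "strict_mono l" and j: "j < n" for l :: "nat \<Rightarrow> nat" and n f j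
  proof -
    have "\<bar>f j * \<beta> j0\<bar> * 1 \<le> \<bar>f j * \<beta> j0\<bar> * norm (u (P (l j) + j0))"
      using Pi[of "l j"] by (intro mult_left_mono norm_ge) auto
    also have "\<dots> = norm (\<Sum>x\<in>{j}. (f x * \<beta> j0) *\<^sub>R u (P (l x) + j0))" by simp
    also have "\<dots> \<le> C * norm (\<Sum>i<n. f i *\<^sub>R y (l i))"
      using proj[OF l, of "{j}" "\<lambda>x. x" n "\<lambda>_. j0" f] j j0Q Pi[of "l 0"] by simp
    finally show ?thesis by (simp add: abs_mult mult.commute)
  qed
  have y0: "y i \<noteq> 0" for i
  proof
    assume "y i = 0"
    then have "\<bar>\<beta> j0\<bar> * \<bar>(1::real)\<bar> \<le> C * 0"
      using coordy[of "\<lambda>x. x + i" 0 1 "\<lambda>_. 1"] by (simp add: strict_mono_def)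
    then show False using \<beta>0 by simp
  qed
  obtain r M where r: "strict_mono r" and spM: "spm (\<lambda>i. y (r i)) M"
    using spm_subsequence_exists[of y 4] ynorm by blast
  have ri: "i \<le> r i" for i using r by (rule strict_mono_imp_increasing)
  have lowerM: "(\<bar>\<beta> j0\<bar> / C) * \<bar>f j\<bar> \<le> M f" if f: "below n f" for n f j
  proof (cases "j < n")
    case False
    have "0 \<le> M f" by (rule LIMSEQ_le_const[OF spm_tendsto_shift[OF spM f]]) auto
    then show ?thesis using False belowD[OF f] by simp
  next
    case True
    have "\<bar>\<beta> j0\<bar> * \<bar>f j\<bar> \<le> C * norm (\<Sum>i<n. f i *\<^sub>R y (r (i + m)))" for m
      by (rule coordy[OF _ True]) (use r in \<open>auto simp: strict_mono_def\<close>)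
    moreover have "(\<lambda>m. C * norm (\<Sum>i<n. f i *\<^sub>R y (r (i + m)))) \<longlonglongrightarrow> C * M f"
      by (intro tendsto_mult_left spm_tendsto_shift[OF spM f])
    ultimately have "\<bar>\<beta> j0\<bar> * \<bar>f j\<bar> \<le> C * M f" by (intro LIMSEQ_le_const) auto
    then show ?thesis using C_pos by (simp add: field_simps)
  qed
  have blk: "\<exists>A a. finite A \<and> A \<subseteq> {i..} \<and> y (r i) = (\<Sum>t\<in>A. a t *\<^sub>R u t)" for i
  proof (intro exI conjI)
    show "finite {P (r i)..<P (r i) + Q (Suc (r i))}" by simp
    show "{P (r i)..<P (r i) + Q (Suc (r i))} \<subseteq> {i..}" using Pi[of "r i"] ri[of i] by auto
    show "y (r i) = (\<Sum>t\<in>{P (r i)..<P (r i) + Q (Suc (r i))}. cy (r i) t *\<^sub>R u t)" by (rule ycy) auto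
  qed
  have "\<bar>\<beta> j0\<bar> / C > 0" using \<beta>0 C_pos by simp
  then have "\<exists>D>0. \<forall>n f. below n f \<longrightarrow> M f \<le> D * N f"
  proof (rule block_dominated[OF spN spM])
    show "(\<bar>\<beta> j0\<bar> / C) * \<bar>f j\<bar> \<le> M f" if "below n f" for n f j by (rule lowerM[OF that])
    show "y (r i) \<noteq> 0" for i by (rule y0)
    show "\<exists>A a. finite A \<and> A \<subseteq> {i..} \<and> y (r i) = (\<Sum>t\<in>A. a t *\<^sub>R u t)" for i by (rule blk)
  qed
  then obtain D where D: "D > 0" "\<And>n f. below n f \<Longrightarrow> M f \<le> D * N f" by blast
  have key: "(1/2) ^ p * N (tens (mm p) (aa p) (bb p)) \<le> C * M (aa p)" for p
  proof (rule LIMSEQ_le)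
    define m where "m = mm p"
    define n where "n = nn p"
    have m0: "m > 0" using mm by (simp add: m_def)
    \<comment> \<open>The summand \<open>q\<close> moves the blocks to infinity, \<open>p\<close>
      ensures that each of them contains the \<open>p\<close>-th piece, and \<open>n * m\<close>
      makes the selected coordinates a Schreier set.\<close>
    define l where "l q i = r (i + (q + p + n * m))" for q i :: nat
    have l: "strict_mono (l q)" for q using r by (auto simp: l_def strict_mono_def)
    have lge: "q + p + n * m \<le> l q i" for q i unfolding l_def using ri[of "i + (q + p + n * m)"] by linarith
    \<comment> \<open>The place in \<open>u\<close> of coordinate \<open>x\<close> of the tensor
      product: copy \<open>x div m\<close> is the \<open>p\<close>-th piece of the block with that
      number.\<close>
    define \<kappa> where "\<kappa> q x = P (l q (x div m)) + (Q p + x mod m)" for q x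
    have \<kappa>: "strict_mono (\<kappa> q)" for q
    proof (rule strict_monoI)
      fix x z :: nat assume xz: "x < z"
      show "\<kappa> q x < \<kappa> q z"
      proof (cases "x div m = z div m")
        case True
        then have "x mod m < z mod m" using xz by (metis div_mult_mod_eq nat_add_left_cancel_less)
        then show ?thesis using True by (simp add: \<kappa>_def)
      next
        case False
        then have "x div m < z div m" using xz by (meson div_le_mono le_neq_implies_less less_imp_le)
        then have "l q (x div m) < l q (z div m)" using l by (simp add: strict_mono_less)
        from PP[OF this] have "P (l q (x div m)) + Q (Suc (l q (x div m))) \<le> P (l q (z div m))" .
        moreover have "Q p + x mod m < Q (Suc (l q (x div m)))"
        proof -
          have "Q p + x mod m < Q (Suc p)" using m0 by (simp add: QS m_def)
          also have "\<dots> \<le> Q (Suc (l q (x div m)))" by (rule Qmono) (use lge[of q "x div m"] in simp)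
          finally show ?thesis .
        qed
        ultimately show ?thesis by (simp add: \<kappa>_def)
      qed
    qed
    have bt: "below (n * m) (tens m (aa p) (bb p))" unfolding n_def m_def by (rule below_tens[OF nn bb])
    have \<kappa>0: "q \<le> \<kappa> q 0" for q using Pi[of "l q 0"] lge[of q 0] by (simp add: \<kappa>_def)
    show "(\<lambda>q. (1/2) ^ p * norm (\<Sum>x<n * m. tens m (aa p) (bb p) x *\<^sub>R u (\<kappa> q x))) \<longlonglongrightarrow> (1/2) ^ p * N (tens (mm p) (aa p) (bb p))"
      unfolding m_def[symmetric] by (intro tendsto_mult_left spm_tendsto[OF spN bt \<kappa> \<kappa>0])
    show "(\<lambda>q. C * norm (\<Sum>i<n. aa p i *\<^sub>R y (l q i))) \<longlonglongrightarrow> C * M (aa p)"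
      unfolding l_def using nn[of p] by (intro tendsto_mult_left spm_tendsto[OF spM]) (auto simp: n_def strict_mono_def)
    have "(1/2) ^ p * norm (\<Sum>x<n * m. tens m (aa p) (bb p) x *\<^sub>R u (\<kappa> q x)) \<le> C * norm (\<Sum>i<n. aa p i *\<^sub>R y (l q i))" for q
    proof -
      have "(1/2) ^ p * norm (\<Sum>x<n * m. tens m (aa p) (bb p) x *\<^sub>R u (\<kappa> q x))
          = norm ((1/2) ^ p *\<^sub>R (\<Sum>x<n * m. tens m (aa p) (bb p) x *\<^sub>R u (\<kappa> q x)))" by simp
      also have "(1/2) ^ p *\<^sub>R (\<Sum>x<n * m. tens m (aa p) (bb p) x *\<^sub>R u (\<kappa> q x))
          = (\<Sum>x<n * m. (aa p (x div m) * \<beta> (Q p + x mod m)) *\<^sub>R u (P (l q (x div m)) + (Q p + x mod m)))"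
        unfolding scaleR_sum_right using m0
        by (intro sum.cong refl) (simp add: tens_def \<kappa>_def \<beta> m_def mult.left_commute)
      also have "norm \<dots> \<le> C * norm (\<Sum>i<n. aa p i *\<^sub>R y (l q i))"
      proof (rule proj[OF l])
        show "card {..<n * m} \<le> P (l q 0)" using Pi[of "l q 0"] lge[of q 0] by simp
        show "inj_on (\<lambda>x. P (l q (x div m)) + (Q p + x mod m)) {..<n * m}"
          using strict_mono_imp_inj_on[OF \<kappa>[of q]] unfolding \<kappa>_def by (meson inj_on_subset subset_UNIV)
        fix x assume x: "x \<in> {..<n * m}"
        have "Q p + x mod m < Q (Suc p)" using m0 by (simp add: QS m_def)
        also have "\<dots> \<le> Q (Suc (l q (x div m)))" by (rule Qmono) (use lge[of q "x div m"] in simp)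
        finally show "x div m < n \<and> Q p + x mod m < Q (Suc (l q (x div m)))"
          using x by (simp add: less_mult_imp_div_less)
      qed simp
      finally show ?thesis .
    qed
    then show "\<exists>N. \<forall>q\<ge>N. (1/2) ^ p * norm (\<Sum>x<n * m. tens m (aa p) (bb p) x *\<^sub>R u (\<kappa> q x)) \<le> C * norm (\<Sum>i<n. aa p i *\<^sub>R y (l q i))" by blast
  qed
  have "2 ^ p < C * D" for p
  proof -
    have h: "(1/2::real) ^ p * 4 ^ p = 2 ^ p" by (simp add: power_mult_distrib[symmetric])
    have "2 ^ p * N (aa p) = (1/2) ^ p * (4 ^ p * N (aa p))" by (simp add: h[symmetric])
    also have "\<dots> < (1/2) ^ p * N (tens (mm p) (aa p) (bb p))" using big[of p] by (intro mult_strict_left_mono) auto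
    also have "\<dots> \<le> C * M (aa p)" by (rule key)
    also have "\<dots> \<le> C * (D * N (aa p))" using D(2)[OF nn] C_pos by (intro mult_left_mono) auto
    finally have "2 ^ p * N (aa p) < (C * D) * N (aa p)" by simp
    then show ?thesis using S.N_nonneg[OF nn] by (rule mult_right_less_imp_less)
  qed
  moreover obtain p where "C * D < 2 ^ p" using real_arch_pow[of 2 "C * D"] by auto
  ultimately show False by (meson less_asym)
qed

end

section \<open>Norming functionals and weak nullness\<close>

definition sublin :: "nat \<Rightarrow> ((nat \<Rightarrow> real) \<Rightarrow> real) \<Rightarrow> bool" where
  "sublin n q \<longleftrightarrow> (\<forall>f g. below n f \<longrightarrow> below n g \<longrightarrow> q (\<lambda>i. f i + g i) \<le> q f + q g) \<and>
     (\<forall>f t. below n f \<longrightarrow> t \<ge> 0 \<longrightarrow> q (\<lambda>i. t * f i) \<le> t * q f)"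

lemma sublin_zero: "sublin n q \<Longrightarrow> q (\<lambda>_. 0) = 0"
proof -
  assume q: "sublin n q"
  have b: "below n (\<lambda>_. 0)" by (simp add: below_def)
  have "q (\<lambda>i. 0 * 0) \<le> 0 * q (\<lambda>_. 0)" using q b unfolding sublin_def by blast
  moreover have "q (\<lambda>i. 0 + 0) \<le> q (\<lambda>_. 0) + q (\<lambda>_. 0)" using q b unfolding sublin_def by blast
  ultimately show ?thesis by simp
qed

lemma sublin_pos:
  assumes q: "sublin n q" and f: "below n f" and t: "t \<ge> 0"
  shows "q (\<lambda>i. t * f i) = t * q f"
proof (cases "t = 0")
  case True
  then show ?thesis using sublin_zero[OF q] by simp
next
  case False
  have 1: "q (\<lambda>i. t * f i) \<le> t * q f" using q f t unfolding sublin_def by blast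
  have "q (\<lambda>i. (1/t) * (t * f i)) \<le> (1/t) * q (\<lambda>i. t * f i)"
    using q below_scale[OF f] t unfolding sublin_def by (metis divide_nonneg_nonneg zero_le_one)
  then have "t * q f \<le> q (\<lambda>i. t * f i)" using False t by (simp add: field_simps)
  with 1 show ?thesis by simp
qed

text \<open>The infimum over \<open>t \<ge> 0\<close> of \<open>p (f + t v) - t * p v\<close> is the
  usual way to lower a sublinear functional until it is odd in the direction \<open>v\<close>: with
  \<open>q v \<le> p v\<close> the last clause gives \<open>q (- v) \<le> - q v\<close>. It is
  finite, being at least \<open>- p (- f)\<close>.\<close>

lemma sublin_step:
  assumes p: "sublin n p" and v: "below n v"
  shows "\<exists>q. sublin n q \<and> (\<forall>f. below n f \<longrightarrow> q f \<le> p f) \<and> q (\<lambda>i. - v i) \<le> - p v"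
proof -
  define h where "h f t = p (\<lambda>i. f i + t * v i) - t * p v" for f t
  define q where "q f = (INF t\<in>{0..}. h f t)" for f
  have padd: "p (\<lambda>i. f i + g i) \<le> p f + p g" if "below n f" "below n g" for f g
    using p that unfolding sublin_def by blast
  have b: "below n (\<lambda>i. f i + t * v i)" if "below n f" for f t
    using that v by (simp add: below_def)
  have lb: "- p (\<lambda>i. - f i) \<le> h f t" if f: "below n f" and t: "t \<ge> 0" for f t
  proof -
    have nf: "below n (\<lambda>i. - f i)" using f by (simp add: below_def)
    have "t * p v = p (\<lambda>i. t * v i)" by (rule sublin_pos[OF p v t, symmetric])
    also have "(\<lambda>i. t * v i) = (\<lambda>i. (f i + t * v i) + - f i)" by auto
    also have "p \<dots> \<le> p (\<lambda>i. f i + t * v i) + p (\<lambda>i. - f i)" by (rule padd[OF b[OF f] nf])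
    finally show ?thesis by (simp add: h_def)
  qed
  have bdd: "bdd_below (h f ` {0..})" if "below n f" for f
    by (rule bdd_belowI2[of _ "- p (\<lambda>i. - f i)"]) (use lb[OF that] in auto)
  have qle: "q f \<le> h f t" if "below n f" "t \<ge> 0" for f t
    unfolding q_def by (rule cINF_lower[OF bdd]) (use that in auto)
  have qge: "x \<le> q f" if "\<And>t. t \<ge> 0 \<Longrightarrow> x \<le> h f t" for x f
    unfolding q_def by (rule cINF_greatest) (use that in auto)
  have "sublin n q"
    unfolding sublin_def
  proof (intro conjI allI impI)
    fix f g assume f: "below n f" and g: "below n g"
    have "q (\<lambda>i. f i + g i) - h g s \<le> q f" if s: "s \<ge> 0" for s
    proof (rule qge)
      fix t :: real assume t: "t \<ge> 0"
      have "q (\<lambda>i. f i + g i) \<le> h (\<lambda>i. f i + g i) (t + s)" by (rule qle) (use f g t s in \<open>auto intro: below_add\<close>)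
      also have "(\<lambda>i. (f i + g i) + (t + s) * v i) = (\<lambda>i. (f i + t * v i) + (g i + s * v i))" by (auto simp: algebra_simps)
      then have "h (\<lambda>i. f i + g i) (t + s) \<le> h f t + h g s"
        unfolding h_def using padd[OF b[OF f] b[OF g], of t s] by (simp add: algebra_simps)
      finally show "q (\<lambda>i. f i + g i) - h g s \<le> h f t" by simp
    qed
    then have "q (\<lambda>i. f i + g i) - q f \<le> q g" by (intro qge) (smt (verit))
    then show "q (\<lambda>i. f i + g i) \<le> q f + q g" by simp
  next
    fix f and c :: real assume f: "below n f" and c: "c \<ge> 0"
    show "q (\<lambda>i. c * f i) \<le> c * q f"
    proof (cases "c = 0")
      case True
      have "below n (\<lambda>_. 0)" by (simp add: below_def)
      then have "q (\<lambda>_. 0) \<le> h (\<lambda>_. 0) 0" by (intro qle) auto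
      then show ?thesis using True sublin_zero[OF p] by (simp add: h_def)
    next
      case False
      then have c: "c > 0" using c by simp
      have "q (\<lambda>i. c * f i) / c \<le> q f"
      proof (rule qge)
        fix t :: real assume t: "t \<ge> 0"
        have "q (\<lambda>i. c * f i) \<le> h (\<lambda>i. c * f i) (c * t)" by (rule qle) (use c t below_scale[OF f] in auto)
        also have "(\<lambda>i. c * f i + c * t * v i) = (\<lambda>i. c * (f i + t * v i))" by (auto simp: algebra_simps)
        then have "h (\<lambda>i. c * f i) (c * t) = c * h f t"
          unfolding h_def using sublin_pos[OF p b[OF f], of c t] c by (simp add: algebra_simps)
        finally show "q (\<lambda>i. c * f i) / c \<le> h f t" using c by (simp add: field_simps)
      qed
      then show ?thesis using c by (simp add: field_simps)
    qed
  qed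
  moreover have "q f \<le> p f" if "below n f" for f using qle[OF that, of 0] by (simp add: h_def)
  moreover have "q (\<lambda>i. - v i) \<le> - p v"
  proof -
    have "below n (\<lambda>i. - v i)" using v by (simp add: below_def)
    then have "q (\<lambda>i. - v i) \<le> h (\<lambda>i. - v i) 1" by (rule qle) simp
    then show ?thesis using sublin_zero[OF p] by (simp add: h_def)
  qed
  ultimately show ?thesis by blast
qed

text \<open>Lower \<open>p\<close> along \<open>a\<close>, and the result along each unit vector. A
  sublinear functional that is odd on the unit vectors is linear, and its values there are the
  coordinates of \<open>b\<close>. Starting with \<open>a\<close> secures
  \<open>p a \<le> (\<Sum>i<n. a i * b i)\<close>.\<close>

lemma finite_Hahn_Banach:
  assumes p: "sublin n p" and a: "below n a"
  shows "\<exists>b. below n b \<and> p a \<le> (\<Sum>i<n. a i * b i) \<and> (\<forall>f. below n f \<longrightarrow> (\<Sum>i<n. f i * b i) \<le> p f)"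
proof -
  define \<delta> :: "nat \<Rightarrow> nat \<Rightarrow> real" where "\<delta> i x = (if x = i then 1 else 0)" for i x
  have "\<exists>q. sublin n q \<and> (\<forall>f. below n f \<longrightarrow> q f \<le> p f) \<and> q (\<lambda>i. - a i) \<le> - p a \<and>
      (\<forall>i<m. q (\<lambda>x. - \<delta> i x) \<le> - q (\<delta> i))" if "m \<le> n" for m
    using that
  proof (induction m)
    case 0
    then show ?case using sublin_step[OF p a] by auto
  next
    case (Suc m)
    then obtain q where q: "sublin n q" "\<And>f. below n f \<Longrightarrow> q f \<le> p f" "q (\<lambda>i. - a i) \<le> - p a"
      "\<And>i. i < m \<Longrightarrow> q (\<lambda>x. - \<delta> i x) \<le> - q (\<delta> i)" by auto
    have b\<delta>: "below n (\<delta> i)" if "i < n" for i using that by (simp add: below_def \<delta>_def)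
    obtain q' where q': "sublin n q'" "\<And>f. below n f \<Longrightarrow> q' f \<le> q f" "q' (\<lambda>i. - \<delta> m i) \<le> - q (\<delta> m)"
      using sublin_step[OF q(1) b\<delta>[of m]] Suc.prems by auto
    have neg: "below n (\<lambda>i. - f i)" if "below n f" for f using that by (simp add: below_def)
    have "q' (\<lambda>x. - \<delta> i x) \<le> - q' (\<delta> i)" if "i < Suc m" for i
    proof (cases "i = m")
      case True
      then show ?thesis using q'(2)[OF b\<delta>[of m]] q'(3) Suc.prems by simp
    next
      case False
      then have i: "i < m" "i < n" using that Suc.prems by auto
      then show ?thesis using q'(2)[OF b\<delta>[OF i(2)]] q'(2)[OF neg[OF b\<delta>[OF i(2)]]] q(4)[OF i(1)] by simp
    qed
    moreover have "q' f \<le> p f" if "below n f" for f using q'(2)[OF that] q(2)[OF that] by simp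
    moreover have "q' (\<lambda>i. - a i) \<le> - p a" using q'(2)[OF neg[OF a]] q(3) by simp
    ultimately show ?case using q'(1) by blast
  qed
  then obtain q where q: "sublin n q" "\<And>f. below n f \<Longrightarrow> q f \<le> p f" "q (\<lambda>i. - a i) \<le> - p a"
    "\<And>i. i < n \<Longrightarrow> q (\<lambda>x. - \<delta> i x) \<le> - q (\<delta> i)" by blast
  define b where "b i = (if i < n then q (\<delta> i) else 0)" for i
  have qadd: "q (\<lambda>i. f i + g i) \<le> q f + q g" if "below n f" "below n g" for f g
    using q(1) that unfolding sublin_def by blast
  have upper: "q (\<lambda>x. if x < m then f x else 0) \<le> (\<Sum>i<m. f i * b i)" if "m \<le> n" for f m
    using that
  proof (induction m)
    case 0
    then show ?case using sublin_zero[OF q(1)] by simp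
  next
    case (Suc m)
    have b\<delta>: "below n (\<delta> m)" "below n (\<lambda>x. - \<delta> m x)" using Suc.prems by (auto simp: below_def \<delta>_def)
    have "q (\<lambda>x. f m * \<delta> m x) \<le> f m * b m"
    proof (cases "f m \<ge> 0")
      case True
      then show ?thesis using sublin_pos[OF q(1) b\<delta>(1) True] Suc.prems by (simp add: b_def)
    next
      case False
      have "q (\<lambda>x. f m * \<delta> m x) = q (\<lambda>x. (- f m) * (- \<delta> m x))" by simp
      also have "\<dots> = (- f m) * q (\<lambda>x. - \<delta> m x)" by (rule sublin_pos[OF q(1) b\<delta>(2)]) (use False in simp)
      also have "\<dots> \<le> (- f m) * (- q (\<delta> m))" by (intro mult_left_mono q(4)) (use False Suc.prems in auto)
      finally show ?thesis using Suc.prems by (simp add: b_def)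
    qed
    moreover have "q (\<lambda>x. if x < m then f x else 0) \<le> (\<Sum>i<m. f i * b i)" using Suc by simp
    moreover have "q (\<lambda>x. (if x < m then f x else 0) + f m * \<delta> m x) \<le> q (\<lambda>x. if x < m then f x else 0) + q (\<lambda>x. f m * \<delta> m x)"
      by (rule qadd) (use Suc.prems in \<open>auto simp: below_def \<delta>_def\<close>)
    moreover have "(\<lambda>x. (if x < m then f x else 0) + f m * \<delta> m x) = (\<lambda>x. if x < Suc m then f x else 0)"
      by (auto simp: \<delta>_def less_Suc_eq)
    ultimately show ?case by simp
  qed
  have upper': "q f \<le> (\<Sum>i<n. f i * b i)" if "below n f" for f
  proof -
    have "(\<lambda>x. if x < n then f x else 0) = f" using belowD[OF that] by auto
    then show ?thesis using upper[of n f] by simp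
  qed
  have lower: "- q (\<lambda>i. - f i) \<le> q f" if f: "below n f" for f
  proof -
    have "q (\<lambda>i. f i + - f i) \<le> q f + q (\<lambda>i. - f i)" by (rule qadd) (use f in \<open>auto simp: below_def\<close>)
    then show ?thesis using sublin_zero[OF q(1)] by simp
  qed
  have "below n b" by (simp add: below_def b_def)
  moreover have "p a \<le> (\<Sum>i<n. a i * b i)" using lower[OF a] q(3) upper'[OF a] by simp
  moreover have "(\<Sum>i<n. f i * b i) \<le> p f" if f: "below n f" for f
  proof -
    have nf: "below n (\<lambda>i. - f i)" using f by (simp add: below_def)
    have "(\<Sum>i<n. f i * b i) \<le> - q (\<lambda>i. - f i)" using upper'[OF nf] by (simp add: sum_negf)
    also have "\<dots> \<le> p f" using lower[OF f] q(2)[OF f] by simp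
    finally show ?thesis .
  qed
  ultimately show ?thesis by blast
qed

section \<open>Reflexivity and weakly null sequences\<close>

lemma bounded_linear_eval: "bounded_linear (\<lambda>f::'a::real_normed_vector \<Rightarrow>\<^sub>L real. blinfun_apply f x)"
  by (rule blinfun.bounded_linear_left)

lemma reflexiveD:
  fixes \<phi> :: "('a::real_normed_vector \<Rightarrow>\<^sub>L real) \<Rightarrow> real"
  assumes "reflexive_space TYPE('a)" and \<phi>: "bounded_linear \<phi>"
  shows "\<exists>x. \<forall>f. \<phi> f = blinfun_apply f x"
proof -
  obtain x where x: "Blinfun \<phi> = Blinfun (\<lambda>f::'a \<Rightarrow>\<^sub>L real. blinfun_apply f x)"
    using assms(1) unfolding reflexive_space_def by (metis surjD)
  have "\<phi> f = blinfun_apply f x" for f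
    using arg_cong[OF x, of "\<lambda>F. blinfun_apply F f"]
    by (simp add: bounded_linear_Blinfun_apply[OF \<phi>] bounded_linear_Blinfun_apply[OF bounded_linear_eval])
  then show ?thesis by blast
qed

text \<open>Compactness of a product of intervals provides a weak-star cluster point of \<open>y\<close> in
  the bidual, which reflexivity turns into a point of the space.\<close>

lemma reflexive_weakly_null:
  fixes y :: "nat \<Rightarrow> 'a::real_normed_vector" and g :: "nat \<Rightarrow> 'a \<Rightarrow>\<^sub>L real"
  assumes refl: "reflexive_space TYPE('a)"
    and total: "\<And>x. (\<And>j. j \<ge> 1 \<Longrightarrow> blinfun_apply (g j) x = 0) \<Longrightarrow> x = 0"
    and B: "\<And>i. norm (y i) \<le> B"
    and null: "\<And>j. j \<ge> 1 \<Longrightarrow> (\<lambda>i. blinfun_apply (g j) (y i)) \<longlonglongrightarrow> 0"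
  shows "weakly_null y"
  unfolding weakly_null_def
proof (intro allI, rule ccontr)
  fix f :: "'a \<Rightarrow>\<^sub>L real"
  assume "\<not> (\<lambda>n. blinfun_apply f (y n)) \<longlonglongrightarrow> 0"
  then obtain \<epsilon> where \<epsilon>: "\<epsilon> > 0" "\<exists>\<^sub>F n in sequentially. \<epsilon> \<le> \<bar>blinfun_apply f (y n)\<bar>"
    unfolding tendsto_iff frequently_def by (auto simp: dist_real_def not_le)
  define S where "S = {n. \<epsilon> \<le> \<bar>blinfun_apply f (y n)\<bar>}"
  \<comment> \<open>Filters take the place of subnets: \<open>G\<close> is the filter of late
    indices at which \<open>f\<close> stays away from 0.\<close>
  define G where "G = inf sequentially (principal S)"
  have G: "G \<noteq> bot"
    using \<epsilon>(2) unfolding G_def trivial_limit_def eventually_inf_principal frequently_def S_def by simp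
  define \<Phi> :: "nat \<Rightarrow> ('a \<Rightarrow>\<^sub>L real) \<Rightarrow> real" where "\<Phi> n = (\<lambda>h. blinfun_apply h (y n))" for n
  define K :: "(('a \<Rightarrow>\<^sub>L real) \<Rightarrow> real) set" where "K = PiE UNIV (\<lambda>h. {- (B * norm h)..B * norm h})"
  have "compactin (product_topology (\<lambda>i. euclidean) UNIV) K"
    unfolding K_def compactin_PiE by simp
  then have "compact K" by (simp add: euclidean_product_topology)
  have \<Phi>K: "\<Phi> n \<in> K" for n
  proof -
    have "\<bar>blinfun_apply h (y n)\<bar> \<le> B * norm h" for h
    proof -
      have "\<bar>blinfun_apply h (y n)\<bar> \<le> norm h * norm (y n)" using norm_blinfun[of h "y n"] by simp
      also have "\<dots> \<le> norm h * B" by (intro mult_left_mono B) simp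
      finally show ?thesis by (simp add: mult.commute)
    qed
    then show ?thesis unfolding K_def \<Phi>_def by (auto simp: abs_le_iff) (smt (verit))
  qed
  have "filtermap \<Phi> G \<noteq> bot" using G by (simp add: filtermap_bot_iff)
  moreover have "eventually (\<lambda>x. x \<in> K) (filtermap \<Phi> G)" by (simp add: eventually_filtermap \<Phi>K)
  ultimately obtain \<phi> where \<phi>: "\<phi> \<in> K" "inf (nhds \<phi>) (filtermap \<Phi> G) \<noteq> bot"
    using \<open>compact K\<close> unfolding compact_filter by blast
  \<comment> \<open>A refinement of \<open>G\<close> along which evaluation at \<open>y n\<close>
    converges pointwise to \<open>\<phi>\<close>; it is proper because \<open>\<phi>\<close> is a
    cluster point.\<close>
  define H where "H = inf G (filtercomap \<Phi> (nhds \<phi>))"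
  have H: "H \<noteq> bot"
  proof
    assume "H = bot"
    then have "eventually (\<lambda>_. False) H" by simp
    then obtain P Q where PQ: "eventually P G" "eventually Q (filtercomap \<Phi> (nhds \<phi>))" "\<And>n. P n \<Longrightarrow> Q n \<Longrightarrow> False"
      unfolding H_def eventually_inf by blast
    obtain R where R: "eventually R (nhds \<phi>)" "\<And>n. R (\<Phi> n) \<Longrightarrow> Q n"
      using PQ(2) unfolding eventually_filtercomap by blast
    have "eventually (\<lambda>\<psi>. \<not> R \<psi>) (filtermap \<Phi> G)"
      unfolding eventually_filtermap using PQ(1) by (rule eventually_mono) (use PQ(3) R(2) in blast)
    then have "eventually (\<lambda>_. False) (inf (nhds \<phi>) (filtermap \<Phi> G))"
      unfolding eventually_inf using R(1) by blast
    then show False using \<phi>(2) by (simp add: trivial_limit_def)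
  qed
  have HG: "H \<le> G" "H \<le> sequentially" by (auto simp: H_def G_def intro: le_infI1)
  have "filterlim \<Phi> (nhds \<phi>) H"
    unfolding H_def filterlim_def by (meson filtermap_mono filtermap_filtercomap inf_le2 order_trans)
  then have lim: "((\<lambda>n. blinfun_apply h (y n)) \<longlongrightarrow> \<phi> h) H" for h
    unfolding tendsto_def
  proof (intro allI impI)
    fix U :: "real set" assume U: "open U" "\<phi> h \<in> U"
    have "open ((\<lambda>\<psi>::('a \<Rightarrow>\<^sub>L real) \<Rightarrow> real. \<psi> h) -` U)"
      by (rule open_vimage[OF U(1) continuous_on_product_coordinates])
    then have "eventually (\<lambda>\<psi>. \<psi> \<in> (\<lambda>\<psi>. \<psi> h) -` U) (nhds \<phi>)" using U(2) by (intro eventually_nhds_in_open) auto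
    then have "eventually (\<lambda>n. \<Phi> n \<in> (\<lambda>\<psi>. \<psi> h) -` U) H"
      using \<open>filterlim \<Phi> (nhds \<phi>) H\<close> unfolding filterlim_iff by blast
    then show "eventually (\<lambda>n. blinfun_apply h (y n) \<in> U) H" by (simp add: \<Phi>_def)
  qed
  have "bounded_linear \<phi>"
  proof (rule bounded_linear_intro[where K=B])
    show "\<phi> (h + h') = \<phi> h + \<phi> h'" for h h'
      using tendsto_unique[OF H lim[of "h + h'"]] tendsto_add[OF lim[of h] lim[of h']]
      by (simp add: blinfun.add_left)
    show "\<phi> (c *\<^sub>R h) = c *\<^sub>R \<phi> h" for c h
      using tendsto_unique[OF H lim[of "c *\<^sub>R h"]] tendsto_scaleR[OF tendsto_const lim[of h], of c]
      by (simp add: blinfun.scaleR_left)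
    show "norm (\<phi> h) \<le> norm h * B" for h
    proof -
      have "\<phi> h \<in> {- (B * norm h)..B * norm h}" using \<phi>(1) by (auto simp: K_def PiE_def Pi_def)
      then show ?thesis by (auto simp: mult.commute)
    qed
  qed
  then obtain x where x: "\<And>h. \<phi> h = blinfun_apply h x" using reflexiveD[OF refl] by blast
  \<comment> \<open>On each \<open>g j\<close> the limit along \<open>H\<close> is that of a null
    sequence, and totality does the rest. So \<open>\<phi> f = 0\<close>, while \<open>H\<close>
    only sees indices where \<open>f\<close> is at least \<open>\<epsilon>\<close> in
    modulus.\<close>
  have "x = 0"
  proof (rule total)
    fix j :: nat assume "j \<ge> 1"
    then have "((\<lambda>n. blinfun_apply (g j) (y n)) \<longlongrightarrow> 0) H" using null HG(2) tendsto_mono by blast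
    then show "blinfun_apply (g j) x = 0" using tendsto_unique[OF H lim[of "g j"]] x by simp
  qed
  then have "\<phi> f = 0" using x by simp
  then have "((\<lambda>n. \<bar>blinfun_apply f (y n)\<bar>) \<longlongrightarrow> \<bar>0\<bar>) H" using tendsto_rabs[OF lim[of f]] by simp
  moreover have "eventually (\<lambda>n. \<epsilon> \<le> \<bar>blinfun_apply f (y n)\<bar>) H"
  proof -
    have "eventually (\<lambda>n. n \<in> S) G" unfolding G_def eventually_inf_principal by simp
    then show ?thesis using filter_leD[OF HG(1)] by (simp add: S_def)
  qed
  ultimately have "\<epsilon> \<le> \<bar>0\<bar>" using tendsto_lowerbound H by blast
  then show False using \<epsilon>(1) by simp
qed

section \<open>The basis and its coordinate functionals\<close>

text \<open>Schreier sets are stable under spreading: the cardinality does not grow and the minimum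
  does not drop.\<close>

lemma schreier1_image:
  assumes "F \<in> schreier1" "strict_mono r"
  shows "r ` F \<in> schreier1"
proof (cases "F = {}")
  case False
  have fin: "finite F" "card F \<le> Min F" using assms(1) False by (auto simp: schreier1_def)
  have "Min F \<le> Min (r ` F)"
  proof (rule Min.boundedI)
    fix t assume "t \<in> r ` F"
    then obtain i where i: "i \<in> F" "t = r i" by blast
    have "Min F \<le> i" using fin i by simp
    also have "i \<le> r i" using assms(2) by (rule strict_mono_imp_increasing)
    finally show "Min F \<le> t" using i by simp
  qed (use fin False in auto)
  then have "card (r ` F) \<le> Min (r ` F)" using fin card_image_le[OF fin(1), of r] by linarith
  then show ?thesis unfolding schreier1_def using fin by blast
qed (simp add: schreier1_def)

text \<open>The models \<open>N\<close> and \<open>M\<close> have to be taken along one common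
  subsequence, so the whole setting must pass to subsequences.\<close>

lemma schreier_seq_subseq:
  assumes "schreier_seq u C B" and r: "strict_mono r"
  shows "schreier_seq (\<lambda>i. u (r i)) C B"
proof -
  interpret schreier_seq u C B by fact
  have ri: "i \<le> r i" for i using r by (rule strict_mono_imp_increasing)
  have inj: "inj_on r S" for S using r by (meson inj_on_subset strict_mono_imp_inj_on subset_UNIV)
  have sums: "(\<Sum>i\<in>S. a i *\<^sub>R u (r i)) = (\<Sum>t\<in>r ` S. a (the_inv_into UNIV r t) *\<^sub>R u t)" for a and S :: "nat set"
    by (simp add: sum.reindex[OF inj] the_inv_into_f_f[OF inj])
  show ?thesis
  proof
    show "1 \<le> norm (u (r i))" if "i \<ge> 1" for i using norm_ge[of "r i"] ri[of i] that by simp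
    show "norm (u (r i)) \<le> B" for i by (rule norm_le)
    show "norm (\<Sum>i\<in>F. a i *\<^sub>R u (r i)) \<le> C * norm (\<Sum>i\<in>G. a i *\<^sub>R u (r i))"
      if FG: "finite G" "0 \<notin> G" "F \<subseteq> G" "F \<in> schreier1" for F G a
      unfolding sums
    proof (rule schreier)
      show "0 \<notin> r ` G"
      proof
        assume "0 \<in> r ` G"
        then obtain i where "i \<in> G" "r i = 0" by auto
        then show False using ri[of i] FG(2) by simp
      qed
      show "r ` F \<in> schreier1" by (rule schreier1_image[OF FG(4) r])
    qed (use FG in auto)
    show "weakly_null y"
      if B': "\<And>i. norm (y i) \<le> B'" and y: "\<And>i. i \<ge> 1 \<Longrightarrow> \<exists>A a. finite A \<and> A \<subseteq> {i..} \<and> y i = (\<Sum>t\<in>A. a t *\<^sub>R u (r t))"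
      for y B'
    proof (rule block_weakly_null[OF B'])
      fix i :: nat assume "i \<ge> 1"
      then obtain A a where A: "finite A" "A \<subseteq> {i..}" "y i = (\<Sum>t\<in>A. a t *\<^sub>R u (r t))" using y by blast
      have rA: "r ` A \<subseteq> {i..}"
      proof
        fix t assume "t \<in> r ` A"
        then obtain j where "j \<in> A" "t = r j" by blast
        then show "t \<in> {i..}" using A(2) ri[of j] by auto
      qed
      have "y i = (\<Sum>t\<in>r ` A. a (the_inv_into UNIV r t) *\<^sub>R u t)" using A(3) sums[of a A] by (rule trans)
      then show "\<exists>A a. finite A \<and> A \<subseteq> {i..} \<and> y i = (\<Sum>t\<in>A. a t *\<^sub>R u t)"
        using finite_imageI[OF A(1)] rA
        by (intro exI[of _ "r ` A"] exI[of _ "\<lambda>t. a (the_inv_into UNIV r t)"] conjI)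
    qed
    show "sm_equiv N M" if "weak_sm (x :: nat \<Rightarrow> 'a) N" "weak_sm (y :: nat \<Rightarrow> 'a) M" for x N y M
      by (rule uniq[OF that])
  qed
qed

text \<open>All coordinates are at most \<open>C * N f\<close>, so precision
  \<open>1 / (2 * C)\<close> makes the deviation at most \<open>N f / 2\<close>, with a threshold
  uniform in \<open>f\<close>.\<close>

lemma (in schreier_seq) spm_u_lower:
  assumes spN: "spm u N"
  shows "\<exists>m. \<forall>f k. below n f \<longrightarrow> strict_mono k \<longrightarrow> m \<le> k 0 \<longrightarrow> N f \<le> 2 * norm (\<Sum>i<n. f i *\<^sub>R u (k i))"
proof -
  have "1 / (2 * C) > 0" using C_pos by simp
  then obtain m where m: "\<And>f k \<mu>. below n f \<Longrightarrow> \<forall>i. \<bar>f i\<bar> \<le> \<mu> \<Longrightarrow> strict_mono k \<Longrightarrow> m \<le> k 0 \<Longrightarrow>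
      \<bar>norm (\<Sum>i<n. f i *\<^sub>R u (k i)) - N f\<bar> \<le> 1 / (2 * C) * \<mu>"
    using spN unfolding spm_def by meson
  have "N f \<le> 2 * norm (\<Sum>i<n. f i *\<^sub>R u (k i))" if f: "below n f" and k: "strict_mono k" "m \<le> k 0" for f k
  proof -
    have "\<forall>i. \<bar>f i\<bar> \<le> C * N f" using spm_u_coord[OF spN f] C_pos by (simp add: field_simps)
    from m[OF f this k] have "\<bar>norm (\<Sum>i<n. f i *\<^sub>R u (k i)) - N f\<bar> \<le> N f / 2" using C_pos by simp
    then show ?thesis by linarith
  qed
  then show ?thesis by blast
qed

section \<open>Coefficients and biorthogonal functionals\<close>

locale schreier_basis =
  fixes e :: "nat \<Rightarrow> 'a::banach" and C :: real
  assumes reflexive: "reflexive_space TYPE('a)"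
    and basis: "schauder_basis e" and normalized: "normalized_seq e"
    and uncond: "schreier_unconditional C e"
    and card: "SPw_card_one TYPE('a)" and card': "SPw_card_one TYPE('a \<Rightarrow>\<^sub>L real)"
begin

definition coef :: "'a \<Rightarrow> nat \<Rightarrow> real" where
  "coef x = (THE a. a 0 = 0 \<and> (\<lambda>n. \<Sum>i=1..n. a i *\<^sub>R e i) \<longlonglongrightarrow> x)"

lemma coef_props: "coef x 0 = 0" "(\<lambda>n. \<Sum>i=1..n. coef x i *\<^sub>R e i) \<longlonglongrightarrow> x"
proof -
  have ex1: "\<exists>!a. a 0 = 0 \<and> (\<lambda>n. \<Sum>i=1..n. a i *\<^sub>R e i) \<longlonglongrightarrow> x"
    using basis unfolding schauder_basis_def by blast
  show "coef x 0 = 0" "(\<lambda>n. \<Sum>i=1..n. coef x i *\<^sub>R e i) \<longlonglongrightarrow> x"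
    using theI'[OF ex1] unfolding coef_def by auto
qed

lemma coef_unique:
  assumes "a 0 = 0" "(\<lambda>n. \<Sum>i=1..n. a i *\<^sub>R e i) \<longlonglongrightarrow> x"
  shows "coef x = a"
  using basis assms coef_props[of x] unfolding schauder_basis_def by blast

lemma norm_e: "i \<ge> 1 \<Longrightarrow> norm (e i) = 1"
  using normalized by (simp add: normalized_seq_def)

lemma finite_series:
  assumes "finite G" "0 \<notin> G"
  shows "(\<lambda>n. \<Sum>i=1..n. (if i \<in> G then a i else 0) *\<^sub>R e i) \<longlonglongrightarrow> (\<Sum>i\<in>G. a i *\<^sub>R e i)"
proof (rule tendsto_eventually)
  have "(\<Sum>i=1..n. (if i \<in> G then a i else 0) *\<^sub>R e i) = (\<Sum>i\<in>G. a i *\<^sub>R e i)" if "n \<ge> Max (insert 0 G)" for n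
  proof (rule sum.mono_neutral_cong_right)
    show "G \<subseteq> {1..n}"
    proof
      fix i assume "i \<in> G"
      then have "i \<le> Max (insert 0 G)" "i \<noteq> 0" using assms by (auto intro: Max_ge gr0I)
      then show "i \<in> {1..n}" using that by simp
    qed
  qed auto
  then show "\<forall>\<^sub>F n in sequentially. (\<Sum>i=1..n. (if i \<in> G then a i else 0) *\<^sub>R e i) = (\<Sum>i\<in>G. a i *\<^sub>R e i)"
    unfolding eventually_sequentially by blast
qed

lemma coef_finite:
  assumes "finite G" "0 \<notin> G"
  shows "coef (\<Sum>i\<in>G. a i *\<^sub>R e i) = (\<lambda>i. if i \<in> G then a i else 0)"
  by (rule coef_unique[OF _ finite_series]) (use assms in auto)

lemma coef_add: "coef (x + y) = (\<lambda>i. coef x i + coef y i)"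
  by (rule coef_unique)
    (use tendsto_add[OF coef_props(2)[of x] coef_props(2)[of y]] in \<open>auto simp: coef_props scaleR_add_left sum.distrib\<close>)

lemma coef_scale: "coef (c *\<^sub>R x) = (\<lambda>i. c * coef x i)"
proof (rule coef_unique)
  have "(\<lambda>n. c *\<^sub>R (\<Sum>i=1..n. coef x i *\<^sub>R e i)) \<longlonglongrightarrow> c *\<^sub>R x" by (intro tendsto_intros coef_props)
  then show "(\<lambda>n. \<Sum>i=1..n. (c * coef x i) *\<^sub>R e i) \<longlonglongrightarrow> c *\<^sub>R x" by (simp add: scaleR_sum_right)
qed (simp add: coef_props)

lemma proj_le: "F \<in> schreier1 \<Longrightarrow> norm (\<Sum>i\<in>F. coef x i *\<^sub>R e i) \<le> C * norm x"
  using uncond coef_props(2)[of x] unfolding schreier_unconditional_def by blast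

lemma C_ge1: "C \<ge> 1"
proof -
  have "{1} \<in> schreier1" by (simp add: schreier1_def)
  moreover have "coef (e 1) = (\<lambda>i. if i \<in> {1} then 1 else 0)" using coef_finite[of "{1}" "\<lambda>_. 1"] by simp
  ultimately show ?thesis using proj_le[of "{1}" "e 1"] norm_e[of 1] by simp
qed

text \<open>Singletons are Schreier sets, so the unconditionality assumption itself bounds the
  coordinate functionals.\<close>

lemma coef_bound: "\<bar>coef x j\<bar> \<le> C * norm x"
proof (cases "j = 0")
  case True
  then show ?thesis using coef_props(1) C_ge1 by simp
next
  case False
  then have "{j} \<in> schreier1" by (simp add: schreier1_def)
  then show ?thesis using proj_le[of "{j}" x] norm_e[of j] False by simp
qed

definition dual :: "nat \<Rightarrow> 'a \<Rightarrow>\<^sub>L real" where "dual j = Blinfun (\<lambda>x. coef x j)"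

lemma dual_apply: "blinfun_apply (dual j) x = coef x j"
proof -
  have "bounded_linear (\<lambda>x. coef x j)"
    by (rule bounded_linear_intro[where K=C]) (use coef_bound in \<open>auto simp: coef_add coef_scale mult.commute\<close>)
  then show ?thesis unfolding dual_def by (simp add: bounded_linear_Blinfun_apply)
qed

lemma coef_total: "(\<And>j. j \<ge> 1 \<Longrightarrow> coef x j = 0) \<Longrightarrow> x = 0"
  using coef_props(2)[of x] by (simp add: LIMSEQ_const_iff)

text \<open>For weak nullness: every coordinate functional vanishes on late blocks, and together
  they separate points, so \<open>reflexive_weakly_null\<close> applies.\<close>

lemma schreier_seq_e: "schreier_seq e C (1 + norm (e 0))"
proof
  show "1 \<le> norm (e i)" if "i \<ge> 1" for i using norm_e[OF that] by simp
  show "norm (e i) \<le> 1 + norm (e 0)" for i using norm_e[of i] by (cases "i = 0") auto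
  show "norm (\<Sum>i\<in>F. a i *\<^sub>R e i) \<le> C * norm (\<Sum>i\<in>G. a i *\<^sub>R e i)"
    if "finite G" "0 \<notin> G" "F \<subseteq> G" "F \<in> schreier1" for F G a
  proof -
    have "(\<Sum>i\<in>F. a i *\<^sub>R e i) = (\<Sum>i\<in>F. coef (\<Sum>i\<in>G. a i *\<^sub>R e i) i *\<^sub>R e i)"
      using that by (intro sum.cong refl) (auto simp: coef_finite)
    then show ?thesis using proj_le[OF that(4)] by simp
  qed
  show "sm_equiv N M" if "weak_sm (x :: nat \<Rightarrow> 'a) N" "weak_sm (y :: nat \<Rightarrow> 'a) M" for x N y M
    using card that unfolding SPw_card_one_def by blast
  show "weakly_null y"
    if B': "\<And>i. norm (y i) \<le> B'" and y: "\<And>i. i \<ge> 1 \<Longrightarrow> \<exists>A a. finite A \<and> A \<subseteq> {i..} \<and> y i = (\<Sum>t\<in>A. a t *\<^sub>R e t)"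
    for y B'
  proof (rule reflexive_weakly_null[OF reflexive, of dual])
    show "x = 0" if "\<And>j. j \<ge> 1 \<Longrightarrow> blinfun_apply (dual j) x = 0" for x
      by (rule coef_total) (use that in \<open>simp add: dual_apply\<close>)
    show "norm (y i) \<le> B'" for i by (rule B')
    fix j :: nat
    have "blinfun_apply (dual j) (y i) = 0" if ij: "i > j" for i
    proof -
      have "i \<ge> 1" using ij by simp
      then obtain A a where A: "finite A" "A \<subseteq> {i..}" "y i = (\<Sum>t\<in>A. a t *\<^sub>R e t)" using y by blast
      have "0 \<notin> A" "j \<notin> A" using A(2) ij by auto
      then show ?thesis using A by (simp add: dual_apply coef_finite)
    qed
    then show "(\<lambda>i. blinfun_apply (dual j) (y i)) \<longlonglongrightarrow> 0"
      by (intro tendsto_eventually) (auto simp: eventually_sequentially intro!: exI[of _ "Suc j"])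
  qed
qed

lemma sum_dual_apply: "blinfun_apply (\<Sum>i\<in>F. a i *\<^sub>R dual i) x = (\<Sum>i\<in>F. a i * coef x i)"
  by (simp add: blinfun.sum_left blinfun.scaleR_left dual_apply)

text \<open>The projection onto a Schreier set has norm at most \<open>C\<close>, and so has its
  adjoint, which is the projection needed for functionals. For weak nullness, a functional on the
  dual is evaluation at some \<open>x\<close>; late blocks annihilate a partial sum of
  \<open>x\<close> that is close to \<open>x\<close>.\<close>

lemma schreier_seq_dual: "schreier_seq dual C C"
proof
  show "1 \<le> norm (dual i)" if "i \<ge> 1" for i
  proof -
    have "coef (e i) i = 1" using coef_finite[of "{i}" "\<lambda>_. 1"] that by simp
    then show ?thesis using norm_blinfun[of "dual i" "e i"] norm_e[OF that] by (simp add: dual_apply)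
  qed
  show "norm (dual i) \<le> C" for i
    by (rule norm_blinfun_bound) (use C_ge1 coef_bound in \<open>auto simp: dual_apply\<close>)
  show "norm (\<Sum>i\<in>F. a i *\<^sub>R dual i) \<le> C * norm (\<Sum>i\<in>G. a i *\<^sub>R dual i)"
    if FG: "finite G" "0 \<notin> G" "F \<subseteq> G" "F \<in> schreier1" for F G a
  proof (rule norm_blinfun_bound)
    fix x
    have finF: "finite F" "0 \<notin> F" using FG finite_subset by auto
    define z where "z = (\<Sum>i\<in>F. coef x i *\<^sub>R e i)"
    have "blinfun_apply (\<Sum>i\<in>G. a i *\<^sub>R dual i) z = (\<Sum>i\<in>F. a i * coef x i)"
      unfolding sum_dual_apply z_def coef_finite[OF finF]
      by (rule sum.mono_neutral_cong_right) (use FG in auto)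
    then have "norm (blinfun_apply (\<Sum>i\<in>F. a i *\<^sub>R dual i) x) = norm (blinfun_apply (\<Sum>i\<in>G. a i *\<^sub>R dual i) z)"
      by (simp add: sum_dual_apply)
    also have "\<dots> \<le> norm (\<Sum>i\<in>G. a i *\<^sub>R dual i) * norm z" by (rule norm_blinfun)
    also have "\<dots> \<le> norm (\<Sum>i\<in>G. a i *\<^sub>R dual i) * (C * norm x)"
      unfolding z_def by (intro mult_left_mono proj_le FG) simp
    finally show "norm (blinfun_apply (\<Sum>i\<in>F. a i *\<^sub>R dual i) x) \<le> C * norm (\<Sum>i\<in>G. a i *\<^sub>R dual i) * norm x"
      by (simp add: mult_ac)
  qed (use C_ge1 in simp)
  show "sm_equiv N M" if "weak_sm (x :: nat \<Rightarrow> 'a \<Rightarrow>\<^sub>L real) N" "weak_sm (y :: nat \<Rightarrow> 'a \<Rightarrow>\<^sub>L real) M" for x N y M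
    using card' that unfolding SPw_card_one_def by blast
  show "weakly_null y"
    if B': "\<And>i. norm (y i) \<le> B'" and y: "\<And>i. i \<ge> 1 \<Longrightarrow> \<exists>A a. finite A \<and> A \<subseteq> {i..} \<and> y i = (\<Sum>t\<in>A. a t *\<^sub>R dual t)"
    for y B'
    unfolding weakly_null_def
  proof
    fix \<phi> :: "('a \<Rightarrow>\<^sub>L real) \<Rightarrow>\<^sub>L real"
    obtain x where x: "\<And>f. blinfun_apply \<phi> f = blinfun_apply f x"
      using reflexiveD[OF reflexive blinfun.bounded_linear_right[of \<phi>]] by blast
    have B0: "B' \<ge> 0" using B'[of 0] norm_ge_zero order_trans by blast
    show "(\<lambda>n. blinfun_apply \<phi> (y n)) \<longlonglongrightarrow> 0"
      unfolding x
    proof (rule metric_LIMSEQ_I)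
      fix \<epsilon> :: real assume \<epsilon>: "\<epsilon> > 0"
      then have "\<epsilon> / (B' + 1) > 0" using B0 by simp
      then obtain n where n: "norm ((\<Sum>i=1..n. coef x i *\<^sub>R e i) - x) < \<epsilon> / (B' + 1)"
        using metric_LIMSEQ_D[OF coef_props(2)[of x]] by (auto simp: dist_norm)
      define s where "s = (\<Sum>i=1..n. coef x i *\<^sub>R e i)"
      have "dist (blinfun_apply (y i) x) 0 < \<epsilon>" if i: "i \<ge> Suc n" for i
      proof -
        have "i \<ge> 1" using i by simp
        then obtain A a where A: "finite A" "A \<subseteq> {i..}" "y i = (\<Sum>t\<in>A. a t *\<^sub>R dual t)" using y by blast
        have "coef s t = 0" if "t \<in> A" for t
          using that A(2) i unfolding s_def by (subst coef_finite) auto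
        then have "blinfun_apply (y i) s = 0" unfolding A(3) sum_dual_apply by simp
        then have "\<bar>blinfun_apply (y i) x\<bar> = norm (blinfun_apply (y i) (s - x))" by (simp add: blinfun.diff_right)
        also have "\<dots> \<le> norm (y i) * norm (s - x)" by (rule norm_blinfun)
        also have "\<dots> \<le> B' * (\<epsilon> / (B' + 1))"
          using n B0 B' by (intro mult_mono) (auto simp: s_def)
        also have "\<dots> < \<epsilon>" using \<epsilon> B0 by (simp add: field_simps)
        finally show ?thesis by (simp add: dist_real_def)
      qed
      then show "\<exists>N. \<forall>i\<ge>N. dist (blinfun_apply (y i) x) 0 < \<epsilon>" by blast
    qed
  qed
qed

section \<open>The pair of dual spreading models\<close>

text \<open>Biorthogonality passes to the limit and becomes \<open>pairing\<close>. The norming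
  properties hold because restricting the coefficients of \<open>x\<close> to a Schreier set costs
  only \<open>C\<close>, so functionals on \<open>n\<close> late coordinates extend to the whole
  space with control.\<close>

lemma dual_models_exist:
  "\<exists>r N M K R. strict_mono r \<and> spm (\<lambda>i. e (r i)) N \<and> dual_models N M (2 * C) (1 / C) (2 * C) (1 / C) K R"
proof -
  interpret E: schreier_seq e C "1 + norm (e 0)" by (rule schreier_seq_e)
  interpret E': schreier_seq dual C C by (rule schreier_seq_dual)
  obtain r1 N where r1: "strict_mono r1" "spm (\<lambda>i. e (r1 i)) N"
    using spm_subsequence_exists[of e] E.norm_le by blast
  obtain r2 M where r2: "strict_mono r2" "spm (\<lambda>i. dual (r1 (r2 i))) M"
    using spm_subsequence_exists[of "\<lambda>i. dual (r1 i)"] E'.norm_le by blast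
  define r where "r i = r1 (r2 i)" for i
  have r: "strict_mono r" using strict_mono_o[OF r1(1) r2(1)] by (simp add: o_def r_def[abs_def])
  have ri: "i \<le> r i" for i using r by (rule strict_mono_imp_increasing)
  define u where "u i = e (r i)" for i
  define v where "v i = dual (r i)" for i
  have spN: "spm u N" unfolding u_def r_def using spm_subseq[OF r1(2) r2(1)] .
  have spM: "spm v M" unfolding v_def r_def using r2(2) .
  interpret U: schreier_seq u C "1 + norm (e 0)" unfolding u_def by (rule schreier_seq_subseq[OF schreier_seq_e r])
  interpret V: schreier_seq v C C unfolding v_def by (rule schreier_seq_subseq[OF schreier_seq_dual r])
  interpret SN: subsym N "2 * C" "1 / C" by (rule U.spm_u_subsym[OF spN])
  interpret SM: subsym M "2 * C" "1 / C" by (rule V.spm_u_subsym[OF spM])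
  have C0: "C > 0" using C_ge1 by simp
  obtain K1 where K1: "K1 > 0" "\<And>n a m b. below n a \<Longrightarrow> below m b \<Longrightarrow> N (tens m a b) \<le> K1 * (N a * N b)"
    using U.tensor_upper[OF spN] by blast
  obtain K2 where K2: "K2 > 0" "\<And>n a m b. below n a \<Longrightarrow> below m b \<Longrightarrow> M (tens m a b) \<le> K2 * (M a * M b)"
    using V.tensor_upper[OF spM] by blast
  define K where "K = K1 + K2"
  \<comment> \<open>The value comes from norming \<open>M\<close>, by coefficients of a vector of
    norm at most 4 and hence of \<open>N\<close>-norm at most \<open>2 * C * 4\<close>. Norming
    \<open>N\<close> gives \<open>4 * C\<close>.\<close>
  define R where "R = 8 * C"
  have ev: "blinfun_apply (\<Sum>i<n. b i *\<^sub>R v (k i)) x = (\<Sum>i<n. b i * coef x (r (k i)))" for n b k x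
    by (simp add: blinfun.sum_left blinfun.scaleR_left v_def dual_apply)
  have bi: "coef (\<Sum>i<n. a i *\<^sub>R u (k i)) (r (k j)) = a j"
    if k: "strict_mono k" "1 \<le> k 0" and j: "j < n" for k :: "nat \<Rightarrow> nat" and n a j
  proof -
    have rk: "strict_mono (\<lambda>i. r (k i))" using strict_mono_o[OF r k(1)] by (simp add: o_def)
    have inj: "inj_on (\<lambda>i. r (k i)) S" for S using rk by (meson inj_on_subset strict_mono_imp_inj_on subset_UNIV)
    have "(\<Sum>i<n. a i *\<^sub>R u (k i)) = (\<Sum>t\<in>(\<lambda>i. r (k i)) ` {..<n}. a (the_inv_into UNIV (\<lambda>i. r (k i)) t) *\<^sub>R e t)"
      by (simp add: sum.reindex[OF inj] the_inv_into_f_f[OF inj] u_def)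
    moreover have "0 \<notin> (\<lambda>i. r (k i)) ` {..<n}"
    proof
      assume "0 \<in> (\<lambda>i. r (k i)) ` {..<n}"
      then obtain i where "r (k i) = 0" by auto
      moreover have "k 0 \<le> k i" using k(1) by (simp add: strict_mono_less_eq)
      ultimately show False using ri[of "k i"] k(2) by simp
    qed
    ultimately have "coef (\<Sum>i<n. a i *\<^sub>R u (k i)) = (\<lambda>t. if t \<in> (\<lambda>i. r (k i)) ` {..<n} then a (the_inv_into UNIV (\<lambda>i. r (k i)) t) else 0)"
      by (simp add: coef_finite)
    then show ?thesis using j the_inv_into_f_f[OF inj, of j UNIV] by simp
  qed
  have prj: "norm (\<Sum>i<n. coef x (r (k i)) *\<^sub>R u (k i)) \<le> C * norm x" if k: "strict_mono k" "n \<le> k 0" for x n and k :: "nat \<Rightarrow> nat"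
  proof -
    have rk: "strict_mono (\<lambda>i. r (k i))" using strict_mono_o[OF r k(1)] by (simp add: o_def)
    have inj: "inj_on (\<lambda>i. r (k i)) S" for S using rk by (meson inj_on_subset strict_mono_imp_inj_on subset_UNIV)
    have ge: "n \<le> r (k i)" for i
    proof -
      have "k 0 \<le> k i" using k(1) by (simp add: strict_mono_less_eq)
      then show ?thesis using ri[of "k i"] k(2) by linarith
    qed
    have "(\<lambda>i. r (k i)) ` {..<n} \<in> schreier1"
      unfolding schreier1_def using ge by (auto simp: card_image[OF inj])
    from proj_le[OF this, of x] show ?thesis by (simp add: sum.reindex[OF inj] u_def)
  qed
  have "dual_models N M (2 * C) (1 / C) (2 * C) (1 / C) K R"
  proof
    show "K > 0" "R > 0" using K1 K2 C0 by (auto simp: K_def R_def)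
    show "N (tens m a b) \<le> K * (N a * N b)" if ab: "below n a" "below m b" for n m a b
    proof -
      have "N (tens m a b) \<le> K1 * (N a * N b)" by (rule K1(2)[OF ab])
      also have "\<dots> \<le> K * (N a * N b)" unfolding K_def
        using K2(1) SN.N_nonneg[OF ab(1)] SN.N_nonneg[OF ab(2)] by (intro mult_right_mono mult_nonneg_nonneg) auto
      finally show ?thesis .
    qed
    show "M (tens m a b) \<le> K * (M a * M b)" if ab: "below n a" "below m b" for n m a b
    proof -
      have "M (tens m a b) \<le> K2 * (M a * M b)" by (rule K2(2)[OF ab])
      also have "\<dots> \<le> K * (M a * M b)" unfolding K_def
        using K1(1) SM.N_nonneg[OF ab(1)] SM.N_nonneg[OF ab(2)] by (intro mult_right_mono mult_nonneg_nonneg) auto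
      finally show ?thesis .
    qed
    show "(\<Sum>i<n. a i * b i) \<le> N a * M b" if ab: "below n a" "below n b" for n a b
    proof (rule LIMSEQ_le_const)
      define k where "k m i = i + Suc m" for m i :: nat
      have k: "strict_mono (k m)" "m \<le> k m 0" "1 \<le> k m 0" for m by (auto simp: k_def strict_mono_def)
      show "(\<lambda>m. norm (\<Sum>i<n. a i *\<^sub>R u (k m i)) * norm (\<Sum>i<n. b i *\<^sub>R v (k m i))) \<longlonglongrightarrow> N a * M b"
        by (intro tendsto_mult spm_tendsto[OF spN ab(1) k(1,2)] spm_tendsto[OF spM ab(2) k(1,2)])
      have "(\<Sum>i<n. a i * b i) \<le> norm (\<Sum>i<n. a i *\<^sub>R u (k m i)) * norm (\<Sum>i<n. b i *\<^sub>R v (k m i))" for m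
      proof -
        have "(\<Sum>i<n. a i * b i) = blinfun_apply (\<Sum>i<n. b i *\<^sub>R v (k m i)) (\<Sum>i<n. a i *\<^sub>R u (k m i))"
          unfolding ev
        proof (rule sum.cong[OF refl])
          fix j assume "j \<in> {..<n}"
          then have "coef (\<Sum>i<n. a i *\<^sub>R u (k m i)) (r (k m j)) = a j" by (intro bi[OF k(1,3)]) simp
          then show "a j * b j = b j * coef (\<Sum>i<n. a i *\<^sub>R u (k m i)) (r (k m j))" by simp
        qed
        also have "\<dots> \<le> norm (\<Sum>i<n. b i *\<^sub>R v (k m i)) * norm (\<Sum>i<n. a i *\<^sub>R u (k m i))"
          using norm_blinfun[of "\<Sum>i<n. b i *\<^sub>R v (k m i)" "\<Sum>i<n. a i *\<^sub>R u (k m i)"] by simp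
        finally show ?thesis by (simp add: mult.commute)
      qed
      then show "\<exists>N. \<forall>m\<ge>N. (\<Sum>i<n. a i * b i) \<le> norm (\<Sum>i<n. a i *\<^sub>R u (k m i)) * norm (\<Sum>i<n. b i *\<^sub>R v (k m i))" by blast
    qed
    fix n :: nat
    obtain m1 where m1: "\<And>f k. below n f \<Longrightarrow> strict_mono k \<Longrightarrow> m1 \<le> k 0 \<Longrightarrow> N f \<le> 2 * norm (\<Sum>i<n. f i *\<^sub>R u (k i))"
      using U.spm_u_lower[OF spN, of n] by blast
    obtain m2 where m2: "\<And>f k. below n f \<Longrightarrow> strict_mono k \<Longrightarrow> m2 \<le> k 0 \<Longrightarrow> M f \<le> 2 * norm (\<Sum>i<n. f i *\<^sub>R v (k i))"
      using V.spm_u_lower[OF spM, of n] by blast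
    \<comment> \<open>Places beyond both thresholds, where actual norms control the limit norms up
      to a factor 2, and beyond \<open>n\<close>, so that they form a Schreier set.\<close>
    define k where "k i = i + (m1 + m2 + n + 1)" for i :: nat
    have k: "strict_mono k" "m1 \<le> k 0" "m2 \<le> k 0" "n \<le> k 0" "1 \<le> k 0" by (auto simp: k_def strict_mono_def)
    have \<xi>: "N (\<lambda>i. if i < n then coef x (r (k i)) else 0) \<le> 2 * C * norm x" for x
    proof -
      have "N (\<lambda>i. if i < n then coef x (r (k i)) else 0) \<le> 2 * norm (\<Sum>i<n. (if i < n then coef x (r (k i)) else 0) *\<^sub>R u (k i))"
        by (rule m1[OF _ k(1,2)]) (simp add: below_def)
      also have "(\<Sum>i<n. (if i < n then coef x (r (k i)) else 0) *\<^sub>R u (k i)) = (\<Sum>i<n. coef x (r (k i)) *\<^sub>R u (k i))"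
        by (intro sum.cong) auto
      finally show ?thesis using prj[OF k(1,4), of x] by simp
    qed
    show "\<exists>b. below n b \<and> M b \<le> R \<and> N a \<le> (\<Sum>i<n. a i * b i)" if a: "below n a" for a
    proof -
      have "sublin n N"
        unfolding sublin_def using SN.triangle SN.scale by auto
      then obtain b where b: "below n b" "N a \<le> (\<Sum>i<n. a i * b i)" "\<And>f. below n f \<Longrightarrow> (\<Sum>i<n. f i * b i) \<le> N f"
        using finite_Hahn_Banach[OF _ a] by blast
      \<comment> \<open>By \<open>\<xi>\<close>, domination by \<open>N\<close> on coefficient
        vectors becomes boundedness on the whole space.\<close>
      have half: "(\<Sum>i<n. b i * coef x (r (k i))) \<le> 2 * C * norm x" for x
      proof -
        have "(\<Sum>i<n. b i * coef x (r (k i))) = (\<Sum>i<n. (if i < n then coef x (r (k i)) else 0) * b i)"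
          by (intro sum.cong) auto
        also have "\<dots> \<le> N (\<lambda>i. if i < n then coef x (r (k i)) else 0)" by (rule b(3)) (simp add: below_def)
        also have "\<dots> \<le> 2 * C * norm x" by (rule \<xi>)
        finally show ?thesis .
      qed
      have "norm (\<Sum>i<n. b i *\<^sub>R v (k i)) \<le> 2 * C"
      proof (rule norm_blinfun_bound)
        fix x
        have "- (\<Sum>i<n. b i * coef x (r (k i))) = (\<Sum>i<n. b i * coef ((-1) *\<^sub>R x) (r (k i)))"
          unfolding coef_scale by (simp add: sum_negf)
        also have "\<dots> \<le> 2 * C * norm x" using half[of "(-1) *\<^sub>R x"] by simp
        finally show "norm (blinfun_apply (\<Sum>i<n. b i *\<^sub>R v (k i)) x) \<le> 2 * C * norm x"
          unfolding ev using half[of x] by (simp add: abs_le_iff)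
      qed (use C0 in simp)
      then have "M b \<le> R" using m2[OF b(1) k(1,3)] C0 by (simp add: R_def)
      then show ?thesis using b by blast
    qed
    show "\<exists>a. below n a \<and> N a \<le> R \<and> M b \<le> (\<Sum>i<n. a i * b i)" if b: "below n b" for b
    proof (cases "M b \<le> 0")
      case True
      then show ?thesis using SN.N_zero C0 by (intro exI[of _ "\<lambda>_. 0"]) (simp add: below_def R_def)
    next
      case False
      define F where "F = (\<Sum>i<n. b i *\<^sub>R v (k i))"
      have MF: "M b \<le> 2 * norm F" unfolding F_def by (rule m2[OF b k(1,3)])
      then have F0: "norm F > 0" using False by linarith
      have "\<exists>x. norm F / 2 * norm x < norm (blinfun_apply F x)"
      proof (rule ccontr)
        assume "\<not> ?thesis"
        then have "norm F \<le> norm F / 2" by (intro norm_blinfun_bound) (auto simp: not_less)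
        then show False using F0 by simp
      qed
      then obtain x where x: "norm F / 2 * norm x < \<bar>blinfun_apply F x\<bar>" by auto
      then have x0: "norm x > 0" by (cases "x = 0") auto
      \<comment> \<open>The norm 4 is made of a factor 2 from \<open>M b \<le> 2 * norm F\<close>
        and another one because \<open>x\<close> attains only more than half of
        \<open>norm F\<close>.\<close>
      define t where "t = 4 * sgn (blinfun_apply F x) / norm x"
      have tx: "norm (t *\<^sub>R x) \<le> 4" using x0 by (simp add: t_def abs_mult abs_sgn_eq)
      have Ft: "blinfun_apply F (t *\<^sub>R x) = 4 * \<bar>blinfun_apply F x\<bar> / norm x"
        by (simp add: blinfun.scaleR_right t_def abs_sgn mult.commute)
      have "M b \<le> 4 * (norm F / 2)" using MF by simp
      also have "\<dots> \<le> 4 * \<bar>blinfun_apply F x\<bar> / norm x" using x x0 by (simp add: field_simps)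
      finally have 1: "M b \<le> blinfun_apply F (t *\<^sub>R x)" unfolding Ft .
      define a where "a i = (if i < n then coef (t *\<^sub>R x) (r (k i)) else 0)" for i
      have "N a \<le> 2 * C * norm (t *\<^sub>R x)" unfolding a_def by (rule \<xi>)
      also have "\<dots> \<le> 2 * C * 4" by (intro mult_left_mono tx) (use C0 in simp)
      finally have "N a \<le> R" by (simp add: R_def)
      moreover have "blinfun_apply F (t *\<^sub>R x) = (\<Sum>i<n. a i * b i)"
        unfolding F_def ev by (intro sum.cong refl) (simp add: a_def)
      moreover have "below n a" by (simp add: a_def below_def)
      ultimately show ?thesis using 1 by auto
    qed
  qed
  with r spN show ?thesis unfolding u_def by blast
qed

section \<open>Transfer to arbitrary weakly null sequences\<close>

text \<open>The dichotomy is known for the model \<open>N\<close> of a subsequence of the basis;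
  uniqueness carries it to \<open>N0\<close>, with constants \<open>A\<close> from the equivalence
  and \<open>l\<close> from normalizing \<open>N\<close>.\<close>

theorem spreading_model_c0_or_lp:
  assumes "weak_sm (x :: nat \<Rightarrow> 'a) N0"
  shows "sm_equiv_c0 N0 \<or> (\<exists>p\<ge>1. sm_equiv_lp p N0)"
proof -
  obtain r N M K R where r: "strict_mono r" and spN: "spm (\<lambda>i. e (r i)) N"
    and D: "dual_models N M (2 * C) (1 / C) (2 * C) (1 / C) K R" using dual_models_exist by blast
  interpret dual_models N M "2 * C" "1 / C" "2 * C" "1 / C" K R by (rule D)
  interpret U: schreier_seq "\<lambda>i. e (r i)" C "1 + norm (e 0)" by (rule schreier_seq_subseq[OF schreier_seq_e r])
  obtain x' :: "nat \<Rightarrow> 'a" where x': "weak_sm x' (\<lambda>f. N f / N unit0)" using U.u_weak_sm(1)[OF spN] by blast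
  define l where "l = N unit0"
  have l: "l > 0" unfolding l_def by (rule U.u_weak_sm(2)[OF spN])
  have C0: "C > 0" using C_ge1 by simp
  obtain A where A: "A > 0" "\<And>n a. N0 (trunc n a) \<le> A * (N (trunc n a) / l)" "\<And>n a. N (trunc n a) / l \<le> A * N0 (trunc n a)"
    using U.uniq[OF assms x'] unfolding sm_equiv_def l_def by blast
  have A2: "N (trunc n a) \<le> l * A * N0 (trunc n a)" for n a using A(3)[of n a] l by (simp add: field_simps)
  have A1: "N0 (trunc n a) \<le> A / l * N (trunc n a)" for n a using A(2)[of n a] by simp
  from c0_or_lp show ?thesis
  proof
    assume "\<exists>D>0. \<forall>n f \<mu>. below n f \<longrightarrow> (\<forall>i. \<bar>f i\<bar> \<le> \<mu>) \<longrightarrow> N f \<le> D * \<mu>"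
    then obtain D where D: "D > 0" "\<And>n f \<mu>. below n f \<Longrightarrow> \<forall>i. \<bar>f i\<bar> \<le> \<mu> \<Longrightarrow> N f \<le> D * \<mu>" by blast
    define E where "E = A / l * D + C * (l * A)"
    have E: "A / l * D \<le> E" "C * (l * A) \<le> E" "E > 0" using A l D C0 by (auto simp: E_def add_pos_pos)
    have "N0 (trunc n a) \<le> E * Max ((\<lambda>i. \<bar>a i\<bar>) ` {1..n}) \<and> Max ((\<lambda>i. \<bar>a i\<bar>) ` {1..n}) \<le> E * N0 (trunc n a)"
      if n: "n \<ge> 1" for n a
    proof -
      define \<mu> where "\<mu> = Max ((\<lambda>i. \<bar>a i\<bar>) ` {1..n})"
      have "\<mu> \<in> (\<lambda>i. \<bar>a i\<bar>) ` {1..n}" unfolding \<mu>_def using n by (intro Max_in) auto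
      then obtain j where j: "j \<in> {1..n}" "\<mu> = \<bar>a j\<bar>" by blast
      have \<mu>0: "\<mu> \<ge> 0" using j by simp
      have le: "\<bar>trunc n a i\<bar> \<le> \<mu>" for i
      proof (cases "i \<in> {1..n}")
        case True
        then show ?thesis unfolding \<mu>_def by (auto simp: trunc_def intro!: Max_ge)
      qed (use \<mu>0 in \<open>auto simp: trunc_def\<close>)
      have "N0 (trunc n a) \<le> A / l * N (trunc n a)" by (rule A1)
      also have "\<dots> \<le> A / l * (D * \<mu>)" using A l D(2)[OF below_trunc, of n a \<mu>] le by (intro mult_left_mono) auto
      also have "\<dots> \<le> E * \<mu>" using mult_right_mono[OF E(1) \<mu>0] by simp
      finally have 1: "N0 (trunc n a) \<le> E * \<mu>" .
      \<comment> \<open>The lower estimate of the \<open>c\<^sub>0\<close> case: the coordinate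
        bound for \<open>N\<close> at the largest coefficient.\<close>
      have "trunc n a j = a j" using j by (auto simp: trunc_def)
      then have "(1 / C) * \<mu> \<le> N (trunc n a)" using N.coord[OF below_trunc, of n a j] j by simp
      then have "\<mu> \<le> C * N (trunc n a)" using C0 by (simp add: field_simps)
      also have "\<dots> \<le> C * (l * A * N0 (trunc n a))" using A2 C0 by (intro mult_left_mono) auto
      finally have 2: "\<mu> \<le> (C * (l * A)) * N0 (trunc n a)" by (simp add: mult_ac)
      have "0 \<le> N0 (trunc n a)"
      proof -
        have "0 \<le> l * A * N0 (trunc n a)" using A2[of n a] N.N_nonneg[OF below_trunc, of n a] by linarith
        then show ?thesis using mult_pos_pos[OF l A(1)] by (intro mult_left_le_imp_le[of "l * A" 0]) auto
      qed
      then have "(C * (l * A)) * N0 (trunc n a) \<le> E * N0 (trunc n a)" by (rule mult_right_mono[OF E(2)])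
      then show ?thesis using 1 2 unfolding \<mu>_def by linarith
    qed
    then have "sm_equiv_c0 N0" unfolding sm_equiv_c0_def using E(3) by blast
    then show ?thesis ..
  next
    assume "\<exists>p\<ge>1. \<exists>D>0. \<forall>n f. below n f \<longrightarrow> N f \<le> D * (\<Sum>i<n. \<bar>f i\<bar> powr p) powr (1/p)
      \<and> (\<Sum>i<n. \<bar>f i\<bar> powr p) powr (1/p) \<le> D * N f"
    then obtain p D where p: "p \<ge> 1" and D: "D > 0" "\<And>n f. below n f \<Longrightarrow> N f \<le> D * (\<Sum>i<n. \<bar>f i\<bar> powr p) powr (1/p)
      \<and> (\<Sum>i<n. \<bar>f i\<bar> powr p) powr (1/p) \<le> D * N f" by blast
    define E where "E = A / l * D + D * (l * A)"
    have E: "A / l * D \<le> E" "D * (l * A) \<le> E" "E > 0" using A l D(1) by (auto simp: E_def add_pos_pos)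
    have "N0 (trunc n a) \<le> E * (\<Sum>i=1..n. \<bar>a i\<bar> powr p) powr (1/p) \<and> (\<Sum>i=1..n. \<bar>a i\<bar> powr p) powr (1/p) \<le> E * N0 (trunc n a)"
      for n a
    proof -
      define S where "S = (\<Sum>i=1..n. \<bar>a i\<bar> powr p) powr (1/p)"
      have "(\<Sum>i<Suc n. \<bar>trunc n a i\<bar> powr p) = (\<Sum>i=1..n. \<bar>a i\<bar> powr p)"
        by (rule sum.mono_neutral_cong_right) (auto simp: trunc_def)
      then have S: "N (trunc n a) \<le> D * S" "S \<le> D * N (trunc n a)"
        using D(2)[OF below_trunc, of n a] by (auto simp: S_def)
      have S0: "S \<ge> 0" by (simp add: S_def)
      have "N0 (trunc n a) \<le> A / l * N (trunc n a)" by (rule A1)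
      also have "\<dots> \<le> A / l * (D * S)" using A l S(1) by (intro mult_left_mono) auto
      also have "\<dots> \<le> E * S" using mult_right_mono[OF E(1) S0] by simp
      finally have 1: "N0 (trunc n a) \<le> E * S" .
      have "S \<le> D * (l * A * N0 (trunc n a))" using S(2) A2 D(1) by (meson less_imp_le mult_left_mono order_trans)
      then have 2: "S \<le> (D * (l * A)) * N0 (trunc n a)" by (simp add: mult_ac)
      have "0 \<le> N0 (trunc n a)"
      proof -
        have "0 \<le> l * A * N0 (trunc n a)" using A2[of n a] N.N_nonneg[OF below_trunc, of n a] by linarith
        then show ?thesis using mult_pos_pos[OF l A(1)] by (intro mult_left_le_imp_le[of "l * A" 0]) auto
      qed
      then have "(D * (l * A)) * N0 (trunc n a) \<le> E * N0 (trunc n a)" by (rule mult_right_mono[OF E(2)])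
      then show ?thesis using 1 2 unfolding S_def by linarith
    qed
    then have "sm_equiv_lp p N0" unfolding sm_equiv_lp_def using E(3) by blast
    then show ?thesis using p by blast
  qed
qed

end

theorem theorem1p11:
  fixes e :: "nat \<Rightarrow> 'a::banach" and C :: real
  assumes "reflexive_space TYPE('a)"
    and "schauder_basis e" and "normalized_seq e"
    and "schreier_unconditional C e"
    and "SPw_card_one TYPE('a)"
    and "SPw_card_one TYPE('a \<Rightarrow>\<^sub>L real)"
  shows "\<forall>(x::nat \<Rightarrow> 'a) N. weak_sm x N \<longrightarrow>
           sm_equiv_c0 N \<or> (\<exists>p\<ge>1. sm_equiv_lp p N)"
proof -
  interpret schreier_basis e C using assms by unfold_locales
  show ?thesis using spreading_model_c0_or_lp by blast
qed

end
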